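(* Let $n\ge1$, $\lambda>1$ and $s>0$. Define $$m(\xi):=\frac{(4\pi^2|\xi|^2)^s\,\ln (4\pi^2|\xi|^2)}{(\lambda+4\pi^2|\xi|^2)^s\,\ln(\lambda+4\pi^2|\xi|^2)},\qquad \xi\in\mathbb R^n,$$ extended continuously at $\xi=0$ by setting $m(0)=0$. Then: (i) There exists $g_{s,\lambda}\in L^1(\mathbb R^n)$ such that $$m(\xi)=1+\widehat{g_{s,\lambda}}(\xi),\qquad \xi\in\mathbb R^n.$$ (ii) Consequently, there exist finite Borel measures $\mu_{s,\lambda}$ and $w_{s,\lambda}$ on $\mathbb R^n$ such that $$(\lambda + 4\pi^2|\xi|^2)^s \ln (\lambda + 4\pi^2|\xi|^2)=\widehat{\mu_{s,\lambda}}(\xi)+\widehat{w_{s,\lambda}}(\xi)\,(4\pi^2|\xi|^2)^s\,\ln (4\pi^2|\xi|^2),\qquad \xi\in\mathbb R^n,$$ and moreover $\widehat{\mu_{s,\lambda}},\widehat{w_{s,\lambda}}\in\mathcal O_M(\mathbb R^n)$.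
   Context: The Fourier transform of $g\in L^1(\mathbb R^n)$ is $\widehat g(\xi)=\int_{\mathbb{R}^n}g(x)e^{-2\pi i x\cdot\xi}\,dx$, and that of a finite Borel measure $\mu$ is $\widehat\mu(\xi)=\int_{\mathbb R^n}e^{-2\pi i x\cdot\xi}\,d\mu(x)$. Finite Borel measures are allowed to be signed, and "finite" means finite total variation $|\mu|(\mathbb R^n)<\infty$. The expression $(4\pi^2|\xi|^2)^s\ln(4\pi^2|\xi|^2)$ is taken to be $0$ at $\xi=0$. The space of Schwartz multipliers is $$\mathcal O_M(\mathbb R^n)=\Bigl\{m\in C^\infty(\mathbb R^n): \forall \alpha\in\mathbb N_0^n\ \exists\, C_\alpha>0,\ N_\alpha\in\mathbb N_0 \text{ with } |\partial^\alpha m(\xi)|\le C_\alpha(1+|\xi|)^{N_\alpha}\ \forall \xi\in\mathbb R^n\Bigr\}.$$ *)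

theory Defs
  imports "HOL-Analysis.Analysis"
begin

subsection \<open>Finite signed Borel measures\<close>

text \<open>
  Measures of type \<^typ>\<open>'a measure\<close> are nonnegative, so a signed measure is represented by its
  real-valued set function. Only its values on Borel sets are relevant.
\<close>

definition total_variation :: "('a::topological_space set \<Rightarrow> real) \<Rightarrow> ennreal" where
  "total_variation \<nu> =
     (SUP A \<in> {A :: nat \<Rightarrow> 'a set. range A \<subseteq> sets borel \<and> disjoint_family A \<and> (\<Union>i. A i) = UNIV}.
        \<Sum>i. ennreal \<bar>\<nu> (A i)\<bar>)"

definition finite_signed_borel_measure :: "('a::topological_space set \<Rightarrow> real) \<Rightarrow> bool" where
  "finite_signed_borel_measure \<nu> \<longleftrightarrow>
     \<nu> {} = 0 \<and>
     (\<forall>A :: nat \<Rightarrow> 'a set. range A \<subseteq> sets borel \<longrightarrow> disjoint_family A \<longrightarrow>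
        (\<lambda>i. \<nu> (A i)) sums \<nu> (\<Union>i. A i)) \<and>
     total_variation \<nu> < \<infinity>"

text \<open>
  The positive part \<open>\<nu>\<^sup>+(A) = sup {\<nu>(B) | B \<subseteq> A Borel}\<close> of the Jordan decomposition of \<open>\<nu>\<close>; the
  negative part is the positive part of \<open>-\<nu>\<close>. Negative values \<open>\<nu>(B)\<close> are truncated to \<open>0\<close> by
  \<^const>\<open>ennreal\<close>, which does not affect the supremum since \<open>B = {}\<close> contributes \<open>0\<close>.
\<close>

definition positive_variation :: "('a::topological_space set \<Rightarrow> real) \<Rightarrow> 'a measure" where
  "positive_variation \<nu> =
     measure_of UNIV (sets borel) (\<lambda>A. SUP B \<in> {B \<in> sets borel. B \<subseteq> A}. ennreal (\<nu> B))"

definition negative_variation :: "('a::topological_space set \<Rightarrow> real) \<Rightarrow> 'a measure" where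
  "negative_variation \<nu> = positive_variation (\<lambda>A. - \<nu> A)"

definition signed_integral ::
    "('a::topological_space set \<Rightarrow> real) \<Rightarrow> ('a \<Rightarrow> complex) \<Rightarrow> complex" where
  "signed_integral \<nu> f =
     (\<integral>x. f x \<partial>positive_variation \<nu>) - (\<integral>x. f x \<partial>negative_variation \<nu>)"


subsection \<open>Fourier transforms\<close>

definition fourier_kernel :: "real ^ 'n \<Rightarrow> real ^ 'n \<Rightarrow> complex" where
  "fourier_kernel \<xi> x = exp (- 2 * complex_of_real pi * \<i> * complex_of_real (x \<bullet> \<xi>))"

definition fourier_transform :: "(real ^ 'n \<Rightarrow> complex) \<Rightarrow> real ^ 'n \<Rightarrow> complex" where
  "fourier_transform g \<xi> = (\<integral>x. g x * fourier_kernel \<xi> x \<partial>lborel)"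

definition fourier_transform_measure :: "((real ^ 'n) set \<Rightarrow> real) \<Rightarrow> real ^ 'n \<Rightarrow> complex" where
  "fourier_transform_measure \<nu> \<xi> = signed_integral \<nu> (fourier_kernel \<xi>)"


subsection \<open>Schwartz multipliers\<close>

definition partial_differentiable :: "'n \<Rightarrow> (real ^ 'n \<Rightarrow> complex) \<Rightarrow> bool" where
  "partial_differentiable i f \<longleftrightarrow> (\<forall>x. (\<lambda>t::real. f (x + t *\<^sub>R axis i 1)) differentiable (at 0))"

definition partial_deriv :: "'n \<Rightarrow> (real ^ 'n \<Rightarrow> complex) \<Rightarrow> real ^ 'n \<Rightarrow> complex" where
  "partial_deriv i f x = vector_derivative (\<lambda>t::real. f (x + t *\<^sub>R axis i 1)) (at 0)"

definition iterated_partial :: "'n list \<Rightarrow> (real ^ 'n \<Rightarrow> complex) \<Rightarrow> real ^ 'n \<Rightarrow> complex" where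
  "iterated_partial is f = foldr partial_deriv is f"

text \<open>\<open>C\<^sup>\<infinity>\<close>: partial derivatives of all orders, in any order of differentiation, exist and are
  continuous.\<close>

definition smooth :: "(real ^ 'n \<Rightarrow> complex) \<Rightarrow> bool" where
  "smooth f \<longleftrightarrow>
     (\<forall>is. continuous_on UNIV (iterated_partial is f) \<and>
           (\<forall>i. partial_differentiable i (iterated_partial is f)))"

text \<open>
  The derivative \<open>\<partial>\<^sup>\<alpha>\<close> for a multi-index \<open>\<alpha>\<close>. A finite index type carries no order, so the coordinates
  are processed along an arbitrary enumeration; for smooth functions the choice is irrelevant
  because partial derivatives commute.
\<close>

definition multi_partial ::
    "('n \<Rightarrow> nat) \<Rightarrow> (real ^ 'n::finite \<Rightarrow> complex) \<Rightarrow> real ^ 'n \<Rightarrow> complex" where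
  "multi_partial \<alpha> f =
     foldr (\<lambda>i. partial_deriv i ^^ \<alpha> i) (SOME is. distinct is \<and> set is = (UNIV :: 'n set)) f"

definition schwartz_multipliers :: "(real ^ 'n::finite \<Rightarrow> complex) set" where
  "schwartz_multipliers =
     {m. smooth m \<and>
         (\<forall>\<alpha>. \<exists>C>0. \<exists>N::nat. \<forall>\<xi>. norm (multi_partial \<alpha> m \<xi>) \<le> C * (1 + norm \<xi>) ^ N)}"


subsection \<open>The symbols\<close>

definition laplace_symbol :: "real ^ 'n \<Rightarrow> real" where
  "laplace_symbol \<xi> = 4 * pi\<^sup>2 * (norm \<xi>)\<^sup>2"

definition log_symbol :: "real \<Rightarrow> real ^ 'n \<Rightarrow> real" where
  "log_symbol s \<xi> =
     (if \<xi> = 0 then 0 else laplace_symbol \<xi> powr s * ln (laplace_symbol \<xi>))"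

definition shifted_log_symbol :: "real \<Rightarrow> real \<Rightarrow> real ^ 'n \<Rightarrow> real" where
  "shifted_log_symbol s lam \<xi> = (lam + laplace_symbol \<xi>) powr s * ln (lam + laplace_symbol \<xi>)"

definition m_symbol :: "real \<Rightarrow> real \<Rightarrow> real ^ 'n \<Rightarrow> real" where
  "m_symbol s lam \<xi> = (if \<xi> = 0 then 0 else log_symbol s \<xi> / shifted_log_symbol s lam \<xi>)"

end

theory Submission
  imports Defs "HOL-Probability.Probability" "HOL-Complex_Analysis.Complex_Analysis" "HOL-Real_Asymp.Real_Asymp"
begin

text \<open>Write \<open>\<rho> = 4 \<pi>\<^sup>2 |\<xi>|\<^sup>2\<close>. Every function to be realised as a Fourier transform is radial, \<open>F(\<rho>)\<close>, and one
  sufficient condition on the function \<open>F\<close> of one real variable serves in all dimensions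
  (\<open>L1_symbol_criterion\<close>): \<open>F\<close> vanishes at infinity, extends continuously to \<open>0\<close>, and
  \<open>|F\<^sup>(\<^sup>k\<^sup>)(r)| \<le> C\<^sub>k W(r) r\<^sup>-\<^sup>k\<close> for \<open>k \<ge> 1\<close>, where \<open>W\<close> vanishes at \<open>0\<close> and at infinity and is integrable
  with respect to \<open>dr / r\<close>.

  The condition suffices because Taylor's formula based at infinity, \<open>taylor_from_infinity\<close>, writes
  \<open>F(\<rho>) = \<integral> k(r) (1 - \<rho> / r)\<^sub>+\<^sup>M dr\<close> with \<open>k(r) = (-1)\<^sup>M\<^sup>+\<^sup>1 r\<^sup>M F\<^sup>(\<^sup>M\<^sup>+\<^sup>1\<^sup>)(r) / M!\<close> integrable. So \<open>F\<close> is a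
  superposition of dilates of a single Riesz mean. For \<open>M > n\<close> the Riesz means are in turn
  superpositions of complex Gaussians: up to a constant, \<open>x\<^sub>+\<^sup>M\<close> is the inverse Laplace transform
  \<open>\<integral> e\<^sup>z\<^sup>x z\<^sup>-\<^sup>M\<^sup>-\<^sup>1 dt\<close> over the line \<open>z = 1 + \<i>t\<close> (\<open>laplace_inversion_power\<close>), and with \<open>x = 1 - \<rho> / r\<close> this
  involves only \<open>exp (- z \<rho> / r)\<close>, the Fourier transform of a Gaussian whose \<open>L\<^sup>1\<close> norm
  \<open>(|z| / Re z)\<^sup>n\<^sup>/\<^sup>2\<close> is independent of \<open>r\<close> and at most \<open>|z|\<^sup>n\<close> (\<open>gauss_kernel\<close>). Fubini's theorem then
  produces an integrable kernel.

  For the first part, put \<open>y = \<rho> / (\<lambda> + \<rho>)\<close>. Then \<open>m - 1 = (y\<^sup>s - 1) + y\<^sup>s ln y / ln (\<lambda> + \<rho>)\<close>, where the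
  denominator stays away from \<open>0\<close> because \<open>\<lambda> > 1\<close>. The weight is \<open>y\<^sup>s ln (1 / y)\<close>: it is of order
  \<open>\<rho>\<^sup>s ln (1 / \<rho>)\<close> at the origin and \<open>1 / \<rho>\<close> at infinity.

  For the second part, write \<open>S = (\<lambda> + \<rho>)\<^sup>s ln (\<lambda> + \<rho>)\<close> and \<open>L = \<rho>\<^sup>s ln \<rho>\<close>. Dividing by \<open>m\<close> is impossible at
  the zeros \<open>\<rho> = 0\<close> and \<open>\<rho> = 1\<close> of \<open>L\<close>, so a cut-off is used: with \<open>v = exp (- 1 / (\<rho> - 2))\<close> for \<open>\<rho> > 2\<close>, \<open>v = 0\<close>
  otherwise, and an integer \<open>k \<ge> s + 2\<close>, the two measures are determined by
  \<open>\<mu>^ = S (1 - v)\<^sup>k\<close> and \<open>w^ = (1 - (1 - v)\<^sup>k) S / L\<close>. Clearly \<open>S = \<mu>^ + w^ L\<close>. The cut-off is smooth, \<open>w^\<close>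
  vanishes for \<open>\<rho> \<le> 2\<close>, and \<open>1 - v\<close> decays like \<open>1 / \<rho>\<close>, so that \<open>\<mu>^\<close> and \<open>w^ - 1\<close> are \<open>O(1 / \<rho>)\<close> together with
  the corresponding bounds for all derivatives. The criterion gives integrable kernels for both; \<open>w\<close>
  has in addition a unit point mass at the origin. Smoothness and growth come from the same bounds,
  since all partial derivatives of \<open>F(\<rho>)\<close> are combinations of monomials in \<open>\<xi>\<close> times derivatives of \<open>F\<close>
  (\<open>radial_schwartz_multiplier\<close>).\<close>

section \<open>Holomorphic dependence of integrals on a parameter\<close>

text \<open>A local integrable bound on the integrand is enough: by Cauchy's inequality it bounds the derivative
  with respect to the parameter too, hence the difference quotients, and dominated convergence applies.\<close>

lemma holomorphic_on_integral:
  fixes f :: "'a \<Rightarrow> complex \<Rightarrow> complex"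
  assumes "open S"
    and hol: "\<And>x. f x holomorphic_on S"
    and meas: "\<And>z. z \<in> S \<Longrightarrow> (\<lambda>x. f x z) \<in> borel_measurable M"
    and dom: "\<And>z. z \<in> S \<Longrightarrow> \<exists>r>0. \<exists>w. integrable M w \<and> (\<forall>u\<in>ball z r. u \<in> S \<and> (\<forall>x. norm (f x u) \<le> w x))"
  shows "(\<lambda>z. \<integral>x. f x z \<partial>M) holomorphic_on S"
proof -
  have "\<exists>D. ((\<lambda>z. \<integral>x. f x z \<partial>M) has_field_derivative D) (at z)" if z: "z \<in> S" for z
  proof -
    obtain r w where r: "r > 0" and w: "integrable M w"
      and sub: "\<And>u. u \<in> ball z r \<Longrightarrow> u \<in> S" and bd: "\<And>u x. u \<in> ball z r \<Longrightarrow> norm (f x u) \<le> w x"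
      using dom[OF z] by blast
    have fd: "(f x has_field_derivative deriv (f x) u) (at u)" if "u \<in> S" for x u
      using hol[of x] \<open>open S\<close> that holomorphic_derivI by blast
    \<comment> \<open>Half the radius leaves room for Cauchy's inequality around every point of the smaller ball.\<close>
    have db: "norm (deriv (f x) u) \<le> 2 * w x / r" if u: "u \<in> ball z (r/2)" for u x
    proof -
      have "norm ((deriv ^^ 1) (f x) u) \<le> fact 1 * w x / (r/2) ^ 1"
      proof (rule Cauchy_inequality)
        have inc: "cball u (r/2) \<subseteq> ball z r"
        proof
          fix v assume "v \<in> cball u (r/2)"
          then show "v \<in> ball z r" using u r dist_triangle[of z v u] by simp
        qed
        then have "cball u (r/2) \<subseteq> S" using sub by blast
        then show "f x holomorphic_on ball u (r/2)" "continuous_on (cball u (r/2)) (f x)"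
          using hol[of x] ball_subset_cball[of u "r/2"]
          by (meson holomorphic_on_subset holomorphic_on_imp_continuous_on order_trans)+
        show "0 < r/2" using r by simp
        fix v assume v: "norm (u - v) = r/2"
        have "v \<in> ball z r" using inc v by (auto simp: dist_norm)
        then show "norm (f x v) \<le> w x" by (rule bd)
      qed
      then show ?thesis by (simp add: field_simps)
    qed
    have z0: "z \<in> ball z (r/2)" using r by simp
    have half: "ball z (r/2) \<subseteq> ball z r" using r by auto
    have lip: "norm (f x u - f x z) \<le> 2 * w x / r * norm (u - z)" if u: "u \<in> ball z (r/2)" for u x
    proof (rule field_differentiable_bound[OF convex_ball _ db u z0])
      show "(f x has_field_derivative deriv (f x) v) (at v within ball z (r/2))" if "v \<in> ball z (r/2)" for v
        using that half sub fd has_field_derivative_at_within by blast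
    qed
    have intg: "integrable M (\<lambda>x. f x u)" if "u \<in> ball z r" for u
      using w meas[OF sub[OF that]] by (rule Bochner_Integration.integrable_bound) (auto intro: order_trans[OF bd[OF that] abs_ge_self])
    have "((\<lambda>u. ((\<integral>x. f x u \<partial>M) - (\<integral>x. f x z \<partial>M)) / (u - z)) \<longlongrightarrow> (\<integral>x. deriv (f x) z \<partial>M)) (at z)"
      unfolding tendsto_at_iff_sequentially
    proof (intro allI impI)
      fix X :: "nat \<Rightarrow> complex" assume X: "\<forall>i. X i \<in> UNIV - {z}" and lim: "X \<longlonglongrightarrow> z"
      have Xz: "filterlim X (at z) sequentially" using X lim by (auto simp: filterlim_at)
      have "\<forall>\<^sub>F i in sequentially. X i \<in> ball z (r/2)"
        using lim z0 by (intro topological_tendstoD) auto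
      then obtain N where N: "\<And>i. i \<ge> N \<Longrightarrow> X i \<in> ball z (r/2)" by (auto simp: eventually_sequentially)
      have q: "(\<lambda>i. (f x (X (i + N)) - f x z) / (X (i + N) - z)) \<longlonglongrightarrow> deriv (f x) z" for x
        using fd[OF z, of x] unfolding has_field_derivative_iff
        by (intro LIMSEQ_ignore_initial_segment filterlim_compose[OF _ Xz])
      have m: "(\<lambda>x. (f x (X (i + N)) - f x z) / (X (i + N) - z)) \<in> borel_measurable M" for i
        using meas[OF z] meas[OF sub, of "X (i + N)"] N[of "i + N"] half by (auto intro!: borel_measurable_divide borel_measurable_diff)
      have "(\<lambda>i. \<integral>x. (f x (X (i + N)) - f x z) / (X (i + N) - z) \<partial>M) \<longlonglongrightarrow> (\<integral>x. deriv (f x) z \<partial>M)"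
      proof (rule integral_dominated_convergence)
        show "integrable M (\<lambda>x. 2 * w x / r)" using w by simp
        show "(\<lambda>x. deriv (f x) z) \<in> borel_measurable M"
          by (rule borel_measurable_LIMSEQ_metric[OF m q])
        show "AE x in M. norm ((f x (X (i + N)) - f x z) / (X (i + N) - z)) \<le> 2 * w x / r" for i
          using lip[OF N[of "i + N"]] X by (intro AE_I2) (simp add: norm_divide divide_le_eq)
      qed (use m q in auto)
      moreover have "(\<integral>x. (f x (X (i + N)) - f x z) / (X (i + N) - z) \<partial>M)
          = ((\<integral>x. f x (X (i + N)) \<partial>M) - (\<integral>x. f x z \<partial>M)) / (X (i + N) - z)" for i
        using intg[of "X (i+N)"] intg[of z] N[of "i+N"] half r by (subst integral_divide_zero) (auto simp: subset_iff)
      ultimately have "(\<lambda>i. ((\<integral>x. f x (X (i + N)) \<partial>M) - (\<integral>x. f x z \<partial>M)) / (X (i + N) - z)) \<longlonglongrightarrow> (\<integral>x. deriv (f x) z \<partial>M)"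
        by (simp only:)
      then show "((\<lambda>u. ((\<integral>x. f x u \<partial>M) - (\<integral>x. f x z \<partial>M)) / (u - z)) \<circ> X) \<longlonglongrightarrow> (\<integral>x. deriv (f x) z \<partial>M)"
        unfolding o_def by (rule LIMSEQ_offset)
    qed
    then show ?thesis unfolding has_field_derivative_iff by blast
  qed
  then show ?thesis by (auto simp: holomorphic_on_def field_differentiable_def dest: has_field_derivative_at_within)
qed

text \<open>Turns a formula for real parameters into one for complex parameters.\<close>

lemma half_plane_identity:
  fixes f g :: "complex \<Rightarrow> complex"
  assumes "f holomorphic_on {a. Re a > 0}" "g holomorphic_on {a. Re a > 0}"
    and eq: "\<And>r. r > 0 \<Longrightarrow> f (of_real r) = g (of_real r)" and "Re a > 0"
  shows "f a = g a"
proof -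
  have lim: "(1::complex) islimpt of_real ` {0<..}"
  proof (rule islimptI)
    fix T assume T: "(1::complex) \<in> T" "open T"
    then obtain e where e: "e > 0" "ball 1 e \<subseteq> T" using open_contains_ball by blast
    have "dist (1::complex) (of_real (1 + e/2)) < e" using e by (simp add: dist_norm)
    then show "\<exists>y\<in>of_real ` {0<..}. y \<in> T \<and> y \<noteq> (1::complex)"
      using e by (intro bexI[of _ "of_real (1 + e/2)"] conjI imageI) (auto simp: subset_iff)
  qed
  have "(\<lambda>a. f a - g a) holomorphic_on {a. Re a > 0}" using assms(1,2) by (rule holomorphic_on_diff)
  then have "f a - g a = 0"
    by (rule analytic_continuation[OF _ open_halfspace_Re_gt convex_connected[OF convex_halfspace_Re_gt], where U = "of_real ` {0<..}" and \<xi> = 1])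
      (use lim eq assms(4) in auto)
  then show ?thesis by simp
qed

section \<open>Gaussians with complex variance\<close>

lemma integral_real_gaussian:
  assumes "a > 0"
  shows "integrable lborel (\<lambda>x::real. exp (- (a * x\<^sup>2)))"
    and "(\<integral>x. exp (- (a * x\<^sup>2)) \<partial>lborel) = sqrt (pi / a)"
    and "(\<integral>x. exp (- (complex_of_real a * (of_real x)\<^sup>2)) * exp (- (2 * of_real pi * \<i> * of_real (x * b))) \<partial>lborel)
           = of_real (sqrt (pi / a) * exp (- (pi\<^sup>2 * b\<^sup>2 / a)))"
proof -
  define \<sigma> where "\<sigma> = 1 / sqrt (2 * a)"
  have s: "\<sigma> > 0" "\<sigma>\<^sup>2 = 1 / (2 * a)" using assms by (auto simp: \<sigma>_def power_divide)
  have e: "exp (- (a * x\<^sup>2)) = sqrt (pi / a) * normal_density 0 \<sigma> x" for x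
    using assms by (simp add: normal_density_def s)
  show "integrable lborel (\<lambda>x::real. exp (- (a * x\<^sup>2)))"
    unfolding e using s by (intro integrable_mult_right) auto
  show "(\<integral>x. exp (- (a * x\<^sup>2)) \<partial>lborel) = sqrt (pi / a)"
    unfolding e using s by simp
  show "(\<integral>x. exp (- (complex_of_real a * (of_real x)\<^sup>2)) * exp (- (2 * of_real pi * \<i> * of_real (x * b))) \<partial>lborel)
           = of_real (sqrt (pi / a) * exp (- (pi\<^sup>2 * b\<^sup>2 / a)))"
  proof -
    define t where "t = - (2 * pi * b * \<sigma>)"
    have "complex_of_real (exp (- (t^2) / 2)) = char std_normal_distribution t"
      by (simp add: char_std_normal_distribution)
    also have "\<dots> = (\<integral>x. std_normal_density x *\<^sub>R exp (\<i> * of_real (t * x)) \<partial>lborel)"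
      unfolding char_def by (subst integral_density) (auto)
    also have "\<dots> = \<bar>1/\<sigma>\<bar> *\<^sub>R (\<integral>x. std_normal_density (0 + (1/\<sigma>) * x) *\<^sub>R exp (\<i> * of_real (t * (0 + (1/\<sigma>) * x))) \<partial>lborel)"
      using s by (intro lborel_integral_real_affine) auto
    also have "\<dots> = complex_of_real (1 / \<sigma> / sqrt (2 * pi)) * (\<integral>x. exp (- (complex_of_real a * (of_real x)\<^sup>2)) * exp (- (2 * of_real pi * \<i> * of_real (x * b))) \<partial>lborel)"
    proof -
      have "std_normal_density (0 + (1/\<sigma>) * x) *\<^sub>R exp (\<i> * of_real (t * (0 + (1/\<sigma>) * x)))
        = complex_of_real (1 / sqrt (2 * pi)) * (exp (- (complex_of_real a * (of_real x)\<^sup>2)) * exp (- (2 * of_real pi * \<i> * of_real (x * b))))" for x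
      proof -
        have "std_normal_density (0 + (1/\<sigma>) * x) = 1 / sqrt (2 * pi) * exp (- (a * x\<^sup>2))"
          using assms by (simp add: std_normal_density_def power_divide s)
        moreover have "t * (0 + (1/\<sigma>) * x) = - (2 * pi * (x * b))"
          using s by (simp add: t_def)
        ultimately show ?thesis
          by (simp add: scaleR_conv_of_real flip: exp_of_real) (simp add: mult_ac)
      qed
      then show ?thesis using s by (simp add: scaleR_conv_of_real)
    qed
    also have "1 / \<sigma> / sqrt (2 * pi) = 1 / sqrt (pi / a)"
      using assms by (simp add: \<sigma>_def real_sqrt_mult real_sqrt_divide)
    also have "- (t\<^sup>2) / 2 = - (pi\<^sup>2 * b\<^sup>2 / a)"
      using s by (simp add: t_def power_mult_distrib)
    finally show ?thesis using assms
      by (simp add: divide_eq_eq mult.commute)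
  qed
qed

lemma Re_inverse_pos: "Re a > 0 \<Longrightarrow> Re (inverse a) > 0"
  by (auto simp: sum_power2_gt_zero_iff intro!: divide_pos_pos)

lemma norm_complex_gaussian:
  "norm (exp (- (a * (complex_of_real x)\<^sup>2)) * exp (- (2 * of_real pi * \<i> * of_real (x * b)))) = exp (- (Re a * x\<^sup>2))"
  by (simp add: norm_mult norm_exp_eq_Re flip: of_real_power)

text \<open>Both sides of the Fourier integral are holomorphic in \<open>a\<close> on the right half-plane, and for real \<open>a\<close> the
  identity is the characteristic function of the normal distribution.\<close>

lemma integral_complex_gaussian:
  assumes a: "Re a > 0"
  shows "integrable lborel (\<lambda>x. exp (- (a * (complex_of_real x)\<^sup>2)) * exp (- (2 * of_real pi * \<i> * of_real (x * b))))"
    and "(\<integral>x. exp (- (a * (complex_of_real x)\<^sup>2)) * exp (- (2 * of_real pi * \<i> * of_real (x * b))) \<partial>lborel)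
           = csqrt (of_real pi / a) * exp (- (of_real (pi\<^sup>2 * b\<^sup>2) / a))"
proof -
  let ?f = "\<lambda>x a. exp (- (a * (complex_of_real x)\<^sup>2)) * exp (- (2 * of_real pi * \<i> * of_real (x * b)))"
  let ?S = "{a. Re a > 0}"
  have [measurable]: "(\<lambda>x. ?f x a) \<in> borel_measurable borel" for a
    by (intro borel_measurable_continuous_onI continuous_intros)
  show "integrable lborel (\<lambda>x. ?f x a)"
    by (rule Bochner_Integration.integrable_bound[OF integral_real_gaussian(1)[OF a]])
       (auto intro!: AE_I2 simp del: of_real_mult simp: norm_complex_gaussian)
  have op: "open ?S" by (rule open_halfspace_Re_gt)
  have "(\<lambda>a. \<integral>x. ?f x a \<partial>lborel) holomorphic_on ?S"
  proof (rule holomorphic_on_integral[OF op])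
    show "(\<lambda>a. ?f x a) holomorphic_on ?S" for x by (intro holomorphic_intros)
    fix z assume z: "z \<in> ?S"
    show "\<exists>r>0. \<exists>w. integrable lborel w \<and> (\<forall>u\<in>ball z r. u \<in> ?S \<and> (\<forall>x. norm (?f x u) \<le> w x))"
    proof (intro exI conjI ballI allI)
      show "Re z / 2 > 0" using z by simp
      then show "integrable lborel (\<lambda>x. exp (- ((Re z / 2) * x\<^sup>2)))" by (rule integral_real_gaussian)
      fix u assume "u \<in> ball z (Re z / 2)"
      then have "Re u > Re z / 2" using abs_Re_le_cmod[of "z - u"] by (simp add: dist_norm abs_le_iff)
      then show "u \<in> ?S" "norm (?f x u) \<le> exp (- ((Re z / 2) * x\<^sup>2))" for x
        using z by (auto simp: norm_complex_gaussian simp del: of_real_mult intro!: mult_right_mono[of "Re z / 2", simplified])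
    qed
  qed auto
  moreover have "(\<lambda>a. csqrt (of_real pi * inverse a) * exp (- (of_real (pi\<^sup>2 * b\<^sup>2) * inverse a))) holomorphic_on ?S"
  proof (intro holomorphic_intros)
    fix a assume "a \<in> ?S"
    then have "Re (of_real pi * inverse a) > 0" using Re_inverse_pos[of a] by (simp del: inverse_complex.simps)
    then show "of_real pi * inverse a \<notin> \<real>\<^sub>\<le>\<^sub>0" by (auto simp: complex_nonpos_Reals_iff)
  qed auto
  ultimately have "(\<integral>x. ?f x a \<partial>lborel) = csqrt (of_real pi * inverse a) * exp (- (of_real (pi\<^sup>2 * b\<^sup>2) * inverse a))"
  proof (rule half_plane_identity[OF _ _ _ a])
    fix r :: real assume r: "r > 0"
    have "csqrt (of_real pi * inverse (of_real r)) = of_real (sqrt (pi / r))"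
      using r by (simp add: field_simps flip: of_real_divide)
    moreover have "exp (- (of_real (pi\<^sup>2 * b\<^sup>2) * inverse (of_real r))) = complex_of_real (exp (- (pi\<^sup>2 * b\<^sup>2 / r)))"
      using r by (simp add: field_simps flip: exp_of_real)
    ultimately show "(\<integral>x. ?f x (of_real r) \<partial>lborel) = csqrt (of_real pi * inverse (of_real r)) * exp (- (of_real (pi\<^sup>2 * b\<^sup>2) * inverse (of_real r)))"
      using integral_real_gaussian(3)[OF r, of b] by simp
  qed
  then show "(\<integral>x. ?f x a \<partial>lborel) = csqrt (of_real pi / a) * exp (- (of_real (pi\<^sup>2 * b\<^sup>2) / a))"
    by (simp only: divide_inverse)
qed

lemma integral_lborel_prod:
  fixes f :: "'a::euclidean_space \<Rightarrow> real \<Rightarrow> 'b::{real_normed_field,banach,second_countable_topology}"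
  assumes "\<And>b. b \<in> Basis \<Longrightarrow> integrable lborel (f b)"
  shows "integrable lborel (\<lambda>x. \<Prod>b\<in>Basis. f b (x \<bullet> b))"
    and "(\<integral>x. (\<Prod>b\<in>Basis. f b ((x::'a) \<bullet> b)) \<partial>lborel) = (\<Prod>b\<in>Basis. \<integral>x. f b x \<partial>lborel)"
proof -
  interpret product_sigma_finite "\<lambda>_::'a. lborel :: real measure" ..
  let ?T = "\<lambda>f. \<Sum>b\<in>Basis. f b *\<^sub>R (b::'a)"
  have [measurable]: "b \<in> Basis \<Longrightarrow> f b \<in> borel_measurable borel" for b
    using assms[of b] by auto
  have T: "(\<Prod>b\<in>Basis. f b (?T x \<bullet> b)) = (\<Prod>b\<in>Basis. f b (x b))" for x
    by (intro prod.cong) auto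
  have m: "?T \<in> (\<Pi>\<^sub>M b\<in>Basis. lborel) \<rightarrow>\<^sub>M borel" by measurable
  have m2: "(\<lambda>x::'a. \<Prod>b\<in>Basis. f b (x \<bullet> b)) \<in> borel_measurable borel" by measurable
  show "integrable lborel (\<lambda>x::'a. \<Prod>b\<in>Basis. f b (x \<bullet> b))"
    unfolding lborel_eq[where 'a='a] by (subst integrable_distr_eq[OF m m2]) (simp only: T, intro product_integrable_prod assms, auto)
  show "(\<integral>x. (\<Prod>b\<in>Basis. f b ((x::'a) \<bullet> b)) \<partial>lborel) = (\<Prod>b\<in>Basis. \<integral>x. f b x \<partial>lborel)"
    unfolding lborel_eq[where 'a='a] by (subst integral_distr[OF m m2]) (simp only: T, intro product_integral_prod assms, auto)
qed

text \<open>The heat kernel at the complex time \<open>z\<close>. The principal root is taken before the power, so that the kernel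
  is a product of one-dimensional ones and holomorphic in \<open>z\<close> on the right half-plane.\<close>

definition gauss_kernel :: "complex \<Rightarrow> real ^ 'n \<Rightarrow> complex" where
  "gauss_kernel z x = exp (- (of_real ((norm x)\<^sup>2) / (4 * z))) / csqrt (4 * of_real pi * z) ^ CARD('n)"

lemma fourier_kernel_eq: "fourier_kernel \<xi> x = exp (- (2 * of_real pi * \<i> * of_real (x \<bullet> \<xi>)))"
  by (simp add: fourier_kernel_def)

lemma norm_sq_Basis: "(norm x)\<^sup>2 = (\<Sum>b\<in>Basis. (x \<bullet> b)\<^sup>2)"
  unfolding power2_norm_eq_inner by (subst euclidean_inner) (simp add: power2_eq_square)

text \<open>The \<open>L\<^sup>1\<close> norm depends only on the argument of \<open>z\<close>; thus dilating the symbol \<open>exp (- z \<rho>)\<close> costs nothing,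
  and along a vertical line the norm grows only polynomially.\<close>

lemma gauss_kernel:
  assumes z: "Re z > 0"
  shows "integrable lborel (gauss_kernel z :: real ^ 'n \<Rightarrow> complex)"
    and "(\<integral>x. norm (gauss_kernel z (x :: real ^ 'n)) \<partial>lborel) = sqrt (norm z / Re z) ^ CARD('n)"
    and "fourier_transform (gauss_kernel z) (\<xi> :: real ^ 'n) = exp (- (z * of_real (laplace_symbol \<xi>)))"
proof -
  define a where "a = inverse (4 * z)"
  have a: "Re a > 0" unfolding a_def using z by (intro Re_inverse_pos) simp
  have z0: "z \<noteq> 0" using z by auto
  define C where "C = csqrt (4 * of_real pi * z)"
  have C: "C \<noteq> 0" using z0 by (simp add: C_def)
  have pa: "of_real pi / a = 4 * of_real pi * z" by (simp add: a_def field_simps)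
  let ?f = "\<lambda>b x. exp (- (a * (complex_of_real x)\<^sup>2)) * exp (- (2 * of_real pi * \<i> * of_real (x * b)))"
  have eq: "gauss_kernel z x * fourier_kernel \<xi> x = (\<Prod>b\<in>Basis. ?f (\<xi> \<bullet> b) (x \<bullet> b)) / C ^ CARD('n)" for x \<xi> :: "real ^ 'n"
  proof -
    have "(\<Prod>b\<in>Basis. ?f (\<xi> \<bullet> b) (x \<bullet> b))
       = exp (\<Sum>b\<in>Basis. - (a * (complex_of_real (x \<bullet> b))\<^sup>2)) * exp (\<Sum>b\<in>Basis. - (2 * of_real pi * \<i> * of_real ((x \<bullet> b) * (\<xi> \<bullet> b))))"
      by (simp only: prod.distrib exp_sum[OF finite_Basis])
    also have "(\<Sum>b\<in>Basis. - (a * (complex_of_real (x \<bullet> b))\<^sup>2)) = - (a * of_real ((norm x)\<^sup>2))"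
      by (simp only: norm_sq_Basis sum_negf sum_distrib_left of_real_sum of_real_power)
    also have "(\<Sum>b\<in>Basis. - (2 * of_real pi * \<i> * complex_of_real ((x \<bullet> b) * (\<xi> \<bullet> b)))) = - (2 * of_real pi * \<i> * of_real (x \<bullet> \<xi>))"
      by (simp only: euclidean_inner[of x \<xi>] sum_negf sum_distrib_left of_real_sum)
    also have "a * of_real ((norm x)\<^sup>2) = of_real ((norm x)\<^sup>2) / (4 * z)"
      by (simp only: a_def divide_inverse mult.commute)
    finally show ?thesis by (simp only: gauss_kernel_def fourier_kernel_eq C_def times_divide_eq_left)
  qed
  note intf = integral_complex_gaussian(1)[OF a]
  have P: "integrable lborel (\<lambda>x :: real ^ 'n. \<Prod>b\<in>Basis. ?f (\<xi> \<bullet> b) (x \<bullet> b))" for \<xi> :: "real ^ 'n"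
    by (rule integral_lborel_prod) (rule intf)
  have "integrable lborel (\<lambda>x. gauss_kernel z x * fourier_kernel (0 :: real ^ 'n) x)"
    unfolding eq by (intro integrable_divide P)
  then show "integrable lborel (gauss_kernel z :: real ^ 'n \<Rightarrow> complex)" by (simp add: fourier_kernel_def)
  have "fourier_transform (gauss_kernel z) \<xi> = (\<integral>x. (\<Prod>b\<in>Basis. ?f (\<xi> \<bullet> b) (x \<bullet> b)) \<partial>lborel) / C ^ CARD('n)"
    unfolding fourier_transform_def eq by simp
  also have "\<dots> = (\<Prod>b\<in>(Basis :: (real ^ 'n) set). csqrt (of_real pi / a) * exp (- (of_real (pi\<^sup>2 * (\<xi> \<bullet> b)\<^sup>2) / a))) / C ^ CARD('n)"
    by (subst integral_lborel_prod(2)) (simp_all only: intf integral_complex_gaussian(2)[OF a])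
  also have "\<dots> = (\<Prod>b\<in>(Basis :: (real ^ 'n) set). exp (- (of_real (pi\<^sup>2 * (\<xi> \<bullet> b)\<^sup>2) / a)))"
    using C by (simp add: prod.distrib pa C_def)
  also have "\<dots> = exp (\<Sum>b\<in>(Basis :: (real ^ 'n) set). (- (of_real (pi\<^sup>2 * (\<xi> \<bullet> b)\<^sup>2) / a)))"
    by (simp only: exp_sum[OF finite_Basis])
  also have "(\<Sum>b\<in>(Basis :: (real ^ 'n) set). (- (complex_of_real (pi\<^sup>2 * (\<xi> \<bullet> b)\<^sup>2) / a))) = - (of_real (pi\<^sup>2 * (norm \<xi>)\<^sup>2) / a)"
    by (simp only: norm_sq_Basis sum_negf sum_distrib_left of_real_sum sum_divide_distrib)
  also have "\<dots> = - (z * of_real (laplace_symbol \<xi>))"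
    using z0 by (simp add: laplace_symbol_def a_def field_simps)
  finally show "fourier_transform (gauss_kernel z) \<xi> = exp (- (z * of_real (laplace_symbol \<xi>)))" .
  have "norm (gauss_kernel z x) = (\<Prod>b\<in>Basis. exp (- (Re a * (x \<bullet> b)\<^sup>2))) / norm C ^ CARD('n)" for x :: "real ^ 'n"
  proof -
    have "norm (gauss_kernel z x) = norm (gauss_kernel z x * fourier_kernel 0 x)" by (simp add: fourier_kernel_def)
    also have "\<dots> = (\<Prod>b\<in>Basis. norm (?f (0 \<bullet> b) (x \<bullet> b))) / norm C ^ CARD('n)"
      unfolding eq by (simp only: norm_divide prod_norm norm_power)
    finally show ?thesis unfolding norm_complex_gaussian .
  qed
  then have "(\<integral>x. norm (gauss_kernel z (x :: real ^ 'n)) \<partial>lborel) = (\<integral>x. (\<Prod>b\<in>Basis. exp (- (Re a * ((x::real^'n) \<bullet> b)\<^sup>2))) \<partial>lborel) / norm C ^ CARD('n)"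
    by simp
  also have "\<dots> = (sqrt (pi / Re a) / norm C) ^ CARD('n)"
    by (subst integral_lborel_prod(2)) (simp_all add: integral_real_gaussian[OF a] power_divide)
  also have "sqrt (pi / Re a) / norm C = sqrt (norm z / Re z)"
  proof -
    have "norm C = sqrt (4 * pi * norm z)" by (simp add: C_def norm_mult norm_csqrt)
    moreover have "pi / Re a = 4 * pi * (norm z)\<^sup>2 / Re z"
    proof -
      have "(Re (4 * z))\<^sup>2 + (Im (4 * z))\<^sup>2 = 16 * (norm z)\<^sup>2"
        by (simp add: cmod_power2)
      then have "Re a = Re z / (4 * (norm z)\<^sup>2)"
        unfolding a_def inverse_complex.simps by simp
      then show ?thesis by simp
    qed
    ultimately have "sqrt (pi / Re a) / norm C = sqrt ((4 * pi * (norm z)\<^sup>2 / Re z) / (4 * pi * norm z))"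
      by (simp only: real_sqrt_divide[symmetric])
    also have "(4 * pi * (norm z)\<^sup>2 / Re z) / (4 * pi * norm z) = norm z / Re z"
      using z0 by (simp add: power2_eq_square)
    finally show ?thesis .
  qed
  finally show "(\<integral>x. norm (gauss_kernel z (x :: real ^ 'n)) \<partial>lborel) = sqrt (norm z / Re z) ^ CARD('n)" .
qed

section \<open>The inverse Laplace transform of a power\<close>

lemma integrable_inverse_plus_sq:
  fixes \<sigma> :: real
  assumes "\<sigma> > 0"
  shows "integrable lborel (\<lambda>t. 1 / (\<sigma>\<^sup>2 + t\<^sup>2))"
proof -
  have *: "integrable lborel (\<lambda>x::real. inverse (1 + x\<^sup>2))"
    using integrable_inverse_1_plus_square by (simp add: set_integrable_def)
  have "integrable lborel (\<lambda>x. 1/\<sigma>\<^sup>2 * inverse (1 + (0 + (1/\<sigma>) * x)\<^sup>2))"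
    using lborel_integrable_real_affine[OF *, of "1/\<sigma>" 0] assms by (intro integrable_mult_right) auto
  also have "(\<lambda>x. 1/\<sigma>\<^sup>2 * inverse (1 + (0 + (1/\<sigma>) * x)\<^sup>2)) = (\<lambda>t. 1 / (\<sigma>\<^sup>2 + t\<^sup>2))"
    using assms by (auto simp: fun_eq_iff power_divide field_simps)
  finally show ?thesis .
qed

lemma cmod_line_sq: "(norm (\<zeta> + \<i> * of_real t))\<^sup>2 = (Re \<zeta>)\<^sup>2 + (Im \<zeta> + t)\<^sup>2"
  by (simp add: cmod_power2)

lemma line_nonzero: "Re \<zeta> > 0 \<Longrightarrow> \<zeta> + \<i> * of_real t \<noteq> 0"
  by (auto simp: complex_eq_iff)

lemma Re_le_norm_line: "Re \<zeta> \<le> norm (\<zeta> + \<i> * of_real t)"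
  using complex_Re_le_cmod[of "\<zeta> + \<i> * of_real t"] by simp

abbreviation line_integrand :: "real \<Rightarrow> nat \<Rightarrow> complex \<Rightarrow> real \<Rightarrow> complex" where
  "line_integrand x k \<zeta> t \<equiv> exp ((\<zeta> + \<i> * of_real t) * of_real x) / (\<zeta> + \<i> * of_real t) ^ k"

lemma borel_measurable_line_integrand [measurable]:
  assumes "Re \<zeta> > 0"
  shows "(\<lambda>t. line_integrand x k \<zeta> t) \<in> borel_measurable borel"
  using line_nonzero[OF assms] by (intro borel_measurable_continuous_onI continuous_intros) auto

lemma integrable_norm_line_power:
  assumes "Re \<zeta> > 0" "M \<ge> 1"
  shows "integrable lborel (\<lambda>t. 1 / norm (\<zeta> + \<i> * of_real t) ^ (M + 1))"
proof (rule Bochner_Integration.integrable_bound)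
  have "integrable lborel (\<lambda>t. 1 / ((Re \<zeta>)\<^sup>2 + (Im \<zeta> + 1 * t)\<^sup>2))"
    by (rule lborel_integrable_real_affine[OF integrable_inverse_plus_sq[OF assms(1)]]) simp
  then show "integrable lborel (\<lambda>t. 1 / (Re \<zeta>) ^ (M - 1) * (1 / ((Re \<zeta>)\<^sup>2 + (Im \<zeta> + 1 * t)\<^sup>2)))"
    by (rule integrable_mult_right)
  show "(\<lambda>t. 1 / norm (\<zeta> + \<i> * of_real t) ^ (M + 1)) \<in> borel_measurable lborel"
    by measurable
  show "AE t in lborel. norm (1 / norm (\<zeta> + \<i> * of_real t) ^ (M + 1)) \<le> norm (1 / (Re \<zeta>) ^ (M - 1) * (1 / ((Re \<zeta>)\<^sup>2 + (Im \<zeta> + 1 * t)\<^sup>2)))"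
  proof (rule AE_I2)
    fix t
    let ?n = "norm (\<zeta> + \<i> * of_real t)"
    have n: "?n > 0" using line_nonzero[OF assms(1)] by simp
    have "?n ^ (M + 1) = ?n ^ (M - 1) * ?n\<^sup>2"
      using assms(2) by (simp flip: power_add)
    moreover have "(Re \<zeta>) ^ (M - 1) \<le> ?n ^ (M - 1)"
      using assms(1) Re_le_norm_line by (intro power_mono) auto
    ultimately have "(Re \<zeta>) ^ (M - 1) * ?n\<^sup>2 \<le> ?n ^ (M + 1)"
      by (simp add: mult_right_mono)
    moreover have "0 < (Re \<zeta>) ^ (M - 1) * ?n\<^sup>2" using n assms(1) by simp
    ultimately have "1 / ?n ^ (M + 1) \<le> 1 / ((Re \<zeta>) ^ (M - 1) * ?n\<^sup>2)"
      using n assms(1) by (intro divide_left_mono mult_pos_pos[OF zero_less_power]) auto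
    then show "norm (1 / ?n ^ (M + 1)) \<le> norm (1 / (Re \<zeta>) ^ (M - 1) * (1 / ((Re \<zeta>)\<^sup>2 + (Im \<zeta> + 1 * t)\<^sup>2)))"
      using assms(1) n by (simp add: cmod_line_sq)
  qed
qed

lemma norm_line_integrand:
  "norm (line_integrand x k \<zeta> t) = exp (Re \<zeta> * x) * (1 / norm (\<zeta> + \<i> * of_real t) ^ k)"
  by (simp add: norm_divide norm_power norm_exp_eq_Re)

lemma integrable_line_integrand:
  assumes "Re \<zeta> > 0" "M \<ge> 1"
  shows "integrable lborel (\<lambda>t. line_integrand x (M + 1) \<zeta> t)"
proof (rule Bochner_Integration.integrable_bound)
  show "integrable lborel (\<lambda>t. exp (Re \<zeta> * x) * (1 / norm (\<zeta> + \<i> * of_real t) ^ (M + 1)))"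
    by (intro integrable_mult_right integrable_norm_line_power assms)
qed (use borel_measurable_line_integrand[OF assms(1)] in \<open>simp_all add: norm_line_integrand del: power_Suc\<close>)

text \<open>Up to the factor \<open>2 \<pi>\<close>, the Bromwich integral for the inverse Laplace transform of \<open>z\<^sup>-\<^sup>M\<^sup>-\<^sup>1\<close> at \<open>x\<close>, taken
  along the vertical line through \<open>\<zeta>\<close>.\<close>

definition line_integral :: "nat \<Rightarrow> real \<Rightarrow> complex \<Rightarrow> complex" where
  "line_integral M x \<zeta> = (\<integral>t. line_integrand x (M + 1) \<zeta> t \<partial>lborel)"

lemma line_integral_vertical_shift:
  "line_integral M x \<zeta> = line_integral M x (of_real (Re \<zeta>))"
proof -
  let ?g = "\<lambda>t. line_integrand x (M + 1) (of_real (Re \<zeta>)) t"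
  have "of_real (Re \<zeta>) + \<i> * of_real (Im \<zeta> + 1 * t) = \<zeta> + \<i> * of_real t" for t
    by (simp add: complex_eq_iff)
  then have "line_integral M x \<zeta> = (\<integral>t. ?g (Im \<zeta> + 1 * t) \<partial>lborel)"
    unfolding line_integral_def by simp
  also have "\<dots> = (\<integral>t. ?g t \<partial>lborel)"
    by (subst lborel_integral_real_affine[where c = 1 and t = "Im \<zeta>" and f = ?g]) simp_all
  finally show ?thesis unfolding line_integral_def .
qed

lemma line_integral_holomorphic:
  assumes "M \<ge> 1"
  shows "line_integral M x holomorphic_on {\<zeta>. Re \<zeta> > 0}"
  unfolding line_integral_def[abs_def]
proof (rule holomorphic_on_integral)
  show "open {\<zeta>. Re \<zeta> > 0}" by (rule open_halfspace_Re_gt)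
  show "(\<lambda>\<zeta>. line_integrand x (M + 1) \<zeta> t) holomorphic_on {\<zeta>. Re \<zeta> > 0}" for t
    using line_nonzero by (intro holomorphic_intros) auto
  fix z assume "z \<in> {\<zeta>. Re \<zeta> > 0}"
  then have z: "Re z > 0" by simp
  then show "(\<lambda>t. line_integrand x (M + 1) z t) \<in> borel_measurable lborel"
    using borel_measurable_line_integrand[OF z, of x "M + 1"] by simp
  let ?f = "\<lambda>t z. line_integrand x (M + 1) z t"
  let ?w = "\<lambda>t. exp (2 * Re z * \<bar>x\<bar>) * 2 ^ (M + 1) * (1 / norm (z + \<i> * of_real t) ^ (M + 1))"
  show "\<exists>r>0. \<exists>w. integrable lborel w \<and> (\<forall>u\<in>ball z r. u \<in> {\<zeta>. Re \<zeta> > 0} \<and> (\<forall>t. norm (?f t u) \<le> w t))"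
  proof (intro exI conjI ballI allI)
    show "Re z / 2 > 0" using z by simp
    show "integrable lborel ?w" by (intro integrable_mult_right integrable_norm_line_power z assms)
    fix u assume u: "u \<in> ball z (Re z / 2)"
    have u1: "\<bar>Re z - Re u\<bar> < Re z / 2" using abs_Re_le_cmod[of "z - u"] u by (simp add: dist_norm)
    then have "Re u > 0" by linarith
    then show "u \<in> {\<zeta>. Re \<zeta> > 0}" by simp
    fix t
    let ?n = "norm (z + \<i> * of_real t)" and ?m = "norm (u + \<i> * of_real t)"
    have "?n \<le> ?m + norm (z - u)" using norm_triangle_ineq[of "u + \<i> * of_real t" "z - u"] by (simp add: algebra_simps)
    moreover have "norm (z - u) < ?n / 2" using u Re_le_norm_line[of z t] by (simp add: dist_norm)
    ultimately have "?n / 2 \<le> ?m" by linarith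
    then have "(?n / 2) ^ (M + 1) \<le> ?m ^ (M + 1)" by (intro power_mono) auto
    moreover have n: "?n > 0" using line_nonzero[OF z] by simp
    moreover have "?m > 0" using n \<open>?n / 2 \<le> ?m\<close> by linarith
    ultimately have "1 / ?m ^ (M + 1) \<le> 1 / (?n / 2) ^ (M + 1)"
      by (intro divide_left_mono mult_pos_pos[OF zero_less_power zero_less_power]) auto
    also have "\<dots> = 2 ^ (M + 1) * (1 / ?n ^ (M + 1))" by (simp add: power_divide del: power_Suc)
    finally have "1 / ?m ^ (M + 1) \<le> 2 ^ (M + 1) * (1 / ?n ^ (M + 1))" .
    moreover have "exp (Re u * x) \<le> exp (2 * Re z * \<bar>x\<bar>)"
    proof -
      have "Re u * x \<le> \<bar>Re u\<bar> * \<bar>x\<bar>" by (metis abs_ge_self abs_mult)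
      also have "\<dots> \<le> 2 * Re z * \<bar>x\<bar>" using u1 by (intro mult_right_mono) linarith+
      finally show ?thesis by simp
    qed
    ultimately show "norm (?f t u) \<le> ?w t"
      unfolding norm_line_integrand mult.assoc by (intro mult_mono) auto
  qed
qed

text \<open>Moving \<open>\<zeta>\<close> vertically only translates the integration variable. Hence the integral, as a holomorphic
  function of \<open>\<zeta>\<close>, is constant on a vertical line, and so it is constant on the half-plane.\<close>

lemma line_integral_constant:
  assumes "M \<ge> 1" "\<sigma> > 0" "\<sigma>' > 0"
  shows "line_integral M x (of_real \<sigma>) = line_integral M x (of_real \<sigma>')"
proof -
  have "(\<lambda>\<zeta>. line_integral M x \<zeta> - line_integral M x (of_real \<sigma>')) (of_real \<sigma>) = 0"
  proof (rule analytic_continuation[where f = "\<lambda>\<zeta>. line_integral M x \<zeta> - line_integral M x (of_real \<sigma>')" and S = "{\<zeta>. Re \<zeta> > 0}" and U = "{\<zeta>. Re \<zeta> = \<sigma>'}" and \<xi> = "of_real \<sigma>'"])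
    show "(\<lambda>\<zeta>. line_integral M x \<zeta> - line_integral M x (of_real \<sigma>')) holomorphic_on {\<zeta>. Re \<zeta> > 0}"
      by (intro holomorphic_intros line_integral_holomorphic assms)
    show "open {\<zeta>. Re \<zeta> > 0}" by (rule open_halfspace_Re_gt)
    show "connected {\<zeta>. Re \<zeta> > 0}" by (intro convex_connected convex_halfspace_Re_gt)
    show "of_real \<sigma>' islimpt {\<zeta>. Re \<zeta> = \<sigma>'}"
    proof (rule islimptI)
      fix T :: "complex set" assume T: "of_real \<sigma>' \<in> T" "open T"
      then obtain e where e: "e > 0" "ball (of_real \<sigma>') e \<subseteq> T" using open_contains_ball by blast
      let ?y = "of_real \<sigma>' + \<i> * of_real (e/2)"
      have "?y \<in> ball (of_real \<sigma>') e" using e by (simp add: dist_norm norm_mult)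
      then have "?y \<in> T" using e by blast
      then show "\<exists>y\<in>{\<zeta>. Re \<zeta> = \<sigma>'}. y \<in> T \<and> y \<noteq> of_real \<sigma>'"
        using e by (intro bexI[of _ ?y]) auto
    qed
    show "line_integral M x z - line_integral M x (of_real \<sigma>') = 0" if "z \<in> {\<zeta>. Re \<zeta> = \<sigma>'}" for z
      using that line_integral_vertical_shift[of M x z] by simp
  qed (use assms in auto)
  then show ?thesis by simp
qed

lemma line_integral_scaling:
  assumes "\<sigma> > 0"
  shows "line_integral M x (of_real \<sigma>) = of_real (inverse \<sigma> ^ M) * line_integral M (\<sigma> * x) 1"
proof -
  let ?g = "\<lambda>t. line_integrand x (M + 1) (of_real \<sigma>) t"
  have *: "?g (0 + \<sigma> * t) = of_real (inverse \<sigma> ^ (M + 1)) * (line_integrand (\<sigma> * x) (M + 1) 1 t)" for t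
  proof -
    have "of_real \<sigma> + \<i> * of_real (0 + \<sigma> * t) = of_real \<sigma> * (1 + \<i> * of_real t)" by (simp add: algebra_simps)
    moreover have "(of_real \<sigma> * (1 + \<i> * of_real t)) * of_real x = (1 + \<i> * of_real t) * of_real (\<sigma> * x)" by simp
    ultimately show ?thesis
      unfolding power_mult_distrib by (simp only: power_mult_distrib) (simp add: divide_simps)
  qed
  have "line_integral M x (of_real \<sigma>) = \<bar>\<sigma>\<bar> *\<^sub>R (\<integral>t. ?g (0 + \<sigma> * t) \<partial>lborel)"
    unfolding line_integral_def using assms by (intro lborel_integral_real_affine) auto
  also have "\<bar>\<sigma>\<bar> *\<^sub>R (\<integral>t. ?g (0 + \<sigma> * t) \<partial>lborel) = \<bar>\<sigma>\<bar> *\<^sub>R (\<integral>t. of_real (inverse \<sigma> ^ (M + 1)) * (line_integrand (\<sigma> * x) (M + 1) 1 t) \<partial>lborel)"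
    unfolding * ..
  also have "\<dots> = of_real (\<sigma> * inverse \<sigma> ^ (M + 1)) * line_integral M (\<sigma> * x) 1"
    unfolding line_integral_def integral_mult_right_zero using assms by (simp only: scaleR_conv_of_real abs_of_pos of_real_mult mult.assoc)
  also have "\<sigma> * inverse \<sigma> ^ (M + 1) = inverse \<sigma> ^ M" using assms by simp
  finally show ?thesis .
qed

text \<open>Integrating along the line through \<open>1 / x\<close> instead of \<open>1\<close> and rescaling gives homogeneity of degree \<open>M\<close>.\<close>

lemma line_integral_pos:
  assumes "M \<ge> 1" "x > 0"
  shows "line_integral M x 1 = of_real (x ^ M) * line_integral M 1 1"
proof -
  have "line_integral M x 1 = line_integral M x (of_real (1/x))"
    using line_integral_constant[of M 1 "1/x" x] assms by simp
  also have "\<dots> = of_real (x ^ M) * line_integral M 1 1"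
    using assms line_integral_scaling[of "1/x" M x] by simp
  finally show ?thesis .
qed

text \<open>For \<open>x \<le> 0\<close> the integral along the line through \<open>\<sigma>\<close> is \<open>O(\<sigma>\<^sup>-\<^sup>M)\<close>, and \<open>\<sigma>\<close> is arbitrary.\<close>

lemma line_integral_nonpos:
  assumes "M \<ge> 1" "x \<le> 0"
  shows "line_integral M x 1 = 0"
proof -
  define C where "C = (\<integral>t. 1 / norm (1 + \<i> * of_real t) ^ (M + 1) \<partial>lborel)"
  have I: "integrable lborel (\<lambda>t. 1 / norm (1 + \<i> * of_real t) ^ (M + 1))"
    using integrable_norm_line_power[of 1 M] assms by simp
  have "norm (line_integral M x 1) \<le> C * inverse \<sigma> ^ M" if "\<sigma> > 0" for \<sigma>
  proof -
    have "norm (line_integral M (\<sigma> * x) 1) \<le> C"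
      unfolding line_integral_def C_def
    proof (rule Bochner_Integration.integral_norm_bound_integral[OF integrable_line_integrand I])
      fix t
      have "exp (Re 1 * (\<sigma> * x)) \<le> 1" using assms that by (simp add: mult_nonneg_nonpos)
      then show "norm (line_integrand (\<sigma> * x) (M + 1) 1 t) \<le> 1 / norm (1 + \<i> * of_real t) ^ (M + 1)"
        unfolding norm_line_integrand by (intro mult_left_le_one_le) auto
    qed (use assms in auto)
    moreover have "line_integral M x 1 = of_real (inverse \<sigma> ^ M) * line_integral M (\<sigma> * x) 1"
      using line_integral_scaling[OF that, of M x] line_integral_constant[of M 1 \<sigma> x] assms that by simp
    ultimately show ?thesis using that by (simp add: norm_mult norm_power norm_inverse mult.commute mult_left_mono)
  qed
  moreover have "((\<lambda>\<sigma>. C * inverse \<sigma> ^ M) \<longlongrightarrow> C * 0 ^ M) at_top"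
    by (intro tendsto_intros tendsto_inverse_0_at_top filterlim_ident)
  ultimately have "norm (line_integral M x 1) \<le> C * 0 ^ M"
    by (intro tendsto_lowerbound[where F = "at_top :: real filter"]) (auto intro: eventually_mono[OF eventually_gt_at_top[of 0]])
  then show ?thesis using assms by (simp add: power_0_left)
qed

text \<open>The Laplace transform of a power, continued analytically from the moments of the Erlang density.\<close>

lemma integral_power_exp:
  assumes "Re \<zeta> > 0"
  shows "integrable lborel (\<lambda>x. indicator {0..} x *\<^sub>R (of_real (x ^ M) * exp (- (\<zeta> * of_real x))))"
    and "(\<integral>x. indicator {0..} x *\<^sub>R (of_real (x ^ M) * exp (- (\<zeta> * of_real x))) \<partial>lborel) = of_real (fact M) / \<zeta> ^ (M + 1)"
proof -
  let ?S = "{\<zeta>. Re \<zeta> > 0}"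
  let ?f = "\<lambda>x \<zeta>. indicator {0..} x *\<^sub>R (complex_of_real (x ^ M) * exp (- (\<zeta> * of_real x)))"
  let ?e = "\<lambda>r x. indicator {0..} x * x ^ M * exp (- (r * x :: real))"
  have real: "integrable lborel (?e r)" "integral\<^sup>L lborel (?e r) = fact M / r ^ (M + 1)" if "r > 0" for r
  proof -
    have e: "?e r x = fact M / r ^ (M + 1) * (erlang_density M r x * x ^ 0)" for x
      using that by (simp add: erlang_density_def)
    have "(\<integral>\<^sup>+ x. ennreal (erlang_density M r x * x ^ 0) \<partial>lborel) = 1"
      using that by (subst nn_integral_erlang_ith_moment) auto
    then have "has_bochner_integral lborel (\<lambda>x. erlang_density M r x * x ^ 0) 1"
      using that by (intro has_bochner_integral_nn_integral) auto
    then show "integrable lborel (?e r)" "integral\<^sup>L lborel (?e r) = fact M / r ^ (M + 1)"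
      unfolding e by (auto simp: has_bochner_integral_iff)
  qed
  have op: "open ?S" by (rule open_halfspace_Re_gt)
  have [measurable]: "(\<lambda>x. ?f x z) \<in> borel_measurable borel" for z
    by (intro borel_measurable_scaleR borel_measurable_indicator borel_measurable_continuous_onI continuous_intros) auto
  have nf: "norm (?f x z) = ?e (Re z) x" for x z
    by (auto simp: indicator_def norm_mult norm_power)
  show "integrable lborel (\<lambda>x. ?f x \<zeta>)"
    by (rule Bochner_Integration.integrable_bound[OF real(1)[OF assms]]) (auto simp only: nf real_norm_def abs_ge_self intro!: AE_I2, simp)
  have "(\<lambda>z. \<integral>x. ?f x z \<partial>lborel) holomorphic_on ?S"
  proof (rule holomorphic_on_integral[OF op])
    show "?f x holomorphic_on ?S" for x
      unfolding scaleR_conv_of_real by (intro holomorphic_intros)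
    fix z assume z: "z \<in> ?S"
    show "\<exists>r>0. \<exists>w. integrable lborel w \<and> (\<forall>u\<in>ball z r. u \<in> ?S \<and> (\<forall>x. norm (?f x u) \<le> w x))"
    proof (intro exI conjI ballI allI)
      show "Re z / 2 > 0" using z by simp
      then show "integrable lborel (?e (Re z / 2))" by (rule real)
      fix u assume "u \<in> ball z (Re z / 2)"
      then have u: "Re u > Re z / 2" using abs_Re_le_cmod[of "z - u"] by (simp add: dist_norm abs_le_iff)
      then show "u \<in> ?S" using z by simp
      show "norm (?f x u) \<le> ?e (Re z / 2) x" for x
        unfolding nf using u by (auto simp: indicator_def intro!: mult_left_mono mult_right_mono[of "Re z / 2", simplified])
    qed
  qed auto
  then show "(\<integral>x. ?f x \<zeta> \<partial>lborel) = of_real (fact M) / \<zeta> ^ (M + 1)"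
  proof (rule half_plane_identity[where g = "\<lambda>z. of_real (fact M) / z ^ (M + 1)", OF _ _ _ assms])
    show "(\<lambda>z. of_real (fact M) / z ^ (M + 1)) holomorphic_on ?S" by (intro holomorphic_intros) auto
    fix r :: real assume r: "r > 0"
    have "(\<integral>x. ?f x (of_real r) \<partial>lborel) = (\<integral>x. of_real (?e r x) \<partial>lborel)"
      by (rule Bochner_Integration.integral_cong) (auto simp: indicator_def simp flip: exp_of_real)
    also have "\<dots> = of_real (fact M / r ^ (M + 1))"
      by (simp only: integral_complex_of_real real(2)[OF r])
    finally show "(\<integral>x. ?f x (of_real r) \<partial>lborel) = of_real (fact M) / of_real r ^ (M + 1)" by simp
  qed
qed

text \<open>If the constant vanished, the Bromwich integral would vanish for every \<open>x\<close>. Integrating it against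
  \<open>x\<^sup>M e\<^sup>-\<^sup>2\<^sup>x\<close> over the positive half-line, however, gives \<open>M! \<integral> |1 + \<i>t|\<^sup>-\<^sup>2\<^sup>M\<^sup>-\<^sup>2 dt > 0\<close>.\<close>

lemma line_integral_nonzero:
  assumes "M \<ge> 1"
  shows "line_integral M 1 1 \<noteq> 0"
proof
  assume "line_integral M 1 1 = 0"
  then have zero: "line_integral M x 1 = 0" for x
    using line_integral_pos[OF assms, of x] line_integral_nonpos[OF assms, of x] by (cases "x > 0") auto
  let ?z = "\<lambda>t. 1 + \<i> * complex_of_real t"
  let ?h = "\<lambda>x. indicator {0..} x *\<^sub>R complex_of_real (x ^ M) * exp (- (2 * of_real x))"
  let ?F = "\<lambda>x t. ?h x * (exp (?z t * of_real x) / ?z t ^ (M + 1))"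
  let ?r = "\<lambda>x. indicator {0..} x *\<^sub>R (complex_of_real (x ^ M) * exp (- (1 * of_real x)))"
  have nz: "?z t \<noteq> 0" for t using line_nonzero[of 1 t] by simp
  have I: "integrable lborel (\<lambda>t. 1 / norm (?z t) ^ (M + 1))"
    using integrable_norm_line_power[of 1 M] assms by simp
  have nF: "norm (?F x t) = norm (?r x) * (1 / norm (?z t) ^ (M + 1))" for x t
  proof -
    have "norm (?h x) * exp (Re 1 * x) = norm (?r x)"
      by (auto simp: norm_mult norm_power norm_exp_eq_Re indicator_def mult.assoc simp flip: exp_add)
    then show ?thesis unfolding norm_mult[of "?h x"] norm_line_integrand by (simp only: mult.assoc[symmetric])
  qed
  have ir: "integrable lborel ?r" by (rule integral_power_exp) simp
  have int: "integrable (lborel \<Otimes>\<^sub>M lborel) (case_prod ?F)"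
  proof (rule lborel_pair.Fubini_integrable)
    show "case_prod ?F \<in> borel_measurable (lborel \<Otimes>\<^sub>M lborel)"
    proof -
      have "(\<lambda>p. exp (?z (snd p) * of_real (fst p)) / ?z (snd p) ^ (M + 1)) \<in> borel_measurable (borel :: (real \<times> real) measure)"
        using nz by (intro borel_measurable_continuous_onI continuous_intros) auto
      then have [measurable]: "(\<lambda>p. exp (?z (snd p) * of_real (fst p)) / ?z (snd p) ^ (M + 1)) \<in> borel_measurable (lborel \<Otimes>\<^sub>M lborel)"
        by (simp add: lborel_prod)
      show ?thesis unfolding case_prod_unfold by measurable
    qed
    show "integrable lborel (\<lambda>x. \<integral>t. norm (case (x, t) of (x, t) \<Rightarrow> ?F x t) \<partial>lborel)"
      unfolding prod.case nF using ir by (subst integral_mult_right_zero) (intro integrable_mult_left integrable_norm)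
    show "AE x in lborel. integrable lborel (\<lambda>t. case (x, t) of (x, t) \<Rightarrow> ?F x t)"
    proof (rule AE_I2)
      fix x
      show "integrable lborel (\<lambda>t. case (x, t) of (x, t) \<Rightarrow> ?F x t)"
        unfolding prod.case by (intro integrable_mult_right integrable_line_integrand assms) simp
    qed
  qed
  have "(\<integral>x. ?F x t \<partial>lborel) = of_real (fact M * (1 / (1 + t\<^sup>2) ^ (M + 1)))" for t
  proof -
    let ?w = "1 - \<i> * complex_of_real t"
    have "exp (- (2 * complex_of_real x)) * exp (?z t * of_real x) = exp (- (?w * of_real x))" for x
      by (simp add: algebra_simps flip: exp_add)
    then have "?F x t = indicator {0..} x *\<^sub>R (of_real (x ^ M) * exp (- (?w * of_real x))) * (1 / ?z t ^ (M + 1))" for x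
      by (simp add: scaleR_conv_of_real mult.assoc flip: mult.assoc[of "exp (- (2 * complex_of_real x))"])
    then have "(\<integral>x. ?F x t \<partial>lborel) = (\<integral>x. indicator {0..} x *\<^sub>R (of_real (x ^ M) * exp (- (?w * of_real x))) \<partial>lborel) * (1 / ?z t ^ (M + 1))"
      by (simp only: integral_mult_left_zero)
    also have "\<dots> = (of_real (fact M) / ?w ^ (M + 1)) * (1 / ?z t ^ (M + 1))"
      by (subst integral_power_exp(2)) simp_all
    also have "\<dots> = of_real (fact M) * (1 / (?w * ?z t) ^ (M + 1))" by (simp add: power_mult_distrib)
    also have "?w * ?z t = of_real (1 + t\<^sup>2)" by (simp add: complex_eq_iff power2_eq_square)
    finally show ?thesis by (simp add: of_real_divide of_real_power)
  qed
  then have "of_real (\<integral>t. fact M * (1 / (1 + t\<^sup>2) ^ (M + 1)) \<partial>lborel) = (\<integral>t. (\<integral>x. ?F x t \<partial>lborel) \<partial>lborel)"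
    by (simp only: integral_complex_of_real)
  also have "\<dots> = (\<integral>x. (\<integral>t. ?F x t \<partial>lborel) \<partial>lborel)"
    by (rule lborel_pair.Fubini_integral[OF int])
  also have "\<dots> = 0"
  proof -
    have "(\<integral>t. ?F x t \<partial>lborel) = 0" for x
      using zero[of x] unfolding integral_mult_right_zero line_integral_def by simp
    then show ?thesis by (simp only: Bochner_Integration.integral_zero)
  qed
  finally have Z: "(\<integral>t. fact M * (1 / (1 + (t::real)\<^sup>2) ^ (M + 1)) \<partial>lborel) = 0" by simp
  have "integrable lborel (\<lambda>t::real. 1 / (1 + t\<^sup>2) ^ (M + 1))"
  proof (rule Bochner_Integration.integrable_bound)
    show "integrable lborel (\<lambda>t::real. 1 / (1\<^sup>2 + t\<^sup>2))" by (rule integrable_inverse_plus_sq) simp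
    show "AE t in (lborel :: real measure). norm (1 / (1 + t\<^sup>2) ^ (M + 1)) \<le> norm (1 / (1\<^sup>2 + t\<^sup>2))"
    proof (rule AE_I2)
      fix t :: real
      have "(1 + t\<^sup>2) ^ 1 \<le> (1 + t\<^sup>2) ^ (M + 1)" by (rule power_increasing) auto
      then show "norm (1 / (1 + t\<^sup>2) ^ (M + 1)) \<le> norm (1 / (1\<^sup>2 + t\<^sup>2))"
        by (simp add: frac_le add_pos_nonneg del: power_Suc)
    qed
  qed measurable
  then have int: "integrable lborel (\<lambda>t::real. fact M * (1 / (1 + t\<^sup>2) ^ (M + 1)) :: real)"
    by (rule integrable_mult_right)
  have nonneg: "AE t in lborel. 0 \<le> fact M * (1 / (1 + (t::real)\<^sup>2) ^ (M + 1))"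
    by (intro AE_I2 mult_nonneg_nonneg divide_nonneg_nonneg zero_le_power) auto
  have "AE t in lborel. fact M * (1 / (1 + (t::real)\<^sup>2) ^ (M + 1)) = 0"
    by (rule integral_nonneg_eq_0_iff_AE[OF int nonneg, THEN iffD1, OF Z])
  then have "AE t in (lborel::real measure). False"
  proof (rule AE_mp[OF _ AE_I2], intro impI)
    fix t :: real assume elim: "fact M * (1 / (1 + t\<^sup>2) ^ (M + 1)) = (0 :: real)"
    have "1 + t\<^sup>2 > 0" by (simp add: add_pos_nonneg)
    then show False using elim by simp
  qed
  then show False by (simp add: eventually_False ae_filter_eq_bot_iff)
qed

lemma laplace_inversion_power:
  assumes "M \<ge> 1"
  obtains c where "c \<noteq> 0"
    "\<And>x. (\<integral>t. exp ((1 + \<i> * of_real t) * of_real x) / (1 + \<i> * of_real t) ^ (M + 1) \<partial>lborel) = c * of_real (max x 0 ^ M)"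
proof
  show "line_integral M 1 1 \<noteq> 0" by (rule line_integral_nonzero[OF assms])
  show "(\<integral>t. exp ((1 + \<i> * of_real t) * of_real x) / (1 + \<i> * of_real t) ^ (M + 1) \<partial>lborel) = line_integral M 1 1 * of_real (max x 0 ^ M)" for x
    using line_integral_pos[OF assms, of x] line_integral_nonpos[OF assms, of x] assms
    by (cases "x > 0") (auto simp: line_integral_def max_def power_0_left)
qed

section \<open>Superpositions of integrable kernels\<close>

definition L1_symbol :: "(real ^ 'n \<Rightarrow> complex) \<Rightarrow> bool" where
  "L1_symbol \<Phi> \<longleftrightarrow> (\<exists>g. integrable lborel g \<and> (\<forall>\<xi>. fourier_transform g \<xi> = \<Phi> \<xi>))"

lemma norm_fourier_kernel [simp]: "norm (fourier_kernel \<xi> x) = 1"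
  unfolding fourier_kernel_eq by (simp add: norm_exp_eq_Re)

lemma continuous_fourier_kernel: "continuous_on UNIV (fourier_kernel \<xi>)"
  unfolding fourier_kernel_eq[abs_def] by (intro continuous_intros)

lemma borel_measurable_fourier_kernel [measurable]: "fourier_kernel \<xi> \<in> borel_measurable borel"
  by (intro borel_measurable_continuous_onI continuous_fourier_kernel)

text \<open>The exchange of integrals behind every superposition below; \<open>\<Omega>\<close> is the parameter space.\<close>

lemma L1_symbol_superposition:
  fixes G :: "'w \<Rightarrow> real ^ 'n \<Rightarrow> complex"
  assumes "sigma_finite_measure \<Omega>"
    and meas [measurable]: "case_prod G \<in> borel_measurable (\<Omega> \<Otimes>\<^sub>M lborel)"
    and int: "\<And>\<omega>. integrable lborel (G \<omega>)"
    and norm_int: "integrable \<Omega> (\<lambda>\<omega>. \<integral>x. norm (G \<omega> x) \<partial>lborel)"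
  shows "L1_symbol (\<lambda>\<xi>. \<integral>\<omega>. fourier_transform (G \<omega>) \<xi> \<partial>\<Omega>)"
    and "integrable \<Omega> (\<lambda>\<omega>. fourier_transform (G \<omega>) \<xi>)"
proof -
  interpret \<Omega>: sigma_finite_measure \<Omega> by fact
  interpret pair_sigma_finite \<Omega> "lborel :: (real ^ 'n) measure" ..
  interpret S: pair_sigma_finite "lborel :: (real ^ 'n) measure" \<Omega> ..
  have I: "integrable (\<Omega> \<Otimes>\<^sub>M lborel) (case_prod G)"
    by (rule Fubini_integrable) (use meas int norm_int in auto)
  have J: "integrable (\<Omega> \<Otimes>\<^sub>M lborel) (case_prod (\<lambda>\<omega> x. G \<omega> x * fourier_kernel \<xi> x))" for \<xi>
    by (rule Bochner_Integration.integrable_bound[OF I]) (auto simp: norm_mult)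
  have "integrable lborel (\<lambda>x. \<integral>\<omega>. G \<omega> x \<partial>\<Omega>)"
    using S.integrable_fst'[OF integrable_product_swap[OF I]] by simp
  moreover have "fourier_transform (\<lambda>x. \<integral>\<omega>. G \<omega> x \<partial>\<Omega>) \<xi> = (\<integral>\<omega>. fourier_transform (G \<omega>) \<xi> \<partial>\<Omega>)" for \<xi>
  proof -
    have "fourier_transform (\<lambda>x. \<integral>\<omega>. G \<omega> x \<partial>\<Omega>) \<xi> = (\<integral>x. (\<integral>\<omega>. G \<omega> x * fourier_kernel \<xi> x \<partial>\<Omega>) \<partial>lborel)"
      by (simp add: fourier_transform_def)
    also have "\<dots> = (\<integral>\<omega>. fourier_transform (G \<omega>) \<xi> \<partial>\<Omega>)"
      unfolding fourier_transform_def by (rule Fubini_integral[OF J])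
    finally show ?thesis .
  qed
  ultimately show "L1_symbol (\<lambda>\<xi>. \<integral>\<omega>. fourier_transform (G \<omega>) \<xi> \<partial>\<Omega>)"
    unfolding L1_symbol_def by blast
  show "integrable \<Omega> (\<lambda>\<omega>. fourier_transform (G \<omega>) \<xi>)"
    using integrable_fst'[OF J[of \<xi>]] by (simp add: fourier_transform_def)
qed

lemma continuous_gauss_kernel:
  "continuous_on ({z. Re z > 0} \<times> UNIV) (\<lambda>(z, x). gauss_kernel z (x :: real ^ 'n))"
proof -
  have nz: "Re z > 0 \<Longrightarrow> 4 * of_real pi * z \<notin> \<real>\<^sub>\<le>\<^sub>0" for z by (auto simp: complex_nonpos_Reals_iff zero_less_mult_iff not_le)
  then have "Re z > 0 \<Longrightarrow> csqrt (4 * of_real pi * z) \<noteq> 0" for z by auto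
  then show ?thesis
    unfolding gauss_kernel_def case_prod_unfold using nz
    by (intro continuous_intros continuous_on_compose2[OF continuous_on_csqrt]) auto
qed

text \<open>Each Riesz mean \<open>(1 - \<rho> / r)\<^sub>+\<^sup>M\<close> is the superposition of \<open>exp (- z \<rho> / r)\<close> over the line \<open>z = 1 + \<i>t\<close> with
  density \<open>e\<^sup>z z\<^sup>-\<^sup>M\<^sup>-\<^sup>1\<close>. The Gaussian kernels have norms at most \<open>|z|\<^sup>n\<close>, so \<open>M > n\<close> leaves an integrable
  \<open>|z|\<^sup>-\<^sup>2\<close>. The parameters \<open>r\<close> and \<open>t\<close> are treated together, as a point of the plane.\<close>

lemma L1_symbol_riesz_superposition:
  fixes k :: "real \<Rightarrow> real"
  assumes M: "M \<ge> CARD('n) + 1"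
    and k: "integrable lborel k" and k0: "\<And>r. r \<le> 0 \<Longrightarrow> k r = 0"
  shows "L1_symbol (\<lambda>\<xi> :: real ^ 'n. of_real (\<integral>r. k r * max (1 - laplace_symbol \<xi> / r) 0 ^ M \<partial>lborel))"
proof -
  obtain c where c: "c \<noteq> 0"
    "\<And>x. (\<integral>t. exp ((1 + \<i> * of_real t) * of_real x) / (1 + \<i> * of_real t) ^ (M + 1) \<partial>lborel) = c * of_real (max x 0 ^ M)"
    using laplace_inversion_power[of M] M by auto
  let ?z = "\<lambda>t. 1 + \<i> * complex_of_real t"
  define A where "A r t = of_real (k r) * (exp (?z t) / ?z t ^ (M + 1)) / c" for r t
  \<comment> \<open>The value for \<open>r \<le> 0\<close>, where \<open>k\<close> vanishes, only keeps the Gaussian parameter in the half-plane.\<close>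
  define \<rho> where "\<rho> r = (if r > 0 then r else 1)" for r :: real
  define G :: "real \<times> real \<Rightarrow> real ^ 'n \<Rightarrow> complex" where
    "G = (\<lambda>(r, t) x. A r t * gauss_kernel (?z t / of_real (\<rho> r)) x)"
  have \<rho>: "\<rho> r > 0" for r by (simp add: \<rho>_def)
  have Re: "Re (?z t / of_real (\<rho> r)) > 0" for t r using \<rho>[of r] by simp
  have nz: "?z t \<noteq> 0" for t using line_nonzero[of 1 t] by simp
  have [measurable]: "k \<in> borel_measurable borel" using k by auto
  have [measurable]: "(\<lambda>t. exp (?z t) / ?z t ^ (M + 1)) \<in> borel_measurable borel"
    using nz by (intro borel_measurable_continuous_onI continuous_intros) auto
  have [measurable]: "\<rho> \<in> borel_measurable borel" unfolding \<rho>_def by measurable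
  have meas: "case_prod G \<in> borel_measurable (lborel \<Otimes>\<^sub>M lborel)"
  proof -
    have "(\<lambda>p. if p \<in> {z. Re z > 0} \<times> (UNIV :: (real ^ 'n) set) then (\<lambda>(z, x). gauss_kernel z x) p else 0) \<in> borel_measurable borel"
      by (intro borel_measurable_continuous_on_if continuous_gauss_kernel)
        (auto intro!: borel_open open_Times open_halfspace_Re_gt)
    then have m: "(\<lambda>p. if p \<in> {z. Re z > 0} \<times> (UNIV :: (real ^ 'n) set) then (\<lambda>(z, x). gauss_kernel z x) p else 0) \<in> borel_measurable (borel \<Otimes>\<^sub>M borel)"
      by (simp only: borel_prod)
    have "(\<lambda>q. (?z (snd (fst q)) / of_real (\<rho> (fst (fst q))), snd q)) \<in> (lborel \<Otimes>\<^sub>M lborel) \<rightarrow>\<^sub>M (borel \<Otimes>\<^sub>M borel :: (complex \<times> (real ^ 'n)) measure)"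
      unfolding lborel_prod[symmetric] by measurable
    from measurable_compose[OF this m]
    have "(\<lambda>q. gauss_kernel (?z (snd (fst q)) / of_real (\<rho> (fst (fst q)))) (snd q :: real ^ 'n)) \<in> borel_measurable (lborel \<Otimes>\<^sub>M lborel)"
      using Re by simp
    moreover have "(\<lambda>q. A (fst (fst q)) (snd (fst q))) \<in> borel_measurable (lborel \<Otimes>\<^sub>M (lborel :: (real ^ 'n) measure))"
      unfolding A_def lborel_prod[symmetric] by measurable
    ultimately show ?thesis unfolding G_def case_prod_unfold by (rule borel_measurable_times[rotated])
  qed
  have nA: "norm (A r t) = \<bar>k r\<bar> * (exp 1 / norm c) * (1 / norm (?z t) ^ (M + 1))" for r t
    by (simp add: A_def norm_mult norm_divide norm_power norm_exp_eq_Re mult_ac)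
  have nG: "(\<integral>x. norm (G (r, t) x) \<partial>lborel) = norm (A r t) * sqrt (norm (?z t)) ^ CARD('n)" for r t
  proof -
    have "norm (?z t / of_real (\<rho> r)) / Re (?z t / of_real (\<rho> r)) = norm (?z t)"
      using \<rho>[of r] by (simp add: norm_divide)
    then show ?thesis
      unfolding G_def by (simp add: norm_mult gauss_kernel(2)[OF Re])
  qed
  have I: "integrable lborel (\<lambda>p. \<integral>x. norm (G p x) \<partial>lborel)"
    unfolding lborel_prod[symmetric]
  proof (rule Bochner_Integration.integrable_bound)
    let ?w = "\<lambda>(r, t). k r * (exp 1 / norm c * (1 / norm (?z t) ^ (1 + 1)))"
    show "integrable (lborel \<Otimes>\<^sub>M lborel) ?w"
    proof (rule lborel_pair.Fubini_integrable)
      have J: "integrable lborel (\<lambda>t. exp 1 / norm c * (1 / norm (?z t) ^ (1 + 1)))"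
        using integrable_norm_line_power[of 1 1] by (intro integrable_mult_right) simp
      show "?w \<in> borel_measurable (lborel \<Otimes>\<^sub>M lborel)" by measurable
      show "integrable lborel (\<lambda>r. \<integral>t. norm (?w (r, t)) \<partial>lborel)"
      proof -
        have "(\<integral>t. norm (?w (r, t)) \<partial>lborel) = norm (k r) * (\<integral>t. norm (exp 1 / norm c * (1 / norm (?z t) ^ (1 + 1))) \<partial>lborel)" for r
          unfolding prod.case norm_mult[of "k r"] by (rule integral_mult_right_zero)
        then show ?thesis by (simp only: integrable_mult_left integrable_norm k)
      qed
      show "AE r in lborel. integrable lborel (\<lambda>t. ?w (r, t))"
        unfolding prod.case by (intro AE_I2 integrable_mult_right J)
    qed
    have "(\<lambda>p. \<integral>x. norm (G p x) \<partial>lborel) = (\<lambda>(r, t). norm (A r t) * sqrt (norm (?z t)) ^ CARD('n))"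
      by (auto simp: fun_eq_iff nG)
    then show "(\<lambda>p. \<integral>x. norm (G p x) \<partial>lborel) \<in> borel_measurable (lborel \<Otimes>\<^sub>M lborel)"
      unfolding A_def by simp
    show "AE p in lborel \<Otimes>\<^sub>M lborel. norm (\<integral>x. norm (G p x) \<partial>lborel) \<le> norm (?w p)"
    proof (intro AE_I2)
      fix p :: "real \<times> real"
      obtain r t where p: "p = (r, t)" by (cases p)
      let ?n = "norm (?z t)"
      have n1: "?n \<ge> 1" using Re_le_norm_line[of 1 t] by simp
      have "sqrt ?n ^ CARD('n) \<le> ?n ^ CARD('n)"
      proof (rule power_mono)
        show "sqrt ?n \<le> ?n" using n1 self_le_power[of ?n 2] by (intro real_le_lsqrt) auto
      qed simp
      also have "?n ^ CARD('n) \<le> ?n ^ (M - 1)" using n1 M by (intro power_increasing) auto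
      finally have "1 / ?n ^ (M + 1) * sqrt ?n ^ CARD('n) \<le> 1 / ?n ^ (M + 1) * ?n ^ (M - 1)"
        by (intro mult_left_mono) auto
      also have "\<dots> = 1 / ?n ^ (1 + 1)"
      proof -
        have "M + 1 = M - 1 + (1 + 1)" using M by linarith
        then have "?n ^ (M + 1) = ?n ^ (M - 1) * ?n ^ (1 + 1)" by (metis power_add)
        moreover have "1 / (a * b) * a = 1 / b" if "a > 0" for a b :: real using that by simp
        ultimately show ?thesis using n1 by (metis zero_less_power less_le_trans zero_less_one)
      qed
      finally have "\<bar>k r\<bar> * (exp 1 / norm c) * (1 / ?n ^ (M + 1) * sqrt ?n ^ CARD('n)) \<le> \<bar>k r\<bar> * (exp 1 / norm c) * (1 / ?n ^ (1 + 1))"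
        by (intro mult_left_mono) auto
      then show "norm (\<integral>x. norm (G p x) \<partial>lborel) \<le> norm (?w p)"
        by (simp add: p nG nA abs_mult mult_ac)
    qed
  qed
  have sf: "sigma_finite_measure (lborel :: (real \<times> real) measure)" ..
  have iG: "integrable lborel (G \<omega>)" for \<omega>
    unfolding G_def case_prod_unfold by (intro integrable_mult_right gauss_kernel(1) Re)
  note sup = L1_symbol_superposition[OF sf meas iG I]
  have "L1_symbol (\<lambda>\<xi>. \<integral>\<omega>. fourier_transform (G \<omega>) \<xi> \<partial>lborel)" by (rule sup)
  moreover have "(\<integral>\<omega>. fourier_transform (G \<omega>) \<xi> \<partial>lborel) = of_real (\<integral>r. k r * max (1 - laplace_symbol \<xi> / r) 0 ^ M \<partial>lborel)" for \<xi>
  proof -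
    let ?L = "laplace_symbol \<xi>"
    have L: "?L \<ge> 0" by (simp add: laplace_symbol_def)
    have fG: "fourier_transform (G (r, t)) \<xi> = A r t * exp (- (?z t / of_real (\<rho> r) * of_real ?L))" for r t
      unfolding G_def prod.case using gauss_kernel(3)[OF Re, of t r \<xi>]
      by (simp add: fourier_transform_def mult.assoc)
    have eq: "fourier_transform (G (r, t)) \<xi> = of_real (k r) / c * (exp (?z t * of_real (1 - ?L / \<rho> r)) / ?z t ^ (M + 1))" for r t
    proof -
      have "?z t * of_real (1 - ?L / \<rho> r) = ?z t + - (?z t / of_real (\<rho> r) * of_real ?L)"
        by (simp add: right_diff_distrib)
      then have "exp (?z t * of_real (1 - ?L / \<rho> r)) = exp (?z t) * exp (- (?z t / of_real (\<rho> r) * of_real ?L))"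
        by (simp only: exp_add)
      then show ?thesis unfolding fG A_def by (simp only: times_divide_eq_left times_divide_eq_right divide_divide_eq_left mult_ac)
    qed
    have int: "integrable (lborel \<Otimes>\<^sub>M lborel) (case_prod (\<lambda>r t. fourier_transform (G (r, t)) \<xi>))"
      using sup(2)[of \<xi>] by (simp add: lborel_prod case_prod_unfold)
    have "(\<integral>\<omega>. fourier_transform (G \<omega>) \<xi> \<partial>lborel) = (\<integral>r. (\<integral>t. fourier_transform (G (r, t)) \<xi> \<partial>lborel) \<partial>lborel)"
      unfolding lborel_prod[symmetric] using lborel_pair.integral_fst'[OF int] by (simp add: case_prod_unfold)
    also have "\<dots> = (\<integral>r. of_real (k r * max (1 - ?L / r) 0 ^ M) \<partial>lborel)"
    proof (rule Bochner_Integration.integral_cong[OF refl])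
      fix r
      have "(\<integral>t. fourier_transform (G (r, t)) \<xi> \<partial>lborel) = of_real (k r) / c * (c * of_real (max (1 - ?L / \<rho> r) 0 ^ M))"
        unfolding eq integral_mult_right_zero c(2) ..
      also have "\<dots> = of_real (k r * max (1 - ?L / \<rho> r) 0 ^ M)" using c(1) by simp
      also have "k r * max (1 - ?L / \<rho> r) 0 ^ M = k r * max (1 - ?L / r) 0 ^ M"
        using k0[of r] by (cases "r > 0") (auto simp: \<rho>_def)
      finally show "(\<integral>t. fourier_transform (G (r, t)) \<xi> \<partial>lborel) = of_real (k r * max (1 - ?L / r) 0 ^ M)" .
    qed
    finally show ?thesis by (simp only: integral_complex_of_real)
  qed
  ultimately show ?thesis by simp
qed

text \<open>The real part of the kernel has the symbol \<open>(\<Phi>(\<xi>) + cnj (\<Phi>(- \<xi>))) / 2\<close>.\<close>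

lemma L1_symbol_real_even:
  fixes \<Phi> :: "real ^ 'n \<Rightarrow> real"
  assumes "L1_symbol (\<lambda>\<xi>. of_real (\<Phi> \<xi>))" "\<And>\<xi>. \<Phi> (- \<xi>) = \<Phi> \<xi>"
  obtains g :: "real ^ 'n \<Rightarrow> real" where "integrable lborel g"
    "\<And>\<xi>. fourier_transform (\<lambda>x. complex_of_real (g x)) \<xi> = of_real (\<Phi> \<xi>)"
proof -
  obtain G where G: "integrable lborel G" "\<And>\<xi>. fourier_transform G \<xi> = of_real (\<Phi> \<xi>)"
    using assms(1) unfolding L1_symbol_def by blast
  have i: "integrable lborel (\<lambda>x. G x * fourier_kernel \<xi> x)" for \<xi>
    by (rule Bochner_Integration.integrable_bound[OF G(1)]) (use G(1) in \<open>auto simp: norm_mult\<close>)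
  have k: "cnj (fourier_kernel (- \<xi>) x) = fourier_kernel \<xi> x" for \<xi> x :: "real ^ 'n"
    by (simp add: fourier_kernel_def exp_cnj)
  have "fourier_transform (\<lambda>x. of_real (Re (G x))) \<xi> = of_real (\<Phi> \<xi>)" for \<xi>
  proof -
    have "of_real (Re (G x)) * fourier_kernel \<xi> x = (G x * fourier_kernel \<xi> x + cnj (G x * fourier_kernel (- \<xi>) x)) / 2" for x
      unfolding complex_cnj_mult k using complex_add_cnj[of "G x"] by (simp flip: distrib_right)
    then have "fourier_transform (\<lambda>x. of_real (Re (G x))) \<xi> = (\<integral>x. (G x * fourier_kernel \<xi> x + cnj (G x * fourier_kernel (- \<xi>) x)) / 2 \<partial>lborel)"
      unfolding fourier_transform_def by (simp only:)
    also have "\<dots> = (fourier_transform G \<xi> + cnj (fourier_transform G (- \<xi>))) / 2"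
      unfolding fourier_transform_def integral_divide_zero using i by (simp only: Bochner_Integration.integral_add integrable_cnj Bochner_Integration.integral_cnj)
    also have "\<dots> = of_real (\<Phi> \<xi>)" by (simp add: G(2) assms(2))
    finally show ?thesis .
  qed
  then show ?thesis using G(1) by (intro that[of "\<lambda>x. Re (G x)"]) auto
qed

section \<open>Taylor's formula at infinity\<close>

text \<open>The Taylor polynomial \<open>T(r)\<close> of \<open>F\<close> with base point \<open>r\<close>, evaluated at \<open>\<rho>\<close>, telescopes under \<open>d / dr\<close>, tends
  to \<open>F(\<rho>)\<close> as \<open>r\<close> decreases to \<open>\<rho>\<close> and to \<open>0\<close> as \<open>r\<close> grows. Its derivative is the integrand, with
  \<open>(r - \<rho>)\<^sup>M\<close> written as \<open>r\<^sup>M (1 - \<rho> / r)\<^sup>M\<close>. At the end point \<open>\<rho> = 0\<close> the limits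
  \<open>r\<^sup>k F\<^sup>(\<^sup>k\<^sup>)(r) \<rightarrow> 0\<close> take the place of the continuity of the derivatives.\<close>

lemma taylor_from_infinity:
  fixes F :: "nat \<Rightarrow> real \<Rightarrow> real"
  assumes "M \<ge> 1" "\<rho> \<ge> 0"
    and der: "\<And>k r. k \<le> M \<Longrightarrow> r > 0 \<Longrightarrow> (F k has_real_derivative F (Suc k) r) (at r)"
    and cont: "continuous_on {0<..} (F (Suc M))"
    and lim_top: "\<And>k. k \<le> M \<Longrightarrow> ((\<lambda>r. r ^ k * F k r) \<longlongrightarrow> 0) at_top"
    and lim_0: "(F 0 \<longlongrightarrow> F 0 0) (at_right 0)"
       "\<And>k. k \<in> {1..M} \<Longrightarrow> ((\<lambda>r. r ^ k * F k r) \<longlongrightarrow> 0) (at_right 0)"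
    and int: "set_integrable lborel {0<..} (\<lambda>r. r ^ M * F (Suc M) r)"
  shows "F 0 \<rho> = (\<integral>r. (- 1) ^ Suc M / fact M * (indicator {0<..} r * (r ^ M * F (Suc M) r)) * max (1 - \<rho> / r) 0 ^ M \<partial>lborel)"
proof -
  let ?T = "\<lambda>k r. (- 1) ^ k / fact k * ((r - \<rho>) ^ k * F k r)" and ?h = "\<lambda>r. indicator {0<..} r * (r ^ M * F (Suc M) r)"
  define T where "T m r = (\<Sum>k\<le>m. ?T k r)" for m r
  define t where "t m r = (- 1) ^ m / fact m * ((r - \<rho>) ^ m * F (Suc m) r)" for m r
  have dT: "(T m has_real_derivative t m r) (at r)" if "m \<le> M" "r > 0" for m r
    using that(1)
  proof (induction m)
    case 0
    then show ?case using der[of 0 r] that by (simp add: T_def[abs_def] t_def)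
  next
    case (Suc m)
    let ?c = "(- 1) ^ Suc m / fact (Suc m) :: real"
    have P: "((\<lambda>r. (r - \<rho>) ^ Suc m) has_real_derivative real (Suc m) * (r - \<rho>) ^ m) (at r)"
      using DERIV_power[of "\<lambda>r. r - \<rho>" 1 r UNIV "Suc m"] by (auto intro!: derivative_eq_intros simp del: power_Suc)
    have "((\<lambda>r. ?c * ((r - \<rho>) ^ Suc m * F (Suc m) r)) has_real_derivative
       ?c * (real (Suc m) * (r - \<rho>) ^ m * F (Suc m) r + F (Suc (Suc m)) r * (r - \<rho>) ^ Suc m)) (at r)"
      using Suc.prems that by (intro DERIV_cmult DERIV_mult P der) auto
    then have "((\<lambda>r. T m r + ?c * ((r - \<rho>) ^ Suc m * F (Suc m) r)) has_real_derivative
       t m r + ?c * (real (Suc m) * (r - \<rho>) ^ m * F (Suc m) r + F (Suc (Suc m)) r * (r - \<rho>) ^ Suc m)) (at r)"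
      using Suc by (intro DERIV_add) auto
    moreover have "t m r + ?c * (real (Suc m) * (r - \<rho>) ^ m * F (Suc m) r + F (Suc (Suc m)) r * (r - \<rho>) ^ Suc m) = t (Suc m) r"
    proof -
      have "?c * real (Suc m) = - ((- 1) ^ m / fact m)" by (simp add: fact_Suc divide_simps del: of_nat_Suc)
      then have "?c * (real (Suc m) * (r - \<rho>) ^ m * F (Suc m) r) = - t m r"
        unfolding t_def by (simp only: mult.assoc[symmetric] mult_minus_left)
      then show ?thesis by (simp only: distrib_left t_def add.assoc[symmetric] right_minus add_0_left mult.commute[of "F (Suc (Suc m)) r"])
    qed
    ultimately show ?case by (simp add: T_def[abs_def])
  qed
  have contF: "isCont (F k) r" if "k \<le> Suc M" "r > 0" for k r
  proof (cases "k \<le> M")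
    case True
    then show ?thesis using der that DERIV_isCont by blast
  next
    case False
    then have "k = Suc M" using that by simp
    then show ?thesis using cont that by (simp add: continuous_on_eq_continuous_at)
  qed
  have T_top: "(T M \<longlongrightarrow> 0) at_top"
  proof -
    have "((\<lambda>r. ?T k r) \<longlongrightarrow> 0) at_top" if "k \<le> M" for k
    proof (rule Lim_null_comparison)
      show "\<forall>\<^sub>F r in at_top. norm (?T k r) \<le> \<bar>r ^ k * F k r\<bar>"
      proof (rule eventually_mono[OF eventually_gt_at_top[of \<rho>]])
        fix r assume r: "r > \<rho>"
        have "\<bar>r - \<rho>\<bar> ^ k / fact k \<le> \<bar>r\<bar> ^ k / 1"
          using r assms(2) by (intro frac_le power_mono) auto
        then have "\<bar>r - \<rho>\<bar> ^ k / fact k * \<bar>F k r\<bar> \<le> \<bar>r\<bar> ^ k * \<bar>F k r\<bar>" by (intro mult_right_mono) auto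
        then show "norm (?T k r) \<le> \<bar>r ^ k * F k r\<bar>"
          by (simp add: abs_mult power_abs)
      qed
      show "((\<lambda>r. \<bar>r ^ k * F k r\<bar>) \<longlongrightarrow> 0) at_top" using tendsto_rabs[OF lim_top[OF that]] by simp
    qed
    then have "(T M \<longlongrightarrow> (\<Sum>k\<le>M. 0)) at_top" unfolding T_def[abs_def] by (intro tendsto_sum) auto
    then show ?thesis by simp
  qed
  have T_rho: "(T M \<longlongrightarrow> F 0 \<rho>) (at_right \<rho>)"
  proof -
    have "((\<lambda>r. ?T k r) \<longlongrightarrow> (if k = 0 then F 0 \<rho> else 0)) (at_right \<rho>)" if "k \<le> M" for k
    proof (cases "\<rho> = 0")
      case True
      show ?thesis
      proof (cases "k = 0")
        case True
        then show ?thesis using lim_0(1) \<open>\<rho> = 0\<close> by simp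
      next
        case False
        then have "((\<lambda>r. (- 1) ^ k / fact k * (r ^ k * F k r)) \<longlongrightarrow> (- 1) ^ k / fact k * 0) (at_right 0)"
          using that by (intro tendsto_mult_left lim_0) auto
        then show ?thesis using False \<open>\<rho> = 0\<close> by simp
      qed
    next
      case False
      then have "isCont (\<lambda>r. ?T k r) \<rho>"
        using assms that by (intro continuous_intros contF) auto
      then have "((\<lambda>r. ?T k r) \<longlongrightarrow> (- 1) ^ k / fact k * ((\<rho> - \<rho>) ^ k * F k \<rho>)) (at_right \<rho>)"
        unfolding isCont_def by (rule tendsto_within_subset) simp
      then show ?thesis by (simp add: power_0_left split: if_splits)
    qed
    then have "(T M \<longlongrightarrow> (\<Sum>k\<le>M. if k = 0 then F 0 \<rho> else 0)) (at_right \<rho>)"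
      unfolding T_def[abs_def] by (intro tendsto_sum) auto
    then show ?thesis by simp
  qed
  define g where "g r = (- 1) ^ Suc M / fact M * (?h r) * max (1 - \<rho> / r) 0 ^ M" for r
  have g: "g r = indicator {\<rho><..} r * (- t M r)" for r
  proof (cases "r > \<rho>")
    case True
    then have r: "r > 0" using assms by simp
    have "max (1 - \<rho> / r) 0 = (r - \<rho>) / r" using True r by (simp add: field_simps)
    then have "r ^ M * max (1 - \<rho> / r) 0 ^ M = (r - \<rho>) ^ M" using r by (simp add: power_divide)
    then show ?thesis using True r by (simp add: g_def t_def mult_ac)
  next
    case False
    then have "r \<le> 0 \<or> max (1 - \<rho> / r) 0 = 0" by (auto simp: field_simps max_def)
    then show ?thesis using False assms(1) by (auto simp: g_def power_0_left)
  qed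
  then have ge: "g = (\<lambda>r. indicator {\<rho><..} r * (- t M r))" by blast
  have e: "einterval (ereal \<rho>) \<infinity> = {\<rho><..}" by (auto simp: einterval_def)
  have m: "(\<lambda>r. ?h r) \<in> borel_measurable lborel"
    using int unfolding set_integrable_def by auto
  have intg: "integrable lborel g"
  proof (rule Bochner_Integration.integrable_bound)
    show "integrable lborel (\<lambda>r. ?h r)" using int by (simp add: set_integrable_def)
    show "g \<in> borel_measurable lborel" unfolding g_def using m by measurable
    show "AE r in lborel. norm (g r) \<le> norm (?h r)"
    proof (rule AE_I2)
      fix r
      have "norm (g r) = norm (?h r) * (max (1 - \<rho> / r) 0 ^ M / fact M)"
        by (simp add: g_def abs_mult power_abs)
      also have "\<dots> \<le> norm (?h r) * 1"
      proof (cases "r > 0")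
        case True
        then have "max (1 - \<rho> / r) 0 ^ M \<le> 1" using assms by (intro power_le_one) auto
        then have "max (1 - \<rho> / r) 0 ^ M / fact M \<le> 1 / 1" by (intro frac_le) auto
        then show ?thesis by (intro mult_left_mono) auto
      qed simp
      finally show "norm (g r) \<le> norm (?h r)" by simp
    qed
  qed
  have "(LBINT r=ereal \<rho>..\<infinity>. - t M r) = 0 - (- F 0 \<rho>)"
  proof (rule interval_integral_FTC_integrable[where F = "\<lambda>r. - T M r"])
    fix r assume "ereal \<rho> < ereal r"
    then have r: "r > 0" using assms by simp
    show "((\<lambda>r. - T M r) has_vector_derivative - t M r) (at r)"
      using dT[OF order_refl r] by (auto simp: has_real_derivative_iff_has_vector_derivative[symmetric] intro: DERIV_minus)
    show "isCont (\<lambda>r. - t M r) r" unfolding t_def by (intro continuous_intros contF r) auto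
  next
    show "set_integrable lborel (einterval (ereal \<rho>) \<infinity>) (\<lambda>r. - t M r)"
      using intg unfolding set_integrable_def e ge by simp
    show "(((\<lambda>r. - T M r) \<circ> real_of_ereal) \<longlongrightarrow> - F 0 \<rho>) (at_right (ereal \<rho>))"
      unfolding ereal_tendsto_simps by (intro tendsto_intros T_rho)
    show "(((\<lambda>r. - T M r) \<circ> real_of_ereal) \<longlongrightarrow> 0) (at_left \<infinity>)"
      unfolding ereal_tendsto_simps using tendsto_minus[OF T_top] by simp
  qed simp
  also have "(LBINT r=ereal \<rho>..\<infinity>. - t M r) = integral\<^sup>L lborel g"
    unfolding ge by (simp add: interval_lebesgue_integral_def set_lebesgue_integral_def e)
  finally have "integral\<^sup>L lborel g = F 0 \<rho>" by simp
  then show ?thesis unfolding g_def[abs_def] by (rule sym)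
qed

section \<open>Symbol estimates\<close>

text \<open>Bounds \<open>|f\<^sup>(\<^sup>k\<^sup>)| \<le> C\<^sub>k W / p\<^sup>k\<close> on \<open>D\<close> for all \<open>k \<le> N\<close>. The recursion, with the weight adjusted for the
  derivative, makes closure under products and quotients provable by induction on \<open>N\<close> without Leibniz or
  Faa di Bruno formulas.\<close>

fun symb :: "nat \<Rightarrow> (real \<Rightarrow> real) \<Rightarrow> real set \<Rightarrow> (real \<Rightarrow> real) \<Rightarrow> (real \<Rightarrow> real) \<Rightarrow> bool" where
  "symb 0 p D W f \<longleftrightarrow> (\<exists>C. \<forall>x\<in>D. \<bar>f x\<bar> \<le> C * W x)"
| "symb (Suc N) p D W f \<longleftrightarrow>
     (\<exists>C. \<forall>x\<in>D. \<bar>f x\<bar> \<le> C * W x) \<and> (\<forall>x\<in>D. f differentiable (at x)) \<and> symb N p D (\<lambda>x. W x / p x) (deriv f)"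

lemma symb_bound: "symb N p D W f \<Longrightarrow> \<exists>C. \<forall>x\<in>D. \<bar>f x\<bar> \<le> C * W x"
  by (cases N) auto

lemma symb_Suc_imp: "symb (Suc N) p D W f \<Longrightarrow> symb N p D W f"
  by (induction N arbitrary: W f) auto

lemma symb_iterated_deriv:
  assumes "symb N p D W f"
  shows "k \<le> N \<Longrightarrow> \<exists>C. \<forall>x\<in>D. \<bar>(deriv ^^ k) f x\<bar> \<le> C * (W x / p x ^ k)"
    and "k < N \<Longrightarrow> x \<in> D \<Longrightarrow> ((deriv ^^ k) f has_real_derivative (deriv ^^ Suc k) f x) (at x)"
proof -
  have "symb (N - k) p D (\<lambda>x. W x / p x ^ k) ((deriv ^^ k) f)" if "k \<le> N" for k
    using that
  proof (induction k)
    case 0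
    then show ?case using assms by simp
  next
    case (Suc k)
    then have "symb (Suc (N - Suc k)) p D (\<lambda>x. W x / p x ^ k) ((deriv ^^ k) f)"
      by (simp add: Suc_diff_Suc)
    then show ?case by (simp add: mult.commute)
  qed note * = this
  show "k \<le> N \<Longrightarrow> \<exists>C. \<forall>x\<in>D. \<bar>(deriv ^^ k) f x\<bar> \<le> C * (W x / p x ^ k)"
    using symb_bound[OF *[of k]] by simp
  show "((deriv ^^ k) f has_real_derivative (deriv ^^ Suc k) f x) (at x)" if "k < N" "x \<in> D"
  proof -
    have "symb (Suc (N - Suc k)) p D (\<lambda>x. W x / p x ^ k) ((deriv ^^ k) f)"
      using *[of k] that by (simp add: Suc_diff_Suc)
    then have "(deriv ^^ k) f differentiable (at x)" using that by simp
    then show ?thesis by (simp add: DERIV_deriv_iff_real_differentiable)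
  qed
qed

lemma symb_union:
  assumes "symb N p D\<^sub>1 W f" "symb N p D\<^sub>2 W f" "\<And>x. x \<in> D\<^sub>1 \<union> D\<^sub>2 \<Longrightarrow> W x \<ge> 0 \<and> p x > 0"
  shows "symb N p (D\<^sub>1 \<union> D\<^sub>2) W f"
proof -
  have bd: "\<exists>C. \<forall>x\<in>D\<^sub>1 \<union> D\<^sub>2. \<bar>f x\<bar> \<le> C * W x" if h: "\<And>x. x \<in> D\<^sub>1 \<union> D\<^sub>2 \<Longrightarrow> W x \<ge> 0 \<and> p x > 0"
    "\<exists>C. \<forall>x\<in>D\<^sub>1. \<bar>f x\<bar> \<le> C * W x" "\<exists>C. \<forall>x\<in>D\<^sub>2. \<bar>f x\<bar> \<le> C * W x" for W f :: "real \<Rightarrow> real"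
  proof -
    obtain A B where "\<forall>x\<in>D\<^sub>1. \<bar>f x\<bar> \<le> A * W x" "\<forall>x\<in>D\<^sub>2. \<bar>f x\<bar> \<le> B * W x" using h by blast
    moreover have "A * W x \<le> max A B * W x" "B * W x \<le> max A B * W x" if "x \<in> D\<^sub>1 \<union> D\<^sub>2" for x
      using h(1)[OF that] by (auto intro: mult_right_mono)
    ultimately show ?thesis by (intro exI[of _ "max A B"]) (blast intro: order_trans)
  qed
  show ?thesis using assms
  proof (induction N arbitrary: W f)
    case 0
    then show ?case using bd[of W f] by simp
  next
    case (Suc N)
    have "symb N p (D\<^sub>1 \<union> D\<^sub>2) (\<lambda>x. W x / p x) (deriv f)"
      using Suc.prems by (intro Suc.IH) (auto intro: divide_nonneg_pos)
    then show ?case using Suc.prems bd[of W f] by auto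
  qed
qed

lemma symb_mono:
  assumes "symb N p D W f" "D' \<subseteq> D" "\<And>x. x \<in> D' \<Longrightarrow> 0 \<le> W x" "\<And>x. x \<in> D' \<Longrightarrow> 0 < q x"
    "\<And>x. x \<in> D' \<Longrightarrow> q x \<le> p x" "\<And>x. x \<in> D' \<Longrightarrow> W x \<le> K * V x"
  shows "symb N q D' V f"
  using assms(1,3,6)
proof (induction N arbitrary: W V f)
  have bd: "\<exists>C. \<forall>x\<in>D'. \<bar>f x\<bar> \<le> C * V x"
    if h: "\<exists>C. \<forall>x\<in>D. \<bar>f x\<bar> \<le> C * W x" "\<And>x. x \<in> D' \<Longrightarrow> 0 \<le> W x" "\<And>x. x \<in> D' \<Longrightarrow> W x \<le> K * V x" for f V W :: "real \<Rightarrow> real"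
  proof -
    obtain C where C: "\<forall>x\<in>D. \<bar>f x\<bar> \<le> C * W x" using h by blast
    have "\<bar>f x\<bar> \<le> (\<bar>C\<bar> * K) * V x" if x: "x \<in> D'" for x
    proof -
      have "\<bar>f x\<bar> \<le> C * W x" using C x assms(2) by blast
      also have "\<dots> \<le> \<bar>C\<bar> * (K * V x)" using h(2,3)[OF x] by (intro mult_mono) auto
      finally show ?thesis by (simp add: mult.assoc)
    qed
    then show ?thesis by blast
  qed
  {
    case 0
    then show ?case using bd[of f W V] by simp
  next
    case (Suc N)
    have "symb N q D' (\<lambda>x. V x / q x) (deriv f)"
    proof (rule Suc.IH[of "\<lambda>x. W x / p x"])
      show "symb N p D (\<lambda>x. W x / p x) (deriv f)" using Suc.prems by simp
      fix x assume x: "x \<in> D'"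
      note h = Suc.prems(2,3)[OF x] assms(4,5)[OF x]
      show "0 \<le> W x / p x" using h by simp
      have "W x / p x \<le> W x / q x" using h by (intro frac_le) auto
      also have "\<dots> \<le> K * V x / q x" using h by (intro divide_right_mono) auto
      finally show "W x / p x \<le> K * (V x / q x)" by simp
    qed
    then show ?case using Suc.prems bd[of f W V] assms(2) by auto
  }
qed

locale symbol_scale =
  fixes p :: "real \<Rightarrow> real" and D :: "real set"
  assumes open_D: "open D" and p_pos: "\<And>x. x \<in> D \<Longrightarrow> p x > 0"
begin

abbreviation S :: "nat \<Rightarrow> (real \<Rightarrow> real) \<Rightarrow> (real \<Rightarrow> real) \<Rightarrow> bool" where "S N \<equiv> symb N p D"

text \<open>Since the domain is open, values there determine the derivatives there.\<close>

lemma symb_cong: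
  assumes "S N W f" "\<And>x. x \<in> D \<Longrightarrow> f x = g x"
  shows "S N W g"
  using assms
proof (induction N arbitrary: W f g)
  case 0
  then show ?case by auto
next
  case (Suc N)
  have ev: "\<forall>\<^sub>F y in nhds x. f y = g y" if "x \<in> D" for x
    using Suc.prems(2) open_D that eventually_nhds by blast
  have "deriv f x = deriv g x" if "x \<in> D" for x
    by (intro deriv_cong_ev ev that refl)
  then have "S N (\<lambda>x. W x / p x) (deriv g)" using Suc.IH[of _ "deriv f" "deriv g"] Suc.prems(1) by simp
  moreover have "g differentiable (at x)" if x: "x \<in> D" for x
  proof -
    have "(f has_real_derivative deriv f x) (at x)" using Suc.prems(1) x by (simp add: DERIV_deriv_iff_real_differentiable)
    then have "(g has_real_derivative deriv f x) (at x)" using ev[OF x] DERIV_cong_ev[OF refl ev[OF x] refl] by blast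
    then show ?thesis by (auto simp: real_differentiable_def)
  qed
  ultimately show ?case using Suc.prems by auto
qed

lemma symb_SucI:
  assumes "\<And>x. x \<in> D \<Longrightarrow> (f has_real_derivative f' x) (at x)"
    and "\<And>x. x \<in> D \<Longrightarrow> \<bar>f x\<bar> \<le> C * W x"
    and "S N (\<lambda>x. W x / p x) f'"
  shows "S (Suc N) W f"
proof -
  have "S N (\<lambda>x. W x / p x) (deriv f)"
    using assms(3) by (rule symb_cong) (use assms(1) DERIV_imp_deriv in metis)
  then show ?thesis using assms(1,2) by (auto simp: real_differentiable_def)
qed

lemma symb_weaken:
  assumes "S N W f" "\<And>x. x \<in> D \<Longrightarrow> 0 \<le> W x" "\<And>x. x \<in> D \<Longrightarrow> W x \<le> K * V x"
  shows "S N V f"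
  by (rule symb_mono[OF assms(1) subset_refl]) (use assms p_pos in auto)

lemma symb_add:
  assumes "S N W f" "S N W g"
  shows "S N W (\<lambda>x. f x + g x)"
  using assms
proof (induction N arbitrary: W f g)
  have bd: "\<bar>f x + g x\<bar> \<le> (A + B) * W x" if "\<bar>f x\<bar> \<le> A * W x" "\<bar>g x\<bar> \<le> B * W x" for f g W :: "real \<Rightarrow> real" and A B x
    using that abs_triangle_ineq[of "f x" "g x"] unfolding distrib_right by linarith
  {
    case 0
    then obtain A B where "\<forall>x\<in>D. \<bar>f x\<bar> \<le> A * W x" "\<forall>x\<in>D. \<bar>g x\<bar> \<le> B * W x" by auto
    then have "\<forall>x\<in>D. \<bar>f x + g x\<bar> \<le> (A + B) * W x" using bd by blast
    then show ?case unfolding symb.simps by blast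
  next
    case (Suc N)
    then obtain A B where AB: "\<forall>x\<in>D. \<bar>f x\<bar> \<le> A * W x" "\<forall>x\<in>D. \<bar>g x\<bar> \<le> B * W x" by auto
    show ?case
    proof (rule symb_SucI)
      show "((\<lambda>x. f x + g x) has_real_derivative deriv f x + deriv g x) (at x)" if "x \<in> D" for x
        using Suc.prems that by (intro DERIV_add) (auto simp: DERIV_deriv_iff_real_differentiable)
      show "\<bar>f x + g x\<bar> \<le> (A + B) * W x" if "x \<in> D" for x
        using AB that bd by blast
      show "S N (\<lambda>x. W x / p x) (\<lambda>x. deriv f x + deriv g x)" using Suc by simp
    qed
  }
qed

lemma symb_mult:
  assumes "S N V f" "S N W g" "\<And>x. x \<in> D \<Longrightarrow> 0 \<le> V x" "\<And>x. x \<in> D \<Longrightarrow> 0 \<le> W x"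
  shows "S N (\<lambda>x. V x * W x) (\<lambda>x. f x * g x)"
  using assms
proof (induction N arbitrary: V W f g)
  have bd: "\<bar>f x * g x\<bar> \<le> (\<bar>A\<bar> * \<bar>B\<bar>) * (V x * W x)"
    if "\<bar>f x\<bar> \<le> A * V x" "\<bar>g x\<bar> \<le> B * W x" "0 \<le> V x" "0 \<le> W x" for f g V W :: "real \<Rightarrow> real" and A B x
  proof -
    have "\<bar>f x\<bar> \<le> \<bar>A\<bar> * V x" "\<bar>g x\<bar> \<le> \<bar>B\<bar> * W x"
      using that by (meson abs_ge_self mult_right_mono order_trans)+
    then have "\<bar>f x\<bar> * \<bar>g x\<bar> \<le> (\<bar>A\<bar> * V x) * (\<bar>B\<bar> * W x)" using that by (intro mult_mono) auto
    then show ?thesis by (simp add: abs_mult mult_ac)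
  qed
  {
    case 0
    then obtain A B where "\<forall>x\<in>D. \<bar>f x\<bar> \<le> A * V x" "\<forall>x\<in>D. \<bar>g x\<bar> \<le> B * W x" by auto
    then have "\<forall>x\<in>D. \<bar>f x * g x\<bar> \<le> (\<bar>A\<bar> * \<bar>B\<bar>) * (V x * W x)" using bd 0(3,4) by blast
    then show ?case unfolding symb.simps by blast
  next
    case (Suc N)
    then obtain A B where AB: "\<forall>x\<in>D. \<bar>f x\<bar> \<le> A * V x" "\<forall>x\<in>D. \<bar>g x\<bar> \<le> B * W x" by auto
    show ?case
    proof (rule symb_SucI)
      show "((\<lambda>x. f x * g x) has_real_derivative deriv f x * g x + deriv g x * f x) (at x)" if "x \<in> D" for x
        using Suc.prems that by (intro DERIV_mult) (auto simp: DERIV_deriv_iff_real_differentiable)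
      show "\<bar>f x * g x\<bar> \<le> (\<bar>A\<bar> * \<bar>B\<bar>) * (V x * W x)" if "x \<in> D" for x
        using bd AB that Suc.prems(3,4) by blast
      have nn: "0 \<le> V x / p x" "0 \<le> W x / p x" if "x \<in> D" for x
        using p_pos[OF that] Suc.prems that by auto
      have "S N (\<lambda>x. V x / p x * W x) (\<lambda>x. deriv f x * g x)"
        using Suc.prems nn symb_Suc_imp by (intro Suc.IH) (auto simp del: divide_nonneg_nonneg)
      moreover have "S N (\<lambda>x. W x / p x * V x) (\<lambda>x. deriv g x * f x)"
        using Suc.prems nn symb_Suc_imp by (intro Suc.IH) auto
      ultimately show "S N (\<lambda>x. V x * W x / p x) (\<lambda>x. deriv f x * g x + deriv g x * f x)"
        by (intro symb_add) (simp_all add: mult.commute)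
    qed
  }
qed

lemma symb_0: "S N W (\<lambda>_. 0)"
proof (induction N arbitrary: W)
  case 0
  show ?case by (auto intro: exI[of _ 0])
next
  case (Suc N)
  show ?case by (rule symb_SucI[where f' = "\<lambda>_. 0" and C = 0]) (auto intro: Suc)
qed

lemma symb_const: "S N (\<lambda>_. 1) (\<lambda>_. c)"
proof (cases N)
  case 0
  show ?thesis by (auto simp: 0)
next
  case (Suc m)
  show ?thesis unfolding Suc by (rule symb_SucI[where f' = "\<lambda>_. 0" and C = "\<bar>c\<bar>"]) (auto intro: symb_0)
qed

lemma symb_cmult: "S N W f \<Longrightarrow> (\<And>x. x \<in> D \<Longrightarrow> 0 \<le> W x) \<Longrightarrow> S N W (\<lambda>x. c * f x)"
  using symb_mult[OF symb_const, of N W f c] by simp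

lemma symb_minus: "S N W f \<Longrightarrow> (\<And>x. x \<in> D \<Longrightarrow> 0 \<le> W x) \<Longrightarrow> S N W (\<lambda>x. - f x)"
  using symb_cmult[of N W f "-1"] by simp

lemma symb_power: "S N W f \<Longrightarrow> (\<And>x. x \<in> D \<Longrightarrow> 0 \<le> W x) \<Longrightarrow> S N (\<lambda>x. W x ^ k) (\<lambda>x. f x ^ k)"
  by (induction k) (auto intro!: symb_mult symb_const)

text \<open>The induction closes because \<open>(1 / g)' = - g' (1 / g)\<^sup>2\<close> has only the lower-order factor \<open>1 / g\<close> on the right;
  the bound on \<open>W V\<close> absorbs one of the two.\<close>

lemma symb_inverse:
  assumes "S N W g" "\<And>x. x \<in> D \<Longrightarrow> g x \<noteq> 0" "\<And>x. x \<in> D \<Longrightarrow> 0 \<le> W x"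
    "\<And>x. x \<in> D \<Longrightarrow> \<bar>inverse (g x)\<bar> \<le> C * V x" "\<And>x. x \<in> D \<Longrightarrow> 0 \<le> V x" "\<And>x. x \<in> D \<Longrightarrow> W x * V x \<le> K"
  shows "S N V (\<lambda>x. inverse (g x))"
  using assms(1)
proof (induction N)
  case 0
  show ?case using assms(4) by auto
next
  case (Suc N)
  note IH = Suc.IH[OF symb_Suc_imp[OF Suc.prems]]
  have pW: "0 \<le> W x / p x" if "x \<in> D" for x using p_pos[OF that] assms(3)[OF that] by simp
  show ?case
  proof (rule symb_SucI)
    show "((\<lambda>x. inverse (g x)) has_real_derivative - (deriv g x * (inverse (g x) * inverse (g x)))) (at x)" if "x \<in> D" for x
      using Suc.prems that assms(2)[OF that]
      by (auto simp: DERIV_deriv_iff_real_differentiable power2_eq_square intro!: derivative_eq_intros)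
    show "\<bar>inverse (g x)\<bar> \<le> C * V x" if "x \<in> D" for x using assms that by blast
    have "S N (\<lambda>x. W x / p x * (V x * V x)) (\<lambda>x. deriv g x * (inverse (g x) * inverse (g x)))"
      using Suc.prems by (intro symb_mult IH assms pW mult_nonneg_nonneg) auto
    then have "S N (\<lambda>x. V x / p x) (\<lambda>x. deriv g x * (inverse (g x) * inverse (g x)))"
    proof (rule symb_weaken)
      fix x assume x: "x \<in> D"
      show "0 \<le> W x / p x * (V x * V x)" by (intro mult_nonneg_nonneg pW assms x)
      have "W x * V x * (V x / p x) \<le> K * (V x / p x)"
        using p_pos[OF x] assms(5,6)[OF x] by (intro mult_right_mono) auto
      then show "W x / p x * (V x * V x) \<le> K * (V x / p x)" by (simp add: mult_ac)
    qed
    then show "S N (\<lambda>x. V x / p x) (\<lambda>x. - (deriv g x * (inverse (g x) * inverse (g x))))"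
      using p_pos assms(5) by (intro symb_minus) (auto intro: divide_nonneg_pos)
  qed
qed

text \<open>A function is controlled to all orders by its size and its logarithmic derivative \<open>h\<close>.\<close>

lemma symb_log_derivative:
  assumes "\<And>x. x \<in> D \<Longrightarrow> (f has_real_derivative f x * h x) (at x)"
    "\<And>x. x \<in> D \<Longrightarrow> \<bar>f x\<bar> \<le> C * W x" "\<And>x. x \<in> D \<Longrightarrow> 0 \<le> W x"
    "S N (\<lambda>x. 1 / p x) h"
  shows "S N W f"
  using assms(4)
proof (induction N)
  case 0
  show ?case using assms(2) by auto
next
  case (Suc N)
  have "S N (\<lambda>x. W x * (1 / p x)) (\<lambda>x. f x * h x)"
    by (rule symb_mult[OF Suc.IH[OF symb_Suc_imp[OF Suc.prems]] symb_Suc_imp[OF Suc.prems] assms(3)])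
      (use p_pos in \<open>auto intro: less_imp_le\<close>)
  then show ?case by (intro symb_SucI[OF assms(1,2)]) simp_all
qed

end

context symbol_scale
begin

lemma symb_shift:
  assumes "\<And>x. x \<in> D \<Longrightarrow> c + x > 0" "\<And>x. x \<in> D \<Longrightarrow> p x \<le> K * (c + x)"
  shows "S N (\<lambda>x. c + x) (\<lambda>x. c + x)"
proof (cases N)
  case 0
  then show ?thesis using assms(1) by (auto intro!: exI[of _ 1] simp: less_imp_le abs_of_pos)
next
  case (Suc m)
  show ?thesis unfolding Suc
  proof (rule symb_SucI[where C = 1 and f' = "\<lambda>_. 1"])
    show "((\<lambda>x. c + x) has_real_derivative 1) (at x)" for x by (auto intro!: derivative_eq_intros)
    show "\<bar>c + x\<bar> \<le> 1 * (c + x)" if "x \<in> D" for x using assms(1)[OF that] by simp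
    show "S m (\<lambda>x. (c + x) / p x) (\<lambda>_. 1)"
      by (rule symb_weaken[OF symb_const, where K = K]) (use assms p_pos in \<open>auto simp: field_simps\<close>)
  qed
qed

lemma symb_inverse_shift:
  assumes "\<And>x. x \<in> D \<Longrightarrow> c + x > 0" "\<And>x. x \<in> D \<Longrightarrow> p x \<le> K * (c + x)"
  shows "S N (\<lambda>x. inverse (c + x)) (\<lambda>x. inverse (c + x))"
  by (rule symb_inverse[OF symb_shift[OF assms], where C = 1 and K = 1])
    (use assms(1) in \<open>auto simp: less_imp_le abs_of_pos dest!: assms(1)\<close>)

lemma symb_powr_shift:
  assumes "\<And>x. x \<in> D \<Longrightarrow> c + x > 0" "\<And>x. x \<in> D \<Longrightarrow> p x \<le> K * (c + x)"
  shows "S N (\<lambda>x. (c + x) powr a) (\<lambda>x. (c + x) powr a)"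
proof (rule symb_log_derivative[where C = 1])
  show "((\<lambda>x. (c + x) powr a) has_real_derivative (c + x) powr a * (a * inverse (c + x))) (at x)" if "x \<in> D" for x
    using assms(1)[OF that] by (auto intro!: derivative_eq_intros simp: powr_diff divide_inverse)
  have "S N (\<lambda>x. 1 / p x) (\<lambda>x. inverse (c + x))"
    by (rule symb_weaken[OF symb_inverse_shift[OF assms], where K = K])
      (use assms p_pos in \<open>auto simp: field_simps intro: less_imp_le\<close>)
  then show "S N (\<lambda>x. 1 / p x) (\<lambda>x. a * inverse (c + x))"
    using p_pos by (intro symb_cmult) (auto intro: less_imp_le)
qed auto

lemma symb_ln_shift:
  assumes "\<And>x. x \<in> D \<Longrightarrow> c + x > 0" "\<And>x. x \<in> D \<Longrightarrow> p x \<le> K * (c + x)"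
    and "\<And>x. x \<in> D \<Longrightarrow> \<bar>ln (c + x)\<bar> \<le> C * W x" "\<And>x. x \<in> D \<Longrightarrow> 1 \<le> K' * W x"
  shows "S N W (\<lambda>x. ln (c + x))"
proof (cases N)
  case 0
  then show ?thesis using assms(3) by auto
next
  case (Suc m)
  show ?thesis unfolding Suc
  proof (rule symb_SucI[where C = C and f' = "\<lambda>x. inverse (c + x)"])
    show "((\<lambda>x. ln (c + x)) has_real_derivative inverse (c + x)) (at x)" if "x \<in> D" for x
      using assms(1)[OF that] by (auto intro!: derivative_eq_intros simp: divide_inverse)
    show "S m (\<lambda>x. W x / p x) (\<lambda>x. inverse (c + x))"
    proof (rule symb_weaken[OF symb_inverse_shift[OF assms(1,2)], where K = "\<bar>K\<bar> * K'"])
      fix x assume x: "x \<in> D"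
      note h = assms(1,2,4)[OF x] p_pos[OF x]
      show "0 \<le> inverse (c + x)" using h by simp
      have "K * (c + x) \<le> \<bar>K\<bar> * (c + x)" using h by (intro mult_right_mono) auto
      then have "p x \<le> \<bar>K\<bar> * (c + x)" using h by linarith
      then have "p x * inverse (c + x) \<le> \<bar>K\<bar>" using h by (simp add: divide_inverse[symmetric] pos_divide_le_eq)
      then have "inverse (c + x) \<le> \<bar>K\<bar> * (1 / p x)"
        using h by (simp add: pos_le_divide_eq mult.commute)
      also have "\<bar>K\<bar> * (1 / p x) \<le> \<bar>K\<bar> * ((K' * W x) / p x)"
        using h by (intro mult_left_mono divide_right_mono) auto
      finally show "inverse (c + x) \<le> \<bar>K\<bar> * K' * (W x / p x)" by simp
    qed
  qed (use assms in auto)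
qed

end

section \<open>Radial symbols with integrable kernel\<close>

lemma set_integrable_derivative_half_line:
  fixes F f :: "real \<Rightarrow> real"
  assumes "\<And>x. x > 0 \<Longrightarrow> (F has_real_derivative f x) (at x)" "\<And>x. x > 0 \<Longrightarrow> isCont f x" "\<And>x. x > 0 \<Longrightarrow> 0 \<le> f x"
    and "(F \<longlongrightarrow> A) (at_right 0)" "(F \<longlongrightarrow> B) at_top"
  shows "set_integrable lborel {0<..} f"
proof -
  have "set_integrable lborel (einterval 0 \<infinity>) f"
  proof (rule interval_integral_FTC_nonneg(1)[where F = F])
    show "((F \<circ> real_of_ereal) \<longlongrightarrow> A) (at_right 0)"
      unfolding zero_ereal_def ereal_tendsto_simps by (rule assms)
    show "((F \<circ> real_of_ereal) \<longlongrightarrow> B) (at_left \<infinity>)"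
      unfolding ereal_tendsto_simps by (rule assms)
  qed (use assms in auto)
  also have "einterval 0 \<infinity> = {0::real<..}" by (auto simp: einterval_def)
  finally show ?thesis .
qed

text \<open>How many derivatives enter depends on the dimension, hence the bounds to all orders. They concern the
  derivative of \<open>F\<close>, with weight \<open>W(r) / r\<close>, so that a nonzero limit at \<open>0\<close> is admitted.\<close>

lemma L1_symbol_criterion:
  fixes F W :: "real \<Rightarrow> real"
  assumes diff: "\<And>r. r > 0 \<Longrightarrow> F differentiable (at r)"
    and symb: "\<And>N. symb N (\<lambda>r. r) {0<..} (\<lambda>r. W r / r) (deriv F)"
    and W_lim: "(W \<longlongrightarrow> 0) at_top" "(W \<longlongrightarrow> 0) (at_right 0)"
    and W_int: "set_integrable lborel {0<..} (\<lambda>r. W r / r)"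
    and F_lim: "(F \<longlongrightarrow> 0) at_top" "(F \<longlongrightarrow> F 0) (at_right 0)"
  shows "L1_symbol (\<lambda>\<xi> :: real ^ 'n. of_real (F (laplace_symbol \<xi>)))"
proof -
  define M where "M = CARD('n) + 1"
  define G where "G k = (deriv ^^ k) F" for k
  have GS: "G (Suc k) = (deriv ^^ k) (deriv F)" for k by (simp add: G_def funpow_swap1)
  have der: "(G k has_real_derivative G (Suc k) r) (at r)" if "r > 0" for k r
  proof (cases k)
    case 0
    then show ?thesis using diff[OF that] by (simp add: G_def DERIV_deriv_iff_real_differentiable)
  next
    case (Suc m)
    show ?thesis unfolding Suc GS using symb_iterated_deriv(2)[OF symb[of "Suc m"], of m r] that by simp
  qed
  have bd: "\<exists>C. \<forall>r>0. \<bar>r ^ Suc k * G (Suc k) r\<bar> \<le> C * W r" for k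
  proof -
    obtain C where C: "\<And>r. r > 0 \<Longrightarrow> \<bar>G (Suc k) r\<bar> \<le> C * (W r / r / r ^ k)"
      using symb_iterated_deriv(1)[OF symb[of k], of k] unfolding GS by auto
    have "\<bar>r ^ Suc k * G (Suc k) r\<bar> \<le> C * W r" if "r > 0" for r
    proof -
      have "r ^ Suc k * \<bar>G (Suc k) r\<bar> \<le> r ^ Suc k * (C * (W r / r / r ^ k))"
        using that by (intro mult_left_mono C) auto
      then show ?thesis using that by (simp add: abs_mult)
    qed
    then show ?thesis by blast
  qed
  have lim: "((\<lambda>r. r ^ Suc k * G (Suc k) r) \<longlongrightarrow> 0) net" if "(W \<longlongrightarrow> 0) net" "\<forall>\<^sub>F r in net. r > 0" for k net
  proof -
    obtain C where C: "\<And>r. r > 0 \<Longrightarrow> \<bar>r ^ Suc k * G (Suc k) r\<bar> \<le> C * W r" using bd[of k] by blast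
    show ?thesis
    proof (rule Lim_null_comparison)
      show "\<forall>\<^sub>F r in net. norm (r ^ Suc k * G (Suc k) r) \<le> C * W r"
        using that(2) by eventually_elim (use C in simp)
      show "((\<lambda>r. C * W r) \<longlongrightarrow> 0) net" using tendsto_mult_left[OF that(1), of C] by simp
    qed
  qed
  have int: "set_integrable lborel {0<..} (\<lambda>r. r ^ M * G (Suc M) r)"
  proof -
    obtain C where C: "\<And>r. r > 0 \<Longrightarrow> \<bar>r ^ Suc M * G (Suc M) r\<bar> \<le> C * W r" using bd[of M] by blast
    have cont: "continuous_on {0<..} (\<lambda>r. r ^ M * G (Suc M) r)"
      using der by (intro continuous_intros continuous_at_imp_continuous_on) (auto intro: DERIV_isCont)
    show ?thesis
      unfolding set_integrable_def
    proof (rule Bochner_Integration.integrable_bound)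
      show "integrable lborel (\<lambda>r. C * (indicator {0<..} r *\<^sub>R (W r / r)))"
        using W_int unfolding set_integrable_def by (rule integrable_mult_right)
      show "(\<lambda>r. indicator {0<..} r *\<^sub>R (r ^ M * G (Suc M) r)) \<in> borel_measurable lborel"
        using borel_measurable_continuous_on_indicator[OF _ cont] by simp
      show "AE r in lborel. norm (indicator {0<..} r *\<^sub>R (r ^ M * G (Suc M) r)) \<le> norm (C * (indicator {0<..} r *\<^sub>R (W r / r)))"
      proof (rule AE_I2)
        fix r :: real
        show "norm (indicator {0<..} r *\<^sub>R (r ^ M * G (Suc M) r)) \<le> norm (C * (indicator {0<..} r *\<^sub>R (W r / r)))"
        proof (cases "r > 0")
          case True
          have "r * \<bar>r ^ M * G (Suc M) r\<bar> \<le> C * W r" using C[OF True] True by (simp add: abs_mult mult.assoc)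
          then have "\<bar>r ^ M * G (Suc M) r\<bar> \<le> C * (W r / r)" using True by (simp add: field_simps)
          then have "\<bar>r ^ M * G (Suc M) r\<bar> \<le> \<bar>C * (W r / r)\<bar>" by (rule order_trans[OF _ abs_ge_self])
          then show ?thesis using True by simp
        qed simp
      qed
    qed
  qed
  define k where "k r = (- 1) ^ Suc M / fact M * (indicator {0<..} r * (r ^ M * G (Suc M) r))" for r
  have eq: "F \<rho> = (\<integral>r. k r * max (1 - \<rho> / r) 0 ^ M \<partial>lborel)" if "\<rho> \<ge> 0" for \<rho>
  proof -
    have "G 0 \<rho> = (\<integral>r. (- 1) ^ Suc M / fact M * (indicator {0<..} r * (r ^ M * G (Suc M) r)) * max (1 - \<rho> / r) 0 ^ M \<partial>lborel)"
    proof (rule taylor_from_infinity[OF _ that der _ _ _ _ int])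
      show "1 \<le> M" by (simp add: M_def)
      show "continuous_on {0<..} (G (Suc M))"
        using der by (intro continuous_at_imp_continuous_on) (auto intro: DERIV_isCont)
      show "((\<lambda>r. r ^ k * G k r) \<longlongrightarrow> 0) at_top" for k
        using F_lim(1) lim[OF W_lim(1) eventually_gt_at_top] by (cases k) (auto simp: G_def simp del: funpow.simps(2))
      show "(G 0 \<longlongrightarrow> G 0 0) (at_right 0)" using F_lim(2) by (simp add: G_def)
      show "((\<lambda>r. r ^ k * G k r) \<longlongrightarrow> 0) (at_right 0)" if "k \<in> {1..M}" for k
        using lim[OF W_lim(2) eventually_at_right_less] that by (cases k) (auto simp del: power_Suc)
    qed auto
    then show ?thesis by (simp add: G_def k_def)
  qed
  have "L1_symbol (\<lambda>\<xi> :: real ^ 'n. of_real (\<integral>r. k r * max (1 - laplace_symbol \<xi> / r) 0 ^ M \<partial>lborel))"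
  proof (rule L1_symbol_riesz_superposition)
    show "integrable lborel k" unfolding k_def using int by (intro integrable_mult_right) (simp add: set_integrable_def)
  qed (auto simp: M_def k_def)
  moreover have "laplace_symbol \<xi> \<ge> 0" for \<xi> :: "real ^ 'n" by (simp add: laplace_symbol_def)
  ultimately show ?thesis using eq by simp
qed

section \<open>The quotient of the logarithmic symbols\<close>

text \<open>Captures at once the linear vanishing of the logarithm at \<open>1\<close> and its slow growth at infinity.\<close>

lemma ln_le_powr_mult:
  fixes u \<epsilon> :: real
  assumes "u > 1" "\<epsilon> > 0"
  shows "ln u \<le> (2 + 2 / \<epsilon>) * (u powr \<epsilon> * (1 - 1 / u))"
proof (cases "u \<le> 2")
  case True
  have a: "u powr \<epsilon> \<ge> 1" using assms by (simp add: ge_one_powr_ge_zero)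
  have "ln u \<le> u - 1" using assms by (intro ln_le_minus_one) auto
  also have "u - 1 = u * (1 - 1 / u)" using assms by (simp add: field_simps)
  also have "\<dots> \<le> (2 * u powr \<epsilon>) * (1 - 1 / u)"
    using assms True a by (intro mult_right_mono) auto
  also have "\<dots> \<le> ((2 + 2 / \<epsilon>) * u powr \<epsilon>) * (1 - 1 / u)"
    using assms by (intro mult_right_mono) auto
  finally show ?thesis by (simp add: mult.assoc)
next
  case False
  have "ln u \<le> u powr \<epsilon> / \<epsilon>" using assms by (intro ln_powr_bound) auto
  also have "\<dots> \<le> (2 / \<epsilon>) * (u powr \<epsilon> * (1 - 1 / u))"
    using assms False by (simp add: field_simps)
  also have "\<dots> \<le> (2 + 2 / \<epsilon>) * (u powr \<epsilon> * (1 - 1 / u))"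
    using assms by (intro mult_right_mono) auto
  finally show ?thesis .
qed

lemma ratio_powr_derivative:
  fixes a b :: real
  assumes "x > 0" "b > 0"
  shows "((\<lambda>x. x powr a * (b + x) powr (- a)) has_real_derivative
    (a * b) * ((x powr a * (b + x) powr (- a)) * (inverse x * inverse (b + x)))) (at x)"
proof -
  have 1: "((\<lambda>x. x powr a) has_real_derivative x powr a * (a * inverse x)) (at x)"
    using assms by (auto intro!: derivative_eq_intros simp: powr_diff divide_inverse)
  have 2: "((\<lambda>x. (b + x) powr (- a)) has_real_derivative (b + x) powr (- a) * (- a * inverse (b + x))) (at x)"
    using assms by (auto intro!: derivative_eq_intros simp: powr_diff divide_inverse)
  have 3: "inverse x - inverse (b + x) = b * (inverse x * inverse (b + x))"
    using assms by (simp add: field_simps)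
  have "x powr a * (a * inverse x) * (b + x) powr (- a) + (b + x) powr (- a) * (- a * inverse (b + x)) * x powr a
      = a * ((x powr a * (b + x) powr (- a)) * (inverse x - inverse (b + x)))"
    by (simp add: algebra_simps)
  also have "\<dots> = (a * b) * ((x powr a * (b + x) powr (- a)) * (inverse x * inverse (b + x)))"
    unfolding 3 by (simp only: mult_ac)
  finally show ?thesis using DERIV_mult[OF 1 2] by simp
qed

text \<open>With \<open>y = \<rho> / (\<lambda> + \<rho>)\<close>, \<open>l = ln y\<close> and \<open>E = 1 / ln (\<lambda> + \<rho>)\<close>, the function is \<open>(y\<^sup>s - 1) + y\<^sup>s l E\<close>. All estimates are
  in terms of the weight \<open>V = y\<^sup>s |l|\<close>: the derivative of \<open>y\<^sup>s\<close> is \<open>s y\<^sup>s (1 - y) / \<rho>\<close> with \<open>1 - y \<le> |l|\<close>, and \<open>E\<close> is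
  a bounded symbol because \<open>\<lambda> > 1\<close>.\<close>

lemma L1_symbol_m_minus_one:
  assumes lam: "lam > 1" and s: "s > 0"
  shows "L1_symbol (\<lambda>\<xi> :: real ^ 'n. of_real (m_symbol s lam \<xi> - 1))"
proof -
  let ?q = "\<lambda>x. inverse x * inverse (lam + x)"
  define yp where "yp x = x powr s * (lam + x) powr (- s)" for x
  define l where "l x = ln x - ln (lam + x)" for x
  define E where "E x = inverse (ln (lam + x))" for x
  define F where "F x = yp x * (1 + l x * E x) - 1" for x
  define \<epsilon> where "\<epsilon> = s / 2"
  \<comment> \<open>A majorant of \<open>V\<close>, up to a constant, for which \<open>W x / x\<close> has an elementary primitive.\<close>
  define W where "W x = x powr \<epsilon> * (lam + x) powr (- \<epsilon> - 1)" for x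
  define V where "V x = yp x * (- l x)" for x
  have \<epsilon>: "\<epsilon> > 0" using s by (simp add: \<epsilon>_def)
  interpret symbol_scale "\<lambda>x. x" "{0<..}" by standard auto
  have lam_pos: "lam + x > 0" "x \<le> 1 * (lam + x)" if "x \<in> {0<..}" for x using that lam by auto
  have id_pos: "0 + x > 0" "x \<le> 1 * (0 + x)" if "x \<in> {0<..}" for x :: real using that by auto
  have yp0: "yp x > 0" if "x > 0" for x using that lam by (simp add: yp_def)
  have lu: "- l x = ln ((lam + x) / x)" "(lam + x) / x > 1" "lam / (lam + x) = 1 - 1 / ((lam + x) / x)" if "x > 0" for x
    using that lam by (auto simp: l_def ln_div field_simps)
  have l_pos: "- l x > 0" if "x > 0" for x using lu[OF that] by simp
  have l_lower: "lam * inverse (lam + x) \<le> - l x" if "x > 0" for x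
  proof -
    have "- ln ((lam + x) / x) \<le> 1 / ((lam + x) / x) - 1"
      using lu(2)[OF that] ln_le_minus_one[of "1 / ((lam + x) / x)"] that lam by (simp add: ln_div)
    then show ?thesis unfolding lu(1)[OF that] divide_inverse[symmetric] lu(3)[OF that] by linarith
  qed
  have Lln: "ln (lam + x) \<ge> ln lam" "ln lam > 0" if "x > 0" for x using that lam by auto
  have S_yp: "S N yp yp" for N
    using symb_mult[OF symb_powr_shift[where c = 0 and a = s and N = N, OF id_pos] symb_powr_shift[where a = "- s", OF lam_pos]] by (simp add: yp_def[abs_def])
  have S_inv: "S N (\<lambda>x. ?q x) (\<lambda>x. ?q x)" for N
    using symb_mult[OF symb_inverse_shift[where c = 0 and N = N, OF id_pos] symb_inverse_shift[OF lam_pos]] lam by simp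
  have inv_le: "?q x \<le> inverse lam * (- l x / x)" if "x > 0" for x
  proof -
    have "inverse (lam + x) \<le> inverse lam * (- l x)"
      using mult_left_mono[OF l_lower[OF that], of "inverse lam"] lam by (simp add: mult.assoc[symmetric])
    then have "?q x \<le> inverse x * (inverse lam * (- l x))"
      using that by (intro mult_left_mono) auto
    then show ?thesis by (simp add: divide_inverse mult_ac)
  qed
  have d_l: "(l has_real_derivative lam * ?q x) (at x)" if "x > 0" for x
    unfolding l_def[abs_def] using that lam by (auto intro!: derivative_eq_intros simp: field_simps)
  have S_l: "S N (\<lambda>x. - l x) l" for N
  proof (cases N)
    case 0
    then show ?thesis using l_pos by (auto intro!: exI[of _ 1] simp: abs_of_neg less_imp_le)
  next
    case (Suc m)
    show ?thesis unfolding Suc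
    proof (rule symb_SucI[where C = 1])
      have "S m (\<lambda>x. - l x / x) (\<lambda>x. ?q x)"
        by (rule symb_weaken[OF S_inv, where K = "inverse lam"]) (use inv_le lam in auto)
      then show "S m (\<lambda>x. - l x / x) (\<lambda>x. lam * ?q x)"
        using l_pos by (intro symb_cmult) (auto intro!: divide_nonpos_pos simp: less_imp_le)
      show "\<bar>l x\<bar> \<le> 1 * - l x" if "x \<in> {0<..}" for x using l_pos[of x] that by simp
    qed (use d_l in auto)
  qed
  have S_E: "S N (\<lambda>_. 1) E" for N
  proof -
    have "S N (\<lambda>x. ln (lam + x)) (\<lambda>x. ln (lam + x))"
      by (rule symb_ln_shift[OF lam_pos, where C = 1 and K' = "1 / ln lam"]) (use Lln lam in \<open>auto simp: field_simps\<close>)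
    then have "S N (\<lambda>x. inverse (ln (lam + x))) E" unfolding E_def[abs_def]
      by (rule symb_inverse[where C = 1 and K = 1]) (use Lln lam in auto)
    then show ?thesis
      by (rule symb_weaken[where K = "inverse (ln lam)"]) (use Lln lam in \<open>auto intro!: le_imp_inverse_le\<close>)
  qed
  have V0: "0 \<le> V x" if "x > 0" for x using yp0[OF that] l_pos[OF that] by (simp add: V_def mult_nonneg_nonpos)
  have S_2: "S N V (\<lambda>x. yp x * l x * E x)" for N
    using symb_mult[OF symb_mult[OF S_yp[of N] S_l] S_E] yp0 l_pos by (simp add: V_def[abs_def] less_imp_le mult_nonneg_nonpos)
  have d_yp: "(yp has_real_derivative (s * lam) * (yp x * ?q x)) (at x)" if "x > 0" for x
    unfolding yp_def[abs_def] using that lam by (intro ratio_powr_derivative) auto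
  have S_1: "S N (\<lambda>x. V x / x) (\<lambda>x. (s * lam) * (yp x * ?q x))" for N
  proof (rule symb_cmult)
    have "S N (\<lambda>x. yp x * ?q x) (\<lambda>x. yp x * ?q x)"
      using yp0 lam by (intro symb_mult S_yp S_inv) (auto intro: less_imp_le)
    then show "S N (\<lambda>x. V x / x) (\<lambda>x. yp x * ?q x)"
    proof (rule symb_weaken[where K = "inverse lam"])
      fix x :: real assume "x \<in> {0<..}"
      then have x: "x > 0" by simp
      show "0 \<le> yp x * ?q x" using yp0[OF x] x lam by simp
      have "yp x * ?q x \<le> yp x * (inverse lam * (- l x / x))"
        using yp0[OF x] inv_le[OF x] by (intro mult_left_mono) auto
      then show "yp x * ?q x \<le> inverse lam * (V x / x)"
        by (simp add: V_def mult_ac)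
    qed
  qed (use V0 in auto)
  have VW: "V x \<le> ((2 + 2 / \<epsilon>) * lam) * W x" if x: "x > 0" for x
  proof -
    let ?u = "(lam + x) / x"
    have yu: "yp x = ?u powr (- s)" using x lam by (simp add: yp_def powr_divide powr_minus field_simps)
    have "V x = ?u powr (- s) * ln ?u" by (simp add: V_def yu lu(1)[OF x])
    also have "\<dots> \<le> ?u powr (- s) * ((2 + 2 / \<epsilon>) * (?u powr \<epsilon> * (1 - 1 / ?u)))"
      by (intro mult_left_mono ln_le_powr_mult lu(2)[OF x] \<epsilon>) auto
    also have "\<dots> = (2 + 2 / \<epsilon>) * ((?u powr (- s) * ?u powr \<epsilon>) * (lam / (lam + x)))"
      unfolding lu(3)[OF x] by (simp add: mult_ac)
    also have "?u powr (- s) * ?u powr \<epsilon> = ?u powr (- \<epsilon>)" by (simp add: \<epsilon>_def flip: powr_add)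
    also have "?u powr (- \<epsilon>) * (lam / (lam + x)) = lam * W x"
      using x lam by (simp add: W_def powr_divide powr_minus powr_diff field_simps)
    finally show ?thesis by (simp add: mult_ac)
  qed
  have F_diff: "(F has_real_derivative (s * lam) * (yp x * ?q x) + deriv (\<lambda>x. yp x * l x * E x) x) (at x)" if "x > 0" for x
  proof -
    have "(\<lambda>x. yp x * l x * E x) differentiable (at x)" using S_2[of "Suc 0"] that by simp
    then have "((\<lambda>x. yp x * l x * E x) has_real_derivative deriv (\<lambda>x. yp x * l x * E x) x) (at x)"
      by (simp add: DERIV_deriv_iff_real_differentiable)
    then have "((\<lambda>x. yp x + yp x * l x * E x - 1) has_real_derivative (s * lam) * (yp x * ?q x) + deriv (\<lambda>x. yp x * l x * E x) x - 0) (at x)"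
      by (intro DERIV_diff DERIV_add d_yp that DERIV_const)
    moreover have "F = (\<lambda>x. yp x + yp x * l x * E x - 1)" by (auto simp: F_def algebra_simps)
    ultimately show ?thesis by simp
  qed
  have S_F: "S N (\<lambda>x. W x / x) (deriv F)" for N
  proof -
    have "S N (\<lambda>x. V x / x) (\<lambda>x. (s * lam) * (yp x * ?q x) + deriv (\<lambda>x. yp x * l x * E x) x)"
      by (rule symb_add[OF S_1]) (use S_2[of "Suc N"] in simp)
    then have "S N (\<lambda>x. V x / x) (deriv F)"
      by (rule symb_cong) (use F_diff DERIV_imp_deriv in \<open>auto simp: DERIV_imp_deriv[OF F_diff]\<close>)
    then show ?thesis
      by (rule symb_weaken[where K = "(2 + 2 / \<epsilon>) * lam"])
        (use V0 VW in \<open>auto simp: divide_right_mono\<close>)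
  qed
  have F_eq: "F x = x powr s * (lam + x) powr (- s) * ln x / ln (lam + x) - 1" if "x > 0" for x
    using Lln[OF that] by (simp add: F_def yp_def l_def E_def field_simps)
  have "L1_symbol (\<lambda>\<xi> :: real ^ 'n. of_real (F (laplace_symbol \<xi>)))"
  proof (rule L1_symbol_criterion[where W = W])
    show "F differentiable (at r)" if "r > 0" for r
      using F_diff[OF that] by (auto simp: real_differentiable_def)
    show "symb N (\<lambda>r. r) {0<..} (\<lambda>r. W r / r) (deriv F)" for N by (rule S_F)
    show "(W \<longlongrightarrow> 0) at_top" unfolding W_def using \<epsilon> lam by real_asymp
    show "(W \<longlongrightarrow> 0) (at_right 0)" unfolding W_def using \<epsilon> lam by real_asymp
    define Y where "Y x = 1 / (\<epsilon> * lam) * (x powr \<epsilon> * (lam + x) powr (- \<epsilon>))" for x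
    show "set_integrable lborel {0<..} (\<lambda>r. W r / r)"
    proof (rule set_integrable_derivative_half_line[where F = Y])
      fix x :: real assume x: "x > 0"
      have "(Y has_real_derivative 1 / (\<epsilon> * lam) * ((\<epsilon> * lam) * ((x powr \<epsilon> * (lam + x) powr (- \<epsilon>)) * (?q x)))) (at x)"
        unfolding Y_def[abs_def] using x lam by (intro DERIV_cmult ratio_powr_derivative) auto
      also have "1 / (\<epsilon> * lam) * ((\<epsilon> * lam) * ((x powr \<epsilon> * (lam + x) powr (- \<epsilon>)) * (?q x)))
          = (x powr \<epsilon> * (lam + x) powr (- \<epsilon>)) * (?q x)"
        using lam \<epsilon> by simp
      also have "\<dots> = W x / x"
        using x lam by (simp add: W_def powr_diff divide_inverse mult_ac)
      finally show "(Y has_real_derivative W x / x) (at x)" .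
      show "isCont (\<lambda>r. W r / r) x" unfolding W_def using x lam by (intro continuous_intros) auto
      show "0 \<le> W x / x" using x by (simp add: W_def)
    next
      show "(Y \<longlongrightarrow> 0) (at_right 0)" unfolding Y_def using \<epsilon> lam by real_asymp
      show "(Y \<longlongrightarrow> 1 / (\<epsilon> * lam)) at_top" unfolding Y_def using \<epsilon> lam by real_asymp
    qed
    have "((\<lambda>x. x powr s * (lam + x) powr (- s) * ln x / ln (lam + x) - 1) \<longlongrightarrow> 0) at_top"
      using s lam by real_asymp
    then show "(F \<longlongrightarrow> 0) at_top"
      by (rule Lim_transform_eventually) (auto intro!: eventually_mono[OF eventually_gt_at_top[of 0]] simp: F_eq)
    have "((\<lambda>x. x powr s * (lam + x) powr (- s) * ln x / ln (lam + x) - 1) \<longlongrightarrow> -1) (at_right 0)"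
      using s lam by real_asymp
    then have "(F \<longlongrightarrow> -1) (at_right 0)"
      by (rule Lim_transform_eventually) (auto intro!: eventually_mono[OF eventually_at_right_less[of 0]] simp: F_eq)
    then show "(F \<longlongrightarrow> F 0) (at_right 0)" by (simp add: F_def yp_def)
  qed
  moreover have "F (laplace_symbol \<xi>) = m_symbol s lam \<xi> - 1" for \<xi> :: "real ^ 'n"
  proof (cases "\<xi> = 0")
    case True
    then show ?thesis by (simp add: F_def yp_def m_symbol_def laplace_symbol_def)
  next
    case False
    then have "laplace_symbol \<xi> > 0" by (simp add: laplace_symbol_def)
    then show ?thesis using False lam
      by (simp add: F_eq m_symbol_def log_symbol_def shifted_log_symbol_def powr_minus divide_inverse mult_ac)
  qed
  ultimately show ?thesis by simp
qed

section \<open>Radial Schwartz multipliers\<close>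

text \<open>The combinations of monomials in the coordinates times functions \<open>F\<^sub>k(\<rho>)\<close>. If \<open>F\<^sub>k' = F\<^sub>k\<^sub>+\<^sub>1\<close>, then the
  class is closed under partial derivatives.\<close>

inductive radial_span :: "(nat \<Rightarrow> real \<Rightarrow> real) \<Rightarrow> (real ^ 'n \<Rightarrow> complex) \<Rightarrow> bool" for F where
  radial: "radial_span F (\<lambda>\<xi>. of_real (F k (laplace_symbol \<xi>)))"
| coord: "radial_span F f \<Longrightarrow> radial_span F (\<lambda>\<xi>. of_real (\<xi> $ j) * f \<xi>)"
| scale: "radial_span F f \<Longrightarrow> radial_span F (\<lambda>\<xi>. of_real c * f \<xi>)"
| add: "radial_span F f \<Longrightarrow> radial_span F g \<Longrightarrow> radial_span F (\<lambda>\<xi>. f \<xi> + g \<xi>)"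

lemma laplace_symbol_nonneg: "laplace_symbol \<xi> \<ge> 0"
  by (simp add: laplace_symbol_def)

lemma laplace_symbol_line:
  "laplace_symbol (x + t *\<^sub>R axis i 1) = laplace_symbol x + 8 * pi\<^sup>2 * (x $ i) * t + 4 * pi\<^sup>2 * t\<^sup>2"
proof -
  have "(norm (x + t *\<^sub>R axis i 1))\<^sup>2 = (norm x)\<^sup>2 + 2 * (x $ i) * t + t\<^sup>2"
    using dot_norm[of x "t *\<^sub>R axis i 1"] by (simp add: inner_axis algebra_simps)
  then show ?thesis by (simp add: laplace_symbol_def algebra_simps)
qed

context
  fixes F :: "nat \<Rightarrow> real \<Rightarrow> real"
  assumes der: "\<And>k x. x \<ge> 0 \<Longrightarrow> (F k has_real_derivative F (Suc k) x) (at x)"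
    and bounded: "\<And>k. \<exists>C. \<forall>x\<ge>0. \<bar>F k x\<bar> \<le> C"
begin

lemma radial_span_partial:
  assumes "radial_span F f"
  shows "\<exists>g. radial_span F g \<and> (\<forall>x :: real ^ 'n. ((\<lambda>t. f (x + t *\<^sub>R axis i 1)) has_vector_derivative g x) (at 0))"
  using assms
proof induction
  case (radial k)
  let ?g = "\<lambda>\<xi> :: real ^ 'n. of_real (8 * pi\<^sup>2) * (of_real (\<xi> $ i) * complex_of_real (F (Suc k) (laplace_symbol \<xi>)))"
  have "((\<lambda>t. complex_of_real (F k (laplace_symbol (x + t *\<^sub>R axis i 1)))) has_vector_derivative ?g x) (at 0)" for x :: "real ^ 'n"
  proof -
    have "((\<lambda>t. laplace_symbol (x + t *\<^sub>R axis i 1)) has_real_derivative 8 * pi\<^sup>2 * (x $ i)) (at 0)"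
      unfolding laplace_symbol_line by (auto intro!: derivative_eq_intros)
    moreover have "(F k has_real_derivative F (Suc k) (laplace_symbol (x + 0 *\<^sub>R axis i 1))) (at (laplace_symbol (x + 0 *\<^sub>R axis i 1)))"
      by (rule der[OF laplace_symbol_nonneg])
    ultimately have "((\<lambda>t. F k (laplace_symbol (x + t *\<^sub>R axis i 1))) has_real_derivative F (Suc k) (laplace_symbol (x + 0 *\<^sub>R axis i 1)) * (8 * pi\<^sup>2 * (x $ i))) (at 0)"
      by (rule DERIV_chain2[rotated])
    then have "((\<lambda>t. complex_of_real (F k (laplace_symbol (x + t *\<^sub>R axis i 1)))) has_vector_derivative
        of_real (F (Suc k) (laplace_symbol (x + 0 *\<^sub>R axis i 1)) * (8 * pi\<^sup>2 * (x $ i)))) (at 0)"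
      by (rule has_vector_derivative_of_real)
    then show ?thesis by (simp add: mult_ac)
  qed
  then show ?case by (intro exI[of _ ?g] conjI radial_span.intros) auto
next
  case (coord f j)
  then obtain g where g: "radial_span F g" "\<And>x. ((\<lambda>t. f (x + t *\<^sub>R axis i 1)) has_vector_derivative g x) (at 0)" by blast
  let ?g = "\<lambda>\<xi>. of_real (\<xi> $ j) * g \<xi> + of_real (axis i 1 $ j) * f \<xi>"
  have "((\<lambda>t. of_real ((x + t *\<^sub>R axis i 1) $ j) * f (x + t *\<^sub>R axis i 1)) has_vector_derivative ?g x) (at 0)" for x
  proof -
    have "((\<lambda>t. (x + t *\<^sub>R axis i 1) $ j) has_real_derivative (axis i 1 $ j)) (at 0)"
      by (auto intro!: derivative_eq_intros)
    then have "((\<lambda>t. complex_of_real ((x + t *\<^sub>R axis i 1) $ j)) has_vector_derivative of_real (axis i 1 $ j)) (at 0)"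
      by (rule has_vector_derivative_of_real)
    from has_vector_derivative_mult[OF this g(2)[of x]] show ?thesis by (simp add: add.commute)
  qed
  then show ?case using coord g by (intro exI[of _ ?g] conjI radial_span.intros) auto
next
  case (scale f c)
  then obtain g where g: "radial_span F g" "\<And>x. ((\<lambda>t. f (x + t *\<^sub>R axis i 1)) has_vector_derivative g x) (at 0)" by blast
  then show ?case
    by (intro exI[of _ "\<lambda>\<xi>. of_real c * g \<xi>"] conjI radial_span.intros allI has_vector_derivative_mult_right)
next
  case (add f1 f2)
  then obtain g1 g2 where "radial_span F g1" "\<And>x. ((\<lambda>t. f1 (x + t *\<^sub>R axis i 1)) has_vector_derivative g1 x) (at 0)"
     "radial_span F g2" "\<And>x. ((\<lambda>t. f2 (x + t *\<^sub>R axis i 1)) has_vector_derivative g2 x) (at 0)" by blast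
  then show ?case
    by (intro exI[of _ "\<lambda>\<xi>. g1 \<xi> + g2 \<xi>"] conjI radial_span.intros allI has_vector_derivative_add)
qed

lemma radial_span_partial_differentiable: "radial_span F f \<Longrightarrow> partial_differentiable i f"
  using radial_span_partial[of f i] unfolding partial_differentiable_def
  by (meson differentiableI_vector)

lemma radial_span_partial_deriv:
  assumes "radial_span F f"
  shows "radial_span F (partial_deriv i f)"
proof -
  obtain g where g: "radial_span F g" "\<And>x. ((\<lambda>t. f (x + t *\<^sub>R axis i 1)) has_vector_derivative g x) (at 0)"
    using radial_span_partial[OF assms] by blast
  then have "partial_deriv i f = g"
    by (auto simp: partial_deriv_def fun_eq_iff vector_derivative_at)
  then show ?thesis using g by simp
qed

lemma radial_span_continuous:
  assumes "radial_span F f"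
  shows "continuous_on UNIV f"
  using assms
proof induction
  case (radial k)
  have F: "continuous_on {0..} (F k)"
    by (intro continuous_at_imp_continuous_on ballI DERIV_isCont[OF der]) auto
  have L: "continuous_on UNIV (laplace_symbol :: real ^ 'n \<Rightarrow> real)"
    unfolding laplace_symbol_def[abs_def] by (intro continuous_intros)
  have "continuous_on UNIV (\<lambda>\<xi> :: real ^ 'n. F k (laplace_symbol \<xi>))"
    by (rule continuous_on_compose2[OF F L]) (auto simp: laplace_symbol_nonneg)
  then show ?case by (rule continuous_on_of_real)
qed (auto intro!: continuous_intros)

lemma radial_span_growth:
  assumes "radial_span F f"
  shows "\<exists>C>0. \<exists>N::nat. \<forall>\<xi>. norm (f \<xi>) \<le> C * (1 + norm \<xi>) ^ N"
  using assms
proof induction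
  case (radial k)
  obtain C where C: "\<forall>x\<ge>0. \<bar>F k x\<bar> \<le> C" using bounded[of k] by blast
  have "norm (complex_of_real (F k (laplace_symbol \<xi>))) \<le> (\<bar>C\<bar> + 1) * (1 + norm \<xi>) ^ 0" for \<xi> :: "real ^ 'n"
  proof -
    have "\<bar>F k (laplace_symbol \<xi>)\<bar> \<le> C" using C laplace_symbol_nonneg[of \<xi>] by blast
    also have "C \<le> \<bar>C\<bar> + 1" by linarith
    finally show ?thesis by simp
  qed
  moreover have "\<bar>C\<bar> + 1 > 0" by linarith
  ultimately show ?case by blast
next
  case (coord f j)
  then obtain C N where C: "C > 0" "\<And>\<xi>. norm (f \<xi>) \<le> C * (1 + norm \<xi>) ^ N" by blast
  have "norm (of_real (\<xi> $ j) * f \<xi>) \<le> C * (1 + norm \<xi>) ^ Suc N" for \<xi>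
  proof -
    have "\<bar>\<xi> $ j\<bar> * norm (f \<xi>) \<le> (1 + norm \<xi>) * (C * (1 + norm \<xi>) ^ N)"
      using component_le_norm_cart[of \<xi> j] C by (intro mult_mono) auto
    then show ?thesis by (simp add: norm_mult mult_ac)
  qed
  then show ?case using C by blast
next
  case (scale f c)
  then obtain C N where C: "C > 0" "\<And>\<xi>. norm (f \<xi>) \<le> C * (1 + norm \<xi>) ^ N" by blast
  have "norm (of_real c * f \<xi>) \<le> ((\<bar>c\<bar> + 1) * C) * (1 + norm \<xi>) ^ N" for \<xi>
  proof -
    have "\<bar>c\<bar> * norm (f \<xi>) \<le> (\<bar>c\<bar> + 1) * (C * (1 + norm \<xi>) ^ N)"
      using C by (intro mult_mono) auto
    then show ?thesis by (simp add: norm_mult mult_ac)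
  qed
  moreover have "(\<bar>c\<bar> + 1) * C > 0" using C by (intro mult_pos_pos) auto
  ultimately show ?case by blast
next
  case (add f g)
  then obtain C N C' N' where C: "C > 0" "\<And>\<xi>. norm (f \<xi>) \<le> C * (1 + norm \<xi>) ^ N"
    "C' > 0" "\<And>\<xi>. norm (g \<xi>) \<le> C' * (1 + norm \<xi>) ^ N'" by blast
  have "norm (f \<xi> + g \<xi>) \<le> (C + C') * (1 + norm \<xi>) ^ max N N'" for \<xi>
  proof -
    have "norm (f \<xi> + g \<xi>) \<le> C * (1 + norm \<xi>) ^ N + C' * (1 + norm \<xi>) ^ N'"
      using norm_triangle_ineq[of "f \<xi>" "g \<xi>"] C(2,4)[of \<xi>] by linarith
    also have "\<dots> \<le> C * (1 + norm \<xi>) ^ max N N' + C' * (1 + norm \<xi>) ^ max N N'"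
      using C by (intro add_mono mult_left_mono power_increasing) auto
    finally show ?thesis by (simp add: distrib_right)
  qed
  then show ?case using C by (meson add_pos_pos)
qed

lemma radial_span_multi_partial:
  assumes "radial_span F f"
  shows "radial_span F (multi_partial \<alpha> f)"
proof -
  have pow: "radial_span F ((partial_deriv i ^^ k) f)" if "radial_span F f" for i k and f :: "real ^ 'n \<Rightarrow> complex"
    by (induction k) (auto intro: that radial_span_partial_deriv)
  have "radial_span F (foldr (\<lambda>i. partial_deriv i ^^ \<alpha> i) js f)" for js
    by (induction js) (auto intro: assms pow)
  then show ?thesis unfolding multi_partial_def .
qed

lemma radial_schwartz_multiplier:
  "(\<lambda>\<xi> :: real ^ 'n. complex_of_real (F 0 (laplace_symbol \<xi>))) \<in> schwartz_multipliers"
proof -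
  let ?f = "\<lambda>\<xi> :: real ^ 'n. complex_of_real (F 0 (laplace_symbol \<xi>))"
  have f: "radial_span F ?f" by (rule radial)
  have "radial_span F (iterated_partial js ?f)" for js
    unfolding iterated_partial_def by (induction js) (auto intro: f radial_span_partial_deriv)
  then have "smooth ?f"
    unfolding smooth_def by (auto intro: radial_span_continuous radial_span_partial_differentiable)
  then show ?thesis
    unfolding schwartz_multipliers_def using radial_span_growth[OF radial_span_multi_partial[OF f]] by blast
qed

end

section \<open>Signed measures with a density\<close>

text \<open>Among the Borel subsets of \<open>A\<close>, the part of \<open>A\<close> where \<open>f > 0\<close> has the largest signed measure.\<close>

lemma positive_variation_density:
  fixes \<kappa> :: "'a::topological_space measure" and f :: "'a \<Rightarrow> real"
  assumes sets [measurable_cong]: "sets \<kappa> = sets borel" and f: "integrable \<kappa> f"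
  shows "positive_variation (\<lambda>A. \<integral>x\<in>A. f x \<partial>\<kappa>) = density \<kappa> (\<lambda>x. ennreal (f x))"
proof -
  let ?\<nu> = "\<lambda>A. \<integral>x\<in>A. f x \<partial>\<kappa>" and ?P = "density \<kappa> (\<lambda>x. ennreal (f x))"
  have [measurable]: "f \<in> borel_measurable \<kappa>" using f by auto
  have sp: "space \<kappa> = UNIV" using sets_eq_imp_space_eq[OF sets] by simp
  have "(SUP B \<in> {B \<in> sets borel. B \<subseteq> A}. ennreal (?\<nu> B)) = emeasure ?P A" if A: "A \<in> sets borel" for A
  proof (rule antisym)
    have [measurable]: "A \<in> sets \<kappa>" using A sets by simp
    show "(SUP B \<in> {B \<in> sets borel. B \<subseteq> A}. ennreal (?\<nu> B)) \<le> emeasure ?P A"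
    proof (rule SUP_least)
      fix B assume "B \<in> {B \<in> sets borel. B \<subseteq> A}"
      then have B [measurable]: "B \<in> sets \<kappa>" and BA: "B \<subseteq> A" using sets by auto
      have int: "integrable \<kappa> (\<lambda>x. indicator B x * max 0 (f x))"
        by (rule Bochner_Integration.integrable_bound[OF f]) (auto simp: indicator_def)
      have "?\<nu> B \<le> (\<integral>x. indicator B x * max 0 (f x) \<partial>\<kappa>)"
        unfolding set_lebesgue_integral_def
        by (intro integral_mono int integrable_mult_indicator[OF B f]) (auto simp: indicator_def)
      then have "ennreal (?\<nu> B) \<le> ennreal (\<integral>x. indicator B x * max 0 (f x) \<partial>\<kappa>)" by (rule ennreal_leI)
      also have "\<dots> = (\<integral>\<^sup>+x. ennreal (indicator B x * max 0 (f x)) \<partial>\<kappa>)"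
        by (rule nn_integral_eq_integral[symmetric, OF int]) (auto simp: indicator_def)
      also have "\<dots> \<le> (\<integral>\<^sup>+x. ennreal (f x) * indicator A x \<partial>\<kappa>)"
        using BA by (intro nn_integral_mono) (auto simp: indicator_def max_def ennreal_neg)
      finally show "ennreal (?\<nu> B) \<le> emeasure ?P A" by (simp add: emeasure_density)
    qed
    let ?B = "A \<inter> {x \<in> space \<kappa>. f x > 0}"
    have B [measurable]: "?B \<in> sets \<kappa>" by measurable
    have int: "integrable \<kappa> (\<lambda>x. indicator ?B x * f x)"
      using integrable_mult_indicator[OF B f] by simp
    have "emeasure ?P A = (\<integral>\<^sup>+x. ennreal (indicator ?B x * f x) \<partial>\<kappa>)"
      by (simp add: emeasure_density) (intro nn_integral_cong, auto simp: indicator_def ennreal_neg sp)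
    also have "\<dots> = ennreal (?\<nu> ?B)"
      unfolding set_lebesgue_integral_def real_scaleR_def
      by (rule nn_integral_eq_integral[OF int]) (auto simp: indicator_def)
    also have "\<dots> \<le> (SUP B \<in> {B \<in> sets borel. B \<subseteq> A}. ennreal (?\<nu> B))"
      using B sets by (intro SUP_upper) auto
    finally show "emeasure ?P A \<le> (SUP B \<in> {B \<in> sets borel. B \<subseteq> A}. ennreal (?\<nu> B))" .
  qed
  then have "positive_variation ?\<nu> = measure_of UNIV (sets borel) (emeasure ?P)"
    unfolding positive_variation_def
    by (intro measure_of_eq) (auto simp: sets.sigma_sets_eq[of borel, simplified])
  also have "\<dots> = ?P"
    using measure_of_of_measure[of ?P] by (simp add: sets sp)
  finally show ?thesis .
qed

text \<open>The total variation is at most the \<open>L\<^sup>1\<close> norm of the density.\<close>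

lemma finite_signed_borel_measure_density:
  fixes \<kappa> :: "'a::topological_space measure" and f :: "'a \<Rightarrow> real"
  assumes sets [measurable_cong]: "sets \<kappa> = sets borel" and f: "integrable \<kappa> f"
  shows "finite_signed_borel_measure (\<lambda>A. \<integral>x\<in>A. f x \<partial>\<kappa>)"
  unfolding finite_signed_borel_measure_def
proof (intro conjI allI impI)
  let ?\<nu> = "\<lambda>A. \<integral>x\<in>A. f x \<partial>\<kappa>"
  have [measurable]: "f \<in> borel_measurable \<kappa>" using f by auto
  have sp: "space \<kappa> = UNIV" using sets_eq_imp_space_eq[OF sets] by simp
  show "?\<nu> {} = 0" by (simp add: set_lebesgue_integral_def)
  have intS: "set_integrable \<kappa> B f" if "B \<in> sets \<kappa>" for B
    unfolding set_integrable_def by (rule integrable_mult_indicator[OF that f])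
  show "(\<lambda>i. ?\<nu> (A i)) sums ?\<nu> (\<Union>i. A i)" if "range A \<subseteq> sets borel" "disjoint_family A" for A :: "nat \<Rightarrow> 'a set"
  proof -
    have A: "A i \<in> sets \<kappa>" for i using that sets by auto
    have "(\<Sum>i<n. ?\<nu> (A i)) = ?\<nu> (\<Union>i<n. A i)" for n
      using that(2) A by (intro set_integral_finite_Union[symmetric] intS) (auto simp: disjoint_family_on_def)
    moreover have "(\<lambda>n. ?\<nu> (\<Union>i<n. A i)) \<longlonglongrightarrow> ?\<nu> (\<Union>n. \<Union>i<n. A i)"
      using A by (intro set_integral_cont_up intS) (auto simp: incseq_def, force)
    moreover have "(\<Union>n. \<Union>i<n. A i) = (\<Union>i. A i)" by blast
    ultimately show ?thesis unfolding sums_def by simp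
  qed
  have "total_variation ?\<nu> \<le> (\<integral>\<^sup>+x. ennreal \<bar>f x\<bar> \<partial>\<kappa>)"
    unfolding total_variation_def
  proof (rule SUP_least)
    fix A :: "nat \<Rightarrow> 'a set" assume "A \<in> {A. range A \<subseteq> sets borel \<and> disjoint_family A \<and> (\<Union>i. A i) = UNIV}"
    then have A [measurable]: "\<And>i. A i \<in> sets \<kappa>" and dis: "disjoint_family A" and un: "(\<Union>i. A i) = UNIV"
      using sets by auto
    have "ennreal \<bar>?\<nu> (A i)\<bar> \<le> (\<integral>\<^sup>+x. ennreal \<bar>f x\<bar> * indicator (A i) x \<partial>\<kappa>)" for i
    proof -
      have int: "integrable \<kappa> (\<lambda>x. indicator (A i) x *\<^sub>R f x)" by (rule integrable_mult_indicator[OF A f])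
      have "\<bar>?\<nu> (A i)\<bar> \<le> (\<integral>x. \<bar>indicator (A i) x *\<^sub>R f x\<bar> \<partial>\<kappa>)"
        unfolding set_lebesgue_integral_def using integral_norm_bound[of \<kappa> "\<lambda>x. indicator (A i) x *\<^sub>R f x"] by simp
      then have "ennreal \<bar>?\<nu> (A i)\<bar> \<le> ennreal (\<integral>x. \<bar>indicator (A i) x *\<^sub>R f x\<bar> \<partial>\<kappa>)" by (rule ennreal_leI)
      also have "\<dots> = (\<integral>\<^sup>+x. ennreal \<bar>indicator (A i) x *\<^sub>R f x\<bar> \<partial>\<kappa>)"
        by (rule nn_integral_eq_integral[symmetric]) (use int in auto)
      also have "\<dots> = (\<integral>\<^sup>+x. ennreal \<bar>f x\<bar> * indicator (A i) x \<partial>\<kappa>)"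
        by (intro nn_integral_cong) (auto simp: indicator_def)
      finally show ?thesis .
    qed
    then have "(\<Sum>i. ennreal \<bar>?\<nu> (A i)\<bar>) \<le> (\<Sum>i. \<integral>\<^sup>+x. ennreal \<bar>f x\<bar> * indicator (A i) x \<partial>\<kappa>)"
      by (intro suminf_le summableI)
    also have "\<dots> = (\<integral>\<^sup>+x. (\<Sum>i. ennreal \<bar>f x\<bar> * indicator (A i) x) \<partial>\<kappa>)"
      by (rule nn_integral_suminf[symmetric]) measurable
    also have "\<dots> = (\<integral>\<^sup>+x. ennreal \<bar>f x\<bar> \<partial>\<kappa>)"
      using un by (intro nn_integral_cong) (simp add: ennreal_suminf_cmult suminf_indicator[OF dis])
    finally show "(\<Sum>i. ennreal \<bar>?\<nu> (A i)\<bar>) \<le> (\<integral>\<^sup>+x. ennreal \<bar>f x\<bar> \<partial>\<kappa>)" .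
  qed
  also have "\<dots> < \<infinity>" using f by (simp add: integrable_iff_bounded)
  finally show "total_variation ?\<nu> < \<infinity>" .
qed

lemma signed_integral_density:
  fixes \<kappa> :: "'a::topological_space measure" and f :: "'a \<Rightarrow> real" and h :: "'a \<Rightarrow> complex"
  assumes sets [measurable_cong]: "sets \<kappa> = sets borel" and f: "integrable \<kappa> f"
    and h [measurable]: "h \<in> borel_measurable borel" and hb: "\<And>x. norm (h x) \<le> 1"
  shows "signed_integral (\<lambda>A. \<integral>x\<in>A. f x \<partial>\<kappa>) h = (\<integral>x. f x *\<^sub>R h x \<partial>\<kappa>)"
proof -
  have [measurable]: "f \<in> borel_measurable \<kappa>" using f by auto
  have mf: "integrable \<kappa> (\<lambda>x. - f x)" using f by simp
  have neg: "(\<lambda>A. - (\<integral>x\<in>A. f x \<partial>\<kappa>)) = (\<lambda>A. \<integral>x\<in>A. - f x \<partial>\<kappa>)"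
    by (simp add: set_lebesgue_integral_def)
  have pos: "(\<integral>x. h x \<partial>density \<kappa> (\<lambda>x. ennreal (g x))) = (\<integral>x. max 0 (g x) *\<^sub>R h x \<partial>\<kappa>)"
    if [measurable]: "g \<in> borel_measurable \<kappa>" for g
  proof -
    have "density \<kappa> (\<lambda>x. ennreal (g x)) = density \<kappa> (\<lambda>x. ennreal (max 0 (g x)))"
      by (intro density_cong AE_I2) (auto simp: max_def ennreal_neg)
    then have "(\<integral>x. h x \<partial>density \<kappa> (\<lambda>x. ennreal (g x))) = (\<integral>x. h x \<partial>density \<kappa> (\<lambda>x. ennreal (max 0 (g x))))"
      by (simp only:)
    also have "\<dots> = (\<integral>x. max 0 (g x) *\<^sub>R h x \<partial>\<kappa>)"
      by (rule integral_density) auto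
    finally show ?thesis .
  qed
  have bd: "norm (max 0 a *\<^sub>R h x) \<le> \<bar>a\<bar>" for a x
    using mult_left_le[OF hb, of "max 0 a" x] by (auto simp: max_def split: if_splits)
  have I: "integrable \<kappa> (\<lambda>x. max 0 (f x) *\<^sub>R h x)" "integrable \<kappa> (\<lambda>x. max 0 (- f x) *\<^sub>R h x)"
    using bd[of "f _"] bd[of "- f _"] by (auto intro!: Bochner_Integration.integrable_bound[OF f] AE_I2 simp del: norm_scaleR)
  have "signed_integral (\<lambda>A. \<integral>x\<in>A. f x \<partial>\<kappa>) h = (\<integral>x. max 0 (f x) *\<^sub>R h x \<partial>\<kappa>) - (\<integral>x. max 0 (- f x) *\<^sub>R h x \<partial>\<kappa>)"
    unfolding signed_integral_def negative_variation_def neg positive_variation_density[OF sets f] positive_variation_density[OF sets mf]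
    by (simp add: pos)
  also have "\<dots> = (\<integral>x. max 0 (f x) *\<^sub>R h x - max 0 (- f x) *\<^sub>R h x \<partial>\<kappa>)" using I by simp
  also have "\<dots> = (\<integral>x. f x *\<^sub>R h x \<partial>\<kappa>)" by (intro Bochner_Integration.integral_cong refl) (auto simp: max_def)
  finally show ?thesis .
qed

text \<open>Lebesgue measure plus a unit mass at the origin. With respect to this measure, a point mass plus an
  absolutely continuous part again has a density, whose positive and negative parts are explicit.\<close>

definition lborel_plus_dirac :: "'a::euclidean_space measure" where
  "lborel_plus_dirac = measure_of UNIV (sets borel) (\<lambda>A. emeasure lborel A + indicator A 0)"

lemma sets_lborel_plus_dirac [measurable_cong]: "sets (lborel_plus_dirac :: 'a::euclidean_space measure) = sets borel"
  using sets.sigma_sets_eq[of "borel :: 'a measure"] by (simp add: lborel_plus_dirac_def)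

lemma emeasure_lborel_plus_dirac:
  assumes "A \<in> sets borel"
  shows "emeasure lborel_plus_dirac A = emeasure lborel A + indicator A (0 :: 'a::euclidean_space)"
proof (rule emeasure_measure_of[OF lborel_plus_dirac_def])
  show "positive (sets lborel_plus_dirac) (\<lambda>A. emeasure lborel A + indicator A (0 :: 'a))"
    by (simp add: positive_def)
  show "countably_additive (sets lborel_plus_dirac) (\<lambda>A. emeasure lborel A + indicator A (0 :: 'a))"
    unfolding countably_additive_def
  proof (intro allI impI)
    fix A :: "nat \<Rightarrow> 'a set"
    assume A: "range A \<subseteq> sets lborel_plus_dirac" and d: "disjoint_family A"
    have "(\<Sum>i. emeasure lborel (A i) + indicator (A i) (0 :: 'a)) = (\<Sum>i. emeasure lborel (A i)) + (\<Sum>i. indicator (A i) (0 :: 'a))"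
      by (rule suminf_add[symmetric]) (auto intro: summableI)
    then show "(\<Sum>i. emeasure lborel (A i) + indicator (A i) (0 :: 'a)) = emeasure lborel (\<Union>i. A i) + indicator (\<Union>i. A i) 0"
      using A d by (simp add: suminf_emeasure sets_lborel_plus_dirac suminf_indicator)
  qed
qed (use assms in \<open>auto simp: sets_lborel_plus_dirac\<close>)

text \<open>Both summands are restrictions of the sum, to the complement of the origin and to the origin.\<close>

lemma integral_lborel_plus_dirac:
  fixes h :: "'a::euclidean_space \<Rightarrow> 'b::{banach, second_countable_topology}"
  assumes h: "integrable lborel h"
  shows "integrable lborel_plus_dirac h" and "(\<integral>x. h x \<partial>lborel_plus_dirac) = (\<integral>x. h x \<partial>lborel) + h 0"
proof -
  have [measurable]: "h \<in> borel_measurable borel" using h by auto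
  have m [measurable]: "{0::'a} \<in> sets borel" "- {0::'a} \<in> sets borel" by auto
  have ind: "(\<lambda>x. ennreal (indicator B x)) = indicator B" for B :: "'a set"
    by (auto simp: fun_eq_iff indicator_def)
  have l: "lborel = density lborel_plus_dirac (\<lambda>x. ennreal (indicator (- {0::'a}) x))"
  proof (rule measure_eqI)
    fix A :: "'a set" assume "A \<in> sets lborel"
    then have A [measurable]: "A \<in> sets borel" by simp
    have "emeasure (density lborel_plus_dirac (\<lambda>x. ennreal (indicator (- {0::'a}) x))) A = emeasure lborel_plus_dirac (- {0} \<inter> A)"
      unfolding ind by (rule emeasure_restricted) measurable
    also have "\<dots> = emeasure lborel (A - {0})"
      by (simp add: emeasure_lborel_plus_dirac Int_commute[of _ A] flip: Diff_eq)
    also have "\<dots> = emeasure lborel A"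
      by (intro emeasure_Diff_null_set) (auto simp: null_sets_def)
    finally show "emeasure lborel A = emeasure (density lborel_plus_dirac (\<lambda>x. ennreal (indicator (- {0::'a}) x))) A" by simp
  qed (simp add: sets_lborel_plus_dirac)
  have d: "return borel (0::'a) = density lborel_plus_dirac (\<lambda>x. ennreal (indicator {0::'a} x))"
  proof (rule measure_eqI)
    fix A :: "'a set" assume "A \<in> sets (return borel 0)"
    then have A [measurable]: "A \<in> sets borel" by simp
    have "emeasure (density lborel_plus_dirac (\<lambda>x. ennreal (indicator {0::'a} x))) A = emeasure lborel_plus_dirac (A \<inter> {0})"
      unfolding ind Int_commute[of A] by (rule emeasure_restricted) measurable
    also have "\<dots> = emeasure lborel (A \<inter> {0}) + indicator (A \<inter> {0}) 0"
      by (simp add: emeasure_lborel_plus_dirac)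
    also have "emeasure lborel (A \<inter> {0}) = 0"
      by (cases "0 \<in> A") auto
    finally show "emeasure (return borel 0) A = emeasure (density lborel_plus_dirac (\<lambda>x. ennreal (indicator {0::'a} x))) A"
      by (simp add: indicator_def)
  qed (simp add: sets_lborel_plus_dirac)
  have mh: "h \<in> borel_measurable lborel_plus_dirac" by measurable
  have i1: "integrable lborel_plus_dirac (\<lambda>x. indicator (- {0::'a}) x *\<^sub>R h x)"
    using h by (subst (asm) l) (simp add: integrable_density mh)
  have "integrable (return borel (0::'a)) h"
    by (rule integrableI_bounded) (auto simp: nn_integral_return)
  then have i2: "integrable lborel_plus_dirac (\<lambda>x. indicator {0::'a} x *\<^sub>R h x)"
    by (subst (asm) d) (simp add: integrable_density mh)
  have sum: "h = (\<lambda>x. indicator (- {0::'a}) x *\<^sub>R h x + indicator {0::'a} x *\<^sub>R h x)"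
    by (auto simp: fun_eq_iff indicator_def)
  show "integrable lborel_plus_dirac h"
    by (subst sum) (intro Bochner_Integration.integrable_add i1 i2)
  have "(\<integral>x. h x \<partial>lborel_plus_dirac) = (\<integral>x. indicator (- {0::'a}) x *\<^sub>R h x \<partial>lborel_plus_dirac) + (\<integral>x. indicator {0::'a} x *\<^sub>R h x \<partial>lborel_plus_dirac)"
    by (subst sum) (intro Bochner_Integration.integral_add i1 i2)
  also have "(\<integral>x. indicator (- {0::'a}) x *\<^sub>R h x \<partial>lborel_plus_dirac) = (\<integral>x. h x \<partial>lborel)"
    by (subst l) (simp add: integral_density mh)
  also have "(\<integral>x. indicator {0::'a} x *\<^sub>R h x \<partial>lborel_plus_dirac) = (\<integral>x. h x \<partial>return borel 0)"
    by (subst d) (simp add: integral_density mh)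
  also have "(\<integral>x. h x \<partial>return borel 0) = h 0" by (simp add: integral_return)
  finally show "(\<integral>x. h x \<partial>lborel_plus_dirac) = (\<integral>x. h x \<partial>lborel) + h 0" .
qed

lemma signed_measure_dirac_plus_L1:
  fixes g :: "real ^ 'n \<Rightarrow> real"
  assumes g: "integrable lborel g"
  obtains \<nu> where "finite_signed_borel_measure \<nu>"
    "\<And>\<xi>. fourier_transform_measure \<nu> \<xi> = of_real c + fourier_transform (\<lambda>x. complex_of_real (g x)) \<xi>"
proof
  \<comment> \<open>Lebesgue measure ignores the value at the origin, which can therefore carry the point mass.\<close>
  define f where "f x = (if x = 0 then c else g x)" for x
  have [measurable]: "g \<in> borel_measurable borel" using g by auto
  have [measurable]: "f \<in> borel_measurable borel" unfolding f_def by measurable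
  have ae: "AE x in lborel. f x = g x"
    using AE_lborel_singleton[of "0 :: real ^ 'n"] by eventually_elim (simp add: f_def)
  have fi: "integrable lborel f"
    using g by (subst integrable_cong_AE[OF _ _ ae]) auto
  note f = integral_lborel_plus_dirac(1)[OF fi]
  show "finite_signed_borel_measure (\<lambda>A. \<integral>x\<in>A. f x \<partial>lborel_plus_dirac)"
    by (rule finite_signed_borel_measure_density[OF sets_lborel_plus_dirac f])
  fix \<xi> :: "real ^ 'n"
  have i: "integrable lborel (\<lambda>x. f x *\<^sub>R fourier_kernel \<xi> x)"
    by (rule Bochner_Integration.integrable_bound[OF fi]) auto
  have "fourier_transform_measure (\<lambda>A. \<integral>x\<in>A. f x \<partial>lborel_plus_dirac) \<xi> = (\<integral>x. f x *\<^sub>R fourier_kernel \<xi> x \<partial>lborel_plus_dirac)"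
    unfolding fourier_transform_measure_def
    by (rule signed_integral_density[OF sets_lborel_plus_dirac f]) auto
  also have "\<dots> = (\<integral>x. f x *\<^sub>R fourier_kernel \<xi> x \<partial>lborel) + of_real c"
    unfolding integral_lborel_plus_dirac(2)[OF i] by (simp add: f_def fourier_kernel_def scaleR_conv_of_real)
  also have "(\<integral>x. f x *\<^sub>R fourier_kernel \<xi> x \<partial>lborel) = (\<integral>x. of_real (g x) * fourier_kernel \<xi> x \<partial>lborel)"
    by (intro integral_cong_AE) (use ae in \<open>auto simp: scaleR_conv_of_real\<close>)
  finally show "fourier_transform_measure (\<lambda>A. \<integral>x\<in>A. f x \<partial>lborel_plus_dirac) \<xi> = of_real c + fourier_transform (\<lambda>x. complex_of_real (g x)) \<xi>"
    by (simp add: fourier_transform_def add.commute)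
qed

section \<open>A cut-off with a flat zero\<close>

lemma power_exp_minus_le_fact:
  fixes u :: real
  assumes "u \<ge> 0"
  shows "u ^ m * exp (- u) \<le> fact m"
proof -
  have "(\<Sum>n\<in>{m}. u ^ n /\<^sub>R fact n) \<le> (\<Sum>n. u ^ n /\<^sub>R fact n)"
    using assms by (intro sum_le_suminf summable_exp_generic) auto
  then have "u ^ m / fact m \<le> exp u" by (simp add: exp_def divide_inverse mult.commute)
  then show ?thesis by (simp add: exp_minus field_simps)
qed

text \<open>In terms of \<open>u = 1 / (x - 2)\<close> this is \<open>u\<^sup>k e\<^sup>-\<^sup>u\<close>, extended by \<open>0\<close>. The family is needed because differentiation
  raises the power of \<open>u\<close>; the cut-off itself is the case \<open>k = 0\<close>. The zero lies at \<open>2\<close> in order to stay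
  clear of the zero of the logarithm at \<open>1\<close>.\<close>

definition flat_exp :: "nat \<Rightarrow> real \<Rightarrow> real" where
  "flat_exp k x = (if x > 2 then (1 / (x - 2)) ^ k * exp (- (1 / (x - 2))) else 0)"

lemma flat_exp_nonneg: "flat_exp k x \<ge> 0"
  by (simp add: flat_exp_def)

text \<open>Quadratic decay at \<open>2\<close> gives the vanishing derivative at the point where the two pieces meet.\<close>

lemma flat_exp_le_square: "flat_exp k x \<le> fact (k + 2) * (x - 2)\<^sup>2"
proof (cases "x > 2")
  case True
  let ?u = "1 / (x - 2)"
  have "?u ^ (k + 2) * exp (- ?u) \<le> fact (k + 2)" using True by (intro power_exp_minus_le_fact) auto
  then have "(?u ^ (k + 2) * exp (- ?u)) * (x - 2)\<^sup>2 \<le> fact (k + 2) * (x - 2)\<^sup>2" by (intro mult_right_mono) auto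
  moreover have "(?u ^ (k + 2) * exp (- ?u)) * (x - 2)\<^sup>2 = flat_exp k x"
  proof -
    have "?u ^ 2 * (x - 2)\<^sup>2 = 1" using True by (simp add: power_divide)
    then show ?thesis using True unfolding flat_exp_def power_add by (simp add: mult_ac)
  qed
  ultimately show ?thesis by simp
qed (simp add: flat_exp_def)

lemma flat_exp_derivative: "(flat_exp k has_real_derivative flat_exp (k + 2) x - real k * flat_exp (k + 1) x) (at x)"
proof -
  consider "x > 2" | "x < 2" | "x = 2" by linarith
  then show ?thesis
  proof cases
    case 1
    let ?f = "\<lambda>x::real. (1 / (x - 2)) ^ k * exp (- (1 / (x - 2)))"
    let ?u = "1 / (x - 2)"
    have du: "((\<lambda>x. 1 / (x - 2)) has_real_derivative - (?u ^ 2)) (at x)"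
      using 1 by (auto intro!: derivative_eq_intros simp: power2_eq_square)
    have "((\<lambda>x. (1 / (x - 2)) ^ k) has_real_derivative real k * ((- (?u ^ 2)) * ?u ^ (k - Suc 0))) (at x)"
      using DERIV_power[OF du, of k] by (simp add: mult_ac)
    moreover have "((\<lambda>x. exp (- (1 / (x - 2)))) has_real_derivative exp (- ?u) * ?u ^ 2) (at x)"
      using DERIV_minus[OF du] by (auto intro!: DERIV_chain2[OF DERIV_exp, of "\<lambda>x. - (1 / (x - 2))" "?u ^ 2"])
    ultimately have "(?f has_real_derivative real k * ((- (?u ^ 2)) * ?u ^ (k - Suc 0)) * exp (- ?u) + exp (- ?u) * ?u ^ 2 * ?u ^ k) (at x)"
      by (rule DERIV_mult)
    moreover have "real k * ((- (?u ^ 2)) * ?u ^ (k - Suc 0)) * exp (- ?u) + exp (- ?u) * ?u ^ 2 * ?u ^ k = flat_exp (k + 2) x - real k * flat_exp (k + 1) x"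
    proof -
      define u where "u = ?u"
      have fl: "flat_exp j x = u ^ j * exp (- u)" for j using 1 by (simp add: flat_exp_def u_def)
      show ?thesis unfolding fl u_def[symmetric] by (cases k) (simp_all add: power2_eq_square algebra_simps)
    qed
    ultimately have "(?f has_real_derivative flat_exp (k + 2) x - real k * flat_exp (k + 1) x) (at x)" by simp
    moreover have ev: "\<forall>\<^sub>F y in nhds x. flat_exp k y = ?f y"
      using eventually_nhds_in_open[of "{2<..}" x] 1 by (auto elim!: eventually_mono simp: flat_exp_def)
    ultimately show ?thesis using DERIV_cong_ev[OF refl ev refl] by blast
  next
    case 2
    have "((\<lambda>_. 0) has_real_derivative flat_exp (k + 2) x - real k * flat_exp (k + 1) x) (at x)"
      using 2 by (simp add: flat_exp_def)
    moreover have ev: "\<forall>\<^sub>F y in nhds x. flat_exp k y = 0"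
      using eventually_nhds_in_open[of "{..<2}" x] 2 by (auto elim!: eventually_mono simp: flat_exp_def)
    ultimately show ?thesis using DERIV_cong_ev[OF refl ev refl] by blast
  next
    case 3
    have "((\<lambda>h. (flat_exp k (2 + h) - flat_exp k 2) / h) \<longlongrightarrow> 0) (at 0)"
    proof (rule Lim_null_comparison)
      have "norm ((flat_exp k (2 + h) - flat_exp k 2) / h) \<le> fact (k + 2) * \<bar>h\<bar>" for h :: real
      proof (cases "h = 0")
        case False
        have "flat_exp k (2 + h) \<le> fact (k + 2) * \<bar>h\<bar> * \<bar>h\<bar>"
          using flat_exp_le_square[of k "2 + h"] by (simp add: power2_eq_square mult.assoc)
        then show ?thesis using False flat_exp_nonneg[of k "2 + h"] by (simp add: flat_exp_def[of k 2] divide_le_eq)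
      qed simp
      then show "\<forall>\<^sub>F h in at 0. norm ((flat_exp k (2 + h) - flat_exp k 2) / h) \<le> fact (k + 2) * \<bar>h\<bar>" by simp
      show "((\<lambda>h::real. fact (k + 2) * \<bar>h\<bar>) \<longlongrightarrow> 0) (at 0)" by (auto intro!: tendsto_eq_intros)
    qed
    then show ?thesis using 3 by (simp add: DERIV_def flat_exp_def[of _ 2])
  qed
qed

abbreviation decay :: "real \<Rightarrow> real" where "decay x \<equiv> inverse (1 + x)"

text \<open>An open neighbourhood of the range \<open>{0..}\<close> of \<open>\<rho>\<close> on which \<open>1 + x\<close> is bounded away from \<open>0\<close> and \<open>\<lambda> + x \<ge> 1 + x\<close>.
  Estimates here include smoothness across \<open>\<xi> = 0\<close>.\<close>

definition tail_domain :: "real set" where "tail_domain = {- 1 / 2<..}"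

interpretation tail: symbol_scale "\<lambda>x. 1 + x" tail_domain
  by standard (auto simp: tail_domain_def)

lemma tail_pos: "x \<in> tail_domain \<Longrightarrow> 1 + x > 1 / 2" "x \<in> tail_domain \<Longrightarrow> decay x \<le> 2" "x \<in> tail_domain \<Longrightarrow> 0 \<le> decay x"
  by (auto simp: tail_domain_def inverse_le_iff field_simps)

lemma flat_exp_bound: "\<exists>C. \<forall>x\<in>tail_domain. \<bar>flat_exp k x\<bar> \<le> C * decay x ^ k"
proof -
  have "\<bar>flat_exp k x\<bar> \<le> (3 ^ k * fact k * exp 1) * decay x ^ k" if "x \<in> tail_domain" for x
  proof (cases "x > 2")
    case True
    let ?u = "1 / (x - 2)"
    have u: "?u > 0" using True by simp
    have "(1 + x) * ?u = 3 * ?u + 1" using True by (simp add: field_simps)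
    then have "((1 + x) * ?u) ^ k * exp (- ?u) \<le> (3 * (?u + 1)) ^ k * exp (- ?u)"
      using u by (intro mult_right_mono power_mono) auto
    also have "\<dots> = 3 ^ k * ((?u + 1) ^ k * exp (- (?u + 1))) * exp 1"
    proof -
      have "exp (- ?u) = exp (- (?u + 1)) * exp 1" by (simp flip: exp_add)
      then show ?thesis unfolding power_mult_distrib by (simp only: mult.assoc)
    qed
    also have "\<dots> \<le> 3 ^ k * fact k * exp 1"
      using u by (intro mult_right_mono mult_left_mono power_exp_minus_le_fact) auto
    finally have "(1 + x) ^ k * flat_exp k x \<le> 3 ^ k * fact k * exp 1"
      using True unfolding power_mult_distrib by (simp add: flat_exp_def mult.assoc)
    then show ?thesis using True flat_exp_nonneg[of k x] by (simp add: field_simps power_inverse)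
  next
    case False
    then show ?thesis using tail_pos[OF that] by (simp add: flat_exp_def)
  qed
  then show ?thesis by blast
qed

lemma symb_flat_exp: "tail.S N (\<lambda>x. decay x ^ k) (flat_exp k)"
proof (induction N arbitrary: k)
  case 0
  show ?case using flat_exp_bound[of k] by simp
next
  case (Suc N)
  obtain C where C: "\<And>x. x \<in> tail_domain \<Longrightarrow> \<bar>flat_exp k x\<bar> \<le> C * decay x ^ k" using flat_exp_bound[of k] by blast
  show ?case
  proof (rule tail.symb_SucI[OF flat_exp_derivative C])
    have w: "(\<lambda>x. decay x ^ k / (1 + x)) = (\<lambda>x :: real. decay x ^ (k + 1))"
      by (simp add: divide_inverse mult.commute)
    have a: "tail.S N (\<lambda>x. decay x ^ (k + 1)) (flat_exp (k + 2))"
      by (rule tail.symb_weaken[OF Suc, where K = 2])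
        (use tail_pos in \<open>auto intro!: mult_right_mono zero_le_power simp: mult.assoc[symmetric]\<close>)
    have b: "tail.S N (\<lambda>x. decay x ^ (k + 1)) (\<lambda>x. - (real k * flat_exp (k + 1) x))"
      by (intro tail.symb_minus tail.symb_cmult Suc zero_le_power tail_pos)
    show "tail.S N (\<lambda>x. decay x ^ k / (1 + x)) (\<lambda>x. flat_exp (k + 2) x - real k * flat_exp (k + 1) x)"
      unfolding w using tail.symb_add[OF a b] by simp
  qed
qed

lemma symb_one_minus_flat_exp: "tail.S N decay (\<lambda>x. 1 - flat_exp 0 x)"
proof -
  have bd: "\<bar>1 - flat_exp 0 x\<bar> \<le> 4 * decay x" if x: "x \<in> tail_domain" for x
  proof (cases "x > 2")
    case True
    let ?u = "1 / (x - 2)"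
    have u: "?u > 0" using True by simp
    have "1 - exp (- ?u) \<le> ?u" using exp_ge_add_one_self[of "- ?u"] by linarith
    then have "(1 - exp (- ?u)) * (x - 2) \<le> ?u * (x - 2)" using True by (intro mult_right_mono) auto
    then have "(1 - exp (- ?u)) * (x - 2) \<le> 1" using True by simp
    moreover have "(1 - exp (- ?u)) * 3 \<le> 3" by simp
    moreover have "(1 - exp (- ?u)) * (1 + x) = (1 - exp (- ?u)) * (x - 2) + (1 - exp (- ?u)) * 3" by (simp add: algebra_simps)
    ultimately have "(1 - exp (- ?u)) * (1 + x) \<le> 4" by linarith
    moreover have "exp (- ?u) \<le> 1" using u by simp
    ultimately show ?thesis using True by (simp add: flat_exp_def pos_le_divide_eq divide_inverse[symmetric])
  next
    case False
    then show ?thesis using tail_pos(1)[OF x] by (simp add: flat_exp_def pos_le_divide_eq divide_inverse[symmetric])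
  qed
  show ?thesis
  proof (cases N)
    case 0
    then show ?thesis using bd by auto
  next
    case (Suc m)
    show ?thesis unfolding Suc
    proof (rule tail.symb_SucI[OF _ bd])
      show "((\<lambda>x. 1 - flat_exp 0 x) has_real_derivative - flat_exp 2 x) (at x)" for x
        using DERIV_diff[OF DERIV_const flat_exp_derivative[of 0 x], of 1] by (simp add: numeral_2_eq_2)
      have "(\<lambda>x. decay x / (1 + x)) = (\<lambda>x :: real. decay x ^ 2)"
        by (simp add: power2_eq_square divide_inverse)
      then show "tail.S m (\<lambda>x. decay x / (1 + x)) (\<lambda>x. - flat_exp 2 x)"
        using symb_flat_exp[of m 2] by (auto intro!: tail.symb_minus)
    qed auto
  qed
qed

text \<open>The criterion with \<open>W(r) = r / (1 + r)\<^sup>2\<close>, whose quotient \<open>W(r) / r\<close> has the primitive \<open>- 1 / (1 + r)\<close>.\<close>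

lemma L1_symbol_tail:
  assumes "\<And>N. tail.S N decay F"
  shows "L1_symbol (\<lambda>\<xi> :: real ^ 'n. of_real (F (laplace_symbol \<xi>)))"
proof -
  interpret pos: symbol_scale "\<lambda>x. x" "{0<..}" by standard auto
  have sub: "{0<..} \<subseteq> tail_domain" by (auto simp: tail_domain_def)
  have diff: "F differentiable (at x)" if "x \<in> tail_domain" for x
    using assms[of 1] that by simp
  have z: "0 \<in> tail_domain" by (simp add: tail_domain_def)
  define W where "W x = x / (1 + x)\<^sup>2" for x :: real
  obtain C where C: "\<And>x. x \<in> tail_domain \<Longrightarrow> \<bar>F x\<bar> \<le> C * decay x" using symb_bound[OF assms[of 0]] by blast
  show ?thesis
  proof (rule L1_symbol_criterion[where W = W])
    show "F differentiable (at r)" if "r > 0" for r using diff sub that by auto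
    show "symb N (\<lambda>r. r) {0<..} (\<lambda>r. W r / r) (deriv F)" for N
    proof -
      have "tail.S N (\<lambda>x. decay x / (1 + x)) (deriv F)" using assms[of "Suc N"] by simp
      then have "pos.S N (\<lambda>x. decay x / (1 + x)) (deriv F)"
        by (rule symb_mono[OF _ sub, where K = 1]) auto
      then show ?thesis
        by (rule pos.symb_weaken[where K = 1]) (auto simp: W_def power2_eq_square divide_inverse)
    qed
    show "(W \<longlongrightarrow> 0) at_top" "(W \<longlongrightarrow> 0) (at_right 0)" unfolding W_def by real_asymp+
    show "set_integrable lborel {0<..} (\<lambda>r. W r / r)"
    proof (rule set_integrable_derivative_half_line[where F = "\<lambda>x. - (1 / (1 + x))"])
      fix x :: real assume x: "x > 0"
      show "((\<lambda>x. - (1 / (1 + x))) has_real_derivative W x / x) (at x)"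
        using x by (auto intro!: derivative_eq_intros simp: W_def power2_eq_square)
      show "isCont (\<lambda>r. W r / r) x" unfolding W_def using x by (intro continuous_intros) auto
      show "0 \<le> W x / x" using x by (simp add: W_def)
    next
      show "((\<lambda>x::real. - (1 / (1 + x))) \<longlongrightarrow> -1) (at_right 0)" by real_asymp
      show "((\<lambda>x::real. - (1 / (1 + x))) \<longlongrightarrow> 0) at_top" by real_asymp
    qed
    show "(F \<longlongrightarrow> 0) at_top"
    proof (rule Lim_null_comparison)
      show "\<forall>\<^sub>F x in at_top. norm (F x) \<le> C * decay x"
        using eventually_gt_at_top[of 0] by eventually_elim (use C sub in auto)
      show "((\<lambda>x. C * decay x) \<longlongrightarrow> 0) at_top" by real_asymp
    qed
    have "isCont F 0" using diff[OF z] by (rule differentiable_imp_continuous_within)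
    then show "(F \<longlongrightarrow> F 0) (at_right 0)" unfolding isCont_def by (rule tendsto_within_subset) simp
  qed
qed

lemma schwartz_multiplier_tail:
  assumes "\<And>N. tail.S N (\<lambda>_. 1) F"
  shows "(\<lambda>\<xi> :: real ^ 'n. complex_of_real (F (laplace_symbol \<xi>))) \<in> schwartz_multipliers"
proof -
  define G where "G k = (deriv ^^ k) F" for k
  have sub: "x \<in> tail_domain" if "x \<ge> 0" for x using that by (simp add: tail_domain_def)
  have "(\<lambda>\<xi> :: real ^ 'n. complex_of_real (G 0 (laplace_symbol \<xi>))) \<in> schwartz_multipliers"
  proof (rule radial_schwartz_multiplier)
    show "(G k has_real_derivative G (Suc k) x) (at x)" if "x \<ge> 0" for k x
      using symb_iterated_deriv(2)[OF assms[of "Suc k"], of k x] sub[OF that] by (simp add: G_def)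
    show "\<exists>C. \<forall>x\<ge>0. \<bar>G k x\<bar> \<le> C" for k
    proof -
      obtain C where C: "\<And>x. x \<in> tail_domain \<Longrightarrow> \<bar>G k x\<bar> \<le> C * (1 / (1 + x) ^ k)"
        using symb_iterated_deriv(1)[OF assms[of k], of k] by (auto simp: G_def)
      have "\<bar>G k x\<bar> \<le> \<bar>C\<bar>" if x: "x \<ge> 0" for x
      proof -
        have "\<bar>G k x\<bar> \<le> C * (1 / (1 + x) ^ k)" by (rule C[OF sub[OF x]])
        also have "\<dots> \<le> \<bar>C\<bar> * 1" using x by (intro mult_mono) auto
        finally show ?thesis by simp
      qed
      then show ?thesis by blast
    qed
  qed
  then show ?thesis by (simp add: G_def)
qed

section \<open>The inverse quotient away from its pole\<close>

text \<open>The logarithm is bounded below by a positive constant here, and the domain overlaps the region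
  \<open>x < 2\<close> where the cut-off vanishes.\<close>

definition upper_domain :: "real set" where "upper_domain = {3 / 2<..}"

interpretation upper: symbol_scale "\<lambda>x. 1 + x" upper_domain
  by standard (auto simp: upper_domain_def)

text \<open>With \<open>X = ((\<lambda> + x) / x)\<^sup>s\<close>, \<open>l = ln ((\<lambda> + x) / x)\<close> and \<open>J = 1 / ln x\<close> the function is \<open>(X - 1) + X l J\<close>, and both
  \<open>X - 1\<close> and \<open>l\<close> are of order \<open>1 / x\<close>.\<close>

lemma symb_quotient_minus_one:
  assumes lam: "lam > 1" and s: "s > 0"
  shows "upper.S N decay (\<lambda>x. (lam + x) powr s * ln (lam + x) / (x powr s * ln x) - 1)"
proof -
  define X where "X x = x powr (- s) * (lam + x) powr s" for x
  define l where "l x = ln (lam + x) - ln x" for x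
  define J where "J x = inverse (ln x)" for x :: real
  have up: "x > 3 / 2" if "x \<in> upper_domain" for x using that by (simp add: upper_domain_def)
  have lam_pos: "lam + x > 0" "1 + x \<le> 1 * (lam + x)" if "x \<in> upper_domain" for x using up[OF that] lam by auto
  have id_pos: "0 + x > 0" "1 + x \<le> 2 * (0 + x)" if "x \<in> upper_domain" for x using up[OF that] by auto
  have iv: "0 \<le> decay x" "inverse x \<le> 2 * decay x" "inverse (lam + x) \<le> 1 * decay x" "0 \<le> inverse x" "0 \<le> inverse (lam + x)"
    if "x \<in> upper_domain" for x using up[OF that] lam by (auto simp: field_simps)
  have X_eq: "X x = ((lam + x) / x) powr s" if "x \<in> upper_domain" for x
    using up[OF that] lam by (simp add: X_def powr_divide powr_minus field_simps)
  have u: "(lam + x) / x \<le> 1 + lam" "(lam + x) / x > 1" "(lam + x) / x - 1 = lam * inverse x" if "x \<in> upper_domain" for x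
    using up[OF that] lam by (auto simp: field_simps)
  have X_le: "0 \<le> X x" "X x \<le> (1 + lam) powr s * 1" if "x \<in> upper_domain" for x
    using u[OF that] s by (auto simp: X_eq[OF that] intro!: powr_mono2)
  have S_X: "upper.S N (\<lambda>_. 1) X" for N
  proof -
    have "upper.S N (\<lambda>x. (0 + x) powr (- s) * (lam + x) powr s) (\<lambda>x. (0 + x) powr (- s) * (lam + x) powr s)"
      by (intro upper.symb_mult upper.symb_powr_shift[OF id_pos] upper.symb_powr_shift[OF lam_pos]) auto
    then have "upper.S N X X" by (simp add: X_def[abs_def])
    then show ?thesis by (rule upper.symb_weaken[OF _ X_le])
  qed
  have S_inv: "upper.S N (\<lambda>x. decay x / (1 + x)) (\<lambda>x. inverse x * inverse (lam + x))" for N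
  proof -
    have 1: "upper.S N decay (\<lambda>x. inverse x)"
      using upper.symb_weaken[OF upper.symb_inverse_shift[OF id_pos, of N], where K = 2 and V = "\<lambda>x. decay x"] iv by auto
    have 2: "upper.S N decay (\<lambda>x. inverse (lam + x))"
      by (rule upper.symb_weaken[OF upper.symb_inverse_shift[OF lam_pos], where K = 1]) (use iv in auto)
    have "upper.S N (\<lambda>x. decay x * decay x) (\<lambda>x. inverse x * inverse (lam + x))"
      by (rule upper.symb_mult[OF 1 2]) (use iv in auto)
    then show ?thesis by (simp add: divide_inverse)
  qed
  have ln_u: "l x = ln ((lam + x) / x)" if "x \<in> upper_domain" for x
    using up[OF that] lam by (simp add: l_def ln_div)
  have l_bd: "0 \<le> l x" "l x \<le> lam * inverse x" if "x \<in> upper_domain" for x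
  proof -
    show "0 \<le> l x" using u(2)[OF that] by (simp add: ln_u[OF that])
    show "l x \<le> lam * inverse x" using ln_le_minus_one[of "(lam + x) / x"] u(2,3)[OF that] by (simp add: ln_u[OF that])
  qed
  have l_bd': "\<bar>l x\<bar> \<le> (2 * lam) * decay x" if "x \<in> upper_domain" for x
  proof -
    have "lam * inverse x \<le> lam * (2 * decay x)"
      using lam by (intro mult_left_mono iv(2) that) simp
    also have "\<dots> = (2 * lam) * decay x" by simp
    finally show ?thesis using l_bd[OF that] by linarith
  qed
  have S_l: "upper.S N decay l"
  proof (cases N)
    case 0
    then show ?thesis using l_bd' by auto
  next
    case (Suc m)
    show ?thesis unfolding Suc
    proof (rule upper.symb_SucI[OF _ l_bd'])
      show "(l has_real_derivative (- lam) * (inverse x * inverse (lam + x))) (at x)" if "x \<in> upper_domain" for x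
        unfolding l_def[abs_def] using up[OF that] lam by (auto intro!: derivative_eq_intros simp: field_simps)
      show "upper.S m (\<lambda>x. decay x / (1 + x)) (\<lambda>x. (- lam) * (inverse x * inverse (lam + x)))"
        using up by (intro upper.symb_cmult S_inv) (force intro: divide_nonneg_pos)
    qed auto
  qed
  have S_J: "upper.S N (\<lambda>_. 1) J"
  proof -
    have l32: "ln (3 / 2) > (0 :: real)" by simp
    have lx: "ln x \<ge> ln (3 / 2)" if "x \<in> upper_domain" for x using up[OF that] by simp
    have lx0: "ln x > 0" if "x \<in> upper_domain" for x using up[OF that] by simp
    have "upper.S N (\<lambda>x. ln (0 + x)) (\<lambda>x. ln (0 + x))"
    proof (rule upper.symb_ln_shift[OF id_pos, where C = 1 and K' = "1 / ln (3 / 2)"])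
      show "\<bar>ln (0 + x)\<bar> \<le> 1 * ln (0 + x)" if "x \<in> upper_domain" for x using lx0[OF that] by simp
      show "1 \<le> 1 / ln (3 / 2) * ln (0 + x)" if "x \<in> upper_domain" for x
        using lx[OF that] l32 by (simp add: pos_le_divide_eq)
    qed auto
    then have "upper.S N (\<lambda>x. inverse (ln (0 + x))) (\<lambda>x. inverse (ln (0 + x)))"
      by (rule upper.symb_inverse[where C = 1 and K = 1]) (use lx0 in \<open>force intro: less_imp_le\<close>)+
    then have "upper.S N (\<lambda>_. 1) (\<lambda>x. inverse (ln (0 + x)))"
    proof (rule upper.symb_weaken[where K = "inverse (ln (3 / 2))"])
      show "0 \<le> inverse (ln (0 + x))" if "x \<in> upper_domain" for x using lx0[OF that] by simp
      show "inverse (ln (0 + x)) \<le> inverse (ln (3 / 2)) * 1" if "x \<in> upper_domain" for x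
        using lx[OF that] l32 by (simp add: le_imp_inverse_le)
    qed
    then show ?thesis by (simp add: J_def[abs_def])
  qed
  \<comment> \<open>From \<open>exp t - 1 \<le> t exp t\<close> with \<open>t = s l\<close>.\<close>
  have X1_bd: "\<bar>X x - 1\<bar> \<le> (s * (1 + lam) powr s * (2 * lam)) * decay x" if x: "x \<in> upper_domain" for x
  proof -
    let ?t = "s * l x"
    have Xt: "X x = exp ?t" using lam up[OF x] by (simp add: X_eq[OF x] powr_def ln_u[OF x])
    have t: "?t \<ge> 0" using l_bd[OF x] s by simp
    have "1 - exp (- ?t) \<le> ?t" using exp_ge_add_one_self[of "- ?t"] by linarith
    then have "(1 - exp (- ?t)) * X x \<le> ?t * X x" using X_le[OF x] by (intro mult_right_mono) auto
    then have "X x - 1 \<le> ?t * X x" unfolding Xt by (simp add: left_diff_distrib flip: exp_add)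
    also have "\<dots> \<le> (s * ((2 * lam) * decay x)) * ((1 + lam) powr s * 1)"
      using s l_bd[OF x] l_bd'[OF x] X_le[OF x] by (intro mult_mono mult_left_mono) auto
    finally have "X x - 1 \<le> (s * (1 + lam) powr s * (2 * lam)) * decay x" by (simp add: mult_ac)
    moreover have "X x \<ge> 1" using t unfolding Xt by simp
    ultimately show ?thesis by simp
  qed
  have S_X1: "upper.S N decay (\<lambda>x. X x - 1)"
  proof (cases N)
    case 0
    then show ?thesis using X1_bd by auto
  next
    case (Suc m)
    show ?thesis unfolding Suc
    proof (rule upper.symb_SucI[OF _ X1_bd])
      show "((\<lambda>x. X x - 1) has_real_derivative (- s * lam) * (X x * (inverse x * inverse (lam + x)))) (at x)" if "x \<in> upper_domain" for x
        using DERIV_diff[OF ratio_powr_derivative[of x lam "- s"] DERIV_const, of 1] up[OF that] lam by (simp add: X_def)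
      have "upper.S m (\<lambda>x. 1 * (decay x / (1 + x))) (\<lambda>x. X x * (inverse x * inverse (lam + x)))"
        using up by (intro upper.symb_mult S_X S_inv) (force intro: divide_nonneg_pos)+
      then show "upper.S m (\<lambda>x. decay x / (1 + x)) (\<lambda>x. (- s * lam) * (X x * (inverse x * inverse (lam + x))))"
        using up by (intro upper.symb_cmult) (force intro: divide_nonneg_pos)+
    qed auto
  qed
  have "upper.S N (\<lambda>x. 1 * decay x * 1) (\<lambda>x. X x * l x * J x)"
    using iv by (intro upper.symb_mult S_X S_l S_J) auto
  then have "upper.S N decay (\<lambda>x. (X x - 1) + X x * l x * J x)"
    by (intro upper.symb_add S_X1) simp
  then show ?thesis
  proof (rule upper.symb_cong)
    fix x assume x: "x \<in> upper_domain"
    have "ln x > 0" using up[OF x] by simp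
    then show "X x - 1 + X x * l x * J x = (lam + x) powr s * ln (lam + x) / (x powr s * ln x) - 1"
      using up[OF x] by (simp add: X_def l_def J_def powr_minus field_simps)
  qed
qed

text \<open>The power \<open>k \<ge> s + 2\<close> of \<open>1 - v = O(1 / x)\<close> compensates the growth of the symbol, crudely bounded by
  \<open>x\<^sup>s\<^sup>+\<^sup>1\<close>, and leaves one factor \<open>1 / x\<close>.\<close>

lemma symb_cutoff_shifted:
  assumes lam: "lam > 1" and s: "s > 0" and k: "real k \<ge> s + 2"
  shows "tail.S N decay (\<lambda>x. (lam + x) powr s * ln (lam + x) * (1 - flat_exp 0 x) ^ k)"
proof -
  have lam_pos: "lam + x > 0" "1 + x \<le> 1 * (lam + x)" if "x \<in> tail_domain" for x using tail_pos(1)[OF that] lam by auto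
  have ln_bd: "\<bar>ln (lam + x)\<bar> \<le> 2 * (lam + x)" "1 \<le> 2 * (lam + x)" if "x \<in> tail_domain" for x
  proof -
    have z: "lam + x > 1 / 2" using tail_pos(1)[OF that] lam by linarith
    then show "1 \<le> 2 * (lam + x)" by simp
    have "ln (lam + x) \<le> lam + x - 1" using z by (intro ln_le_minus_one) auto
    moreover have "ln (inverse (lam + x)) \<le> inverse (lam + x) - 1" using z by (intro ln_le_minus_one) auto
    moreover have "inverse (lam + x) \<le> 2" using le_imp_inverse_le[of "1 / 2" "lam + x"] z by simp
    ultimately show "\<bar>ln (lam + x)\<bar> \<le> 2 * (lam + x)" using z by (simp add: ln_inverse)
  qed
  have "tail.S N (\<lambda>x. (lam + x) powr s * (lam + x) * decay x ^ k) (\<lambda>x. (lam + x) powr s * ln (lam + x) * (1 - flat_exp 0 x) ^ k)"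
  proof (intro tail.symb_mult tail.symb_power symb_one_minus_flat_exp)
    show "tail.S N (\<lambda>x. (lam + x) powr s) (\<lambda>x. (lam + x) powr s)" by (rule tail.symb_powr_shift[OF lam_pos])
    show "tail.S N (\<lambda>x. lam + x) (\<lambda>x. ln (lam + x))"
      by (rule tail.symb_ln_shift[OF lam_pos ln_bd])
  qed (use lam_pos tail_pos in \<open>force intro: less_imp_le\<close>)+
  then show ?thesis
  proof (rule tail.symb_weaken[where K = "(2 * lam) powr (s + 1) * 2 powr (k - s - 2)"])
    fix x assume x: "x \<in> tail_domain"
    define z where "z = 1 + x"
    have z: "z > 1 / 2" using tail_pos(1)[OF x] by (simp add: z_def)
    show "0 \<le> (lam + x) powr s * (lam + x) * decay x ^ k" using lam_pos[OF x] tail_pos[OF x] by simp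
    have "lam + x \<le> (2 * lam) * z"
    proof -
      have "(lam - 1) * 1 \<le> (lam - 1) * (2 * z)" using lam z by (intro mult_left_mono) auto
      then show ?thesis using z by (simp add: z_def algebra_simps)
    qed
    then have "(lam + x) powr (s + 1) \<le> ((2 * lam) * z) powr (s + 1)"
      using lam_pos[OF x] s by (intro powr_mono2) auto
    also have "\<dots> = (2 * lam) powr (s + 1) * z powr (s + 1)" using lam z by (simp add: powr_mult)
    finally have a: "(lam + x) powr (s + 1) \<le> (2 * lam) powr (s + 1) * z powr (s + 1)" .
    have "inverse z powr (k - s - 2) \<le> 2 powr (k - s - 2)"
      using z k le_imp_inverse_le[of "1 / 2" z] by (intro powr_mono2) auto
    moreover have "z powr (s + 1) * inverse z ^ k = inverse z powr (k - s - 2) * inverse z"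
    proof -
      have e1: "inverse z ^ k = z powr (- real k)" using z by (simp add: powr_minus powr_realpow power_inverse)
      have e2: "inverse z = z powr (- 1)" using z by (simp add: powr_minus)
      have e3: "inverse z powr (k - s - 2) = z powr (- (k - s - 2))"
        using z by (subst powr_minus) (simp add: inverse_powr)
      have "z powr (s + 1) * inverse z ^ k = z powr ((s + 1) + - real k)" by (simp only: e1 powr_add)
      also have "(s + 1) + - real k = - (k - s - 2) + - 1" by simp
      also have "z powr (- (k - s - 2) + - 1) = inverse z powr (k - s - 2) * inverse z" by (simp only: e3 powr_add e2[symmetric])
      finally show ?thesis .
    qed
    ultimately have b: "z powr (s + 1) * inverse z ^ k \<le> 2 powr (k - s - 2) * inverse z"
      using z by (simp add: mult_right_mono)
    have "(lam + x) powr s * (lam + x) * inverse z ^ k = (lam + x) powr (s + 1) * inverse z ^ k"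
      using lam_pos[OF x] by (simp add: powr_add)
    also have "\<dots> \<le> ((2 * lam) powr (s + 1) * z powr (s + 1)) * inverse z ^ k"
      using a z by (intro mult_right_mono) auto
    also have "\<dots> \<le> (2 * lam) powr (s + 1) * (2 powr (k - s - 2) * inverse z)"
      unfolding mult.assoc using b by (intro mult_left_mono) auto
    finally show "(lam + x) powr s * (lam + x) * decay x ^ k \<le> (2 * lam) powr (s + 1) * 2 powr (k - s - 2) * decay x"
      by (simp add: z_def mult.assoc)
  qed
qed

text \<open>Below \<open>2\<close> the function is identically \<open>-1\<close>; above \<open>3 / 2\<close> it is \<open>\<psi> (S / L - 1) - (1 - \<psi>)\<close> with
  \<open>\<psi> = 1 - (1 - v)\<^sup>k\<close>. The two open regions cover the domain, and symbol estimates are local.\<close>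

lemma symb_cutoff_quotient:
  assumes lam: "lam > 1" and s: "s > 0" and k: "k \<ge> 1"
  shows "tail.S N decay
    (\<lambda>x. (1 - ((1 - flat_exp 0 x) ^ k)) * ((lam + x) powr s * ln (lam + x) / (x powr s * ln x)) - 1)" (is "tail.S N _ ?w")
proof -
  let ?lo = "{- 1 / 2<..<2} :: real set"
  have S_R: "tail.S N decay (\<lambda>x. (1 - flat_exp 0 x) ^ k)"
  proof -
    have "tail.S N (\<lambda>x. decay x ^ k) (\<lambda>x. (1 - flat_exp 0 x) ^ k)"
      using tail_pos by (intro tail.symb_power symb_one_minus_flat_exp) auto
    then show ?thesis
    proof (rule tail.symb_weaken[where K = "2 ^ (k - 1)"])
      fix x assume x: "x \<in> tail_domain"
      show "0 \<le> decay x ^ k" using tail_pos[OF x] by simp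
      have "decay x ^ (k - 1) * decay x \<le> 2 ^ (k - 1) * decay x"
        using tail_pos[OF x] by (intro mult_right_mono power_mono) auto
      then show "decay x ^ k \<le> 2 ^ (k - 1) * decay x"
        using k by (cases k) (auto simp: mult.commute)
    qed
  qed
  have upper_sub: "upper_domain \<subseteq> tail_domain" by (auto simp: upper_domain_def tail_domain_def)
  have up: "0 \<le> decay x" "decay x \<le> 1" if "x \<in> upper_domain" for x
    using that by (auto simp: upper_domain_def field_simps)
  have S_R_up: "upper.S N decay (\<lambda>x. (1 - flat_exp 0 x) ^ k)"
    by (rule symb_mono[OF S_R upper_sub, where K = 1]) (use up in \<open>auto simp: upper_domain_def\<close>)
  have S_psi: "upper.S N (\<lambda>_. 1) (\<lambda>x. 1 - ((1 - flat_exp 0 x) ^ k))"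
  proof -
    have "upper.S N (\<lambda>_. 1) (\<lambda>x. - ((1 - flat_exp 0 x) ^ k))"
      by (intro upper.symb_minus upper.symb_weaken[OF S_R_up, where K = 1]) (use up in auto)
    from upper.symb_add[OF upper.symb_const[of N 1] this] show ?thesis by simp
  qed
  have "upper.S N (\<lambda>x. 1 * decay x) (\<lambda>x. (1 - ((1 - flat_exp 0 x) ^ k)) * ((lam + x) powr s * ln (lam + x) / (x powr s * ln x) - 1))"
    by (intro upper.symb_mult S_psi symb_quotient_minus_one lam s) (use up in auto)
  moreover have "upper.S N (\<lambda>x. 1 * decay x) (\<lambda>x. - ((1 - flat_exp 0 x) ^ k))"
    using S_R_up up by (auto intro!: upper.symb_minus)
  ultimately have "upper.S N (\<lambda>x. 1 * decay x) (\<lambda>x. (1 - ((1 - flat_exp 0 x) ^ k)) * ((lam + x) powr s * ln (lam + x) / (x powr s * ln x) - 1) + - ((1 - flat_exp 0 x) ^ k))"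
    by (rule upper.symb_add)
  then have 1: "upper.S N decay ?w"
    by (simp add: algebra_simps)
  interpret lo: symbol_scale "\<lambda>x. 1 + x" ?lo by standard auto
  have "lo.S N decay (\<lambda>_. -1)"
    by (rule lo.symb_weaken[OF lo.symb_const, where K = 3]) (auto simp: field_simps)
  then have 2: "lo.S N decay ?w"
    by (rule lo.symb_cong) (auto simp: flat_exp_def)
  have "symb N (\<lambda>x. 1 + x) (upper_domain \<union> ?lo) decay ?w"
    by (rule symb_union[OF 1 2]) (auto simp: upper_domain_def)
  also have "upper_domain \<union> ?lo = tail_domain" by (auto simp: upper_domain_def tail_domain_def)
  finally show ?thesis .
qed

theorem proposition1p7:
  fixes lam s :: real
  assumes "lam > 1" and "s > 0"
  shows "(\<exists>g :: real ^ 'n \<Rightarrow> real. integrable lborel g \<and>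
            (\<forall>\<xi>. complex_of_real (m_symbol s lam \<xi>) =
                   1 + fourier_transform (\<lambda>x. complex_of_real (g x)) \<xi>))
       \<and> (\<exists>\<mu> w :: (real ^ 'n) set \<Rightarrow> real.
            finite_signed_borel_measure \<mu> \<and> finite_signed_borel_measure w \<and>
            (\<forall>\<xi>. complex_of_real (shifted_log_symbol s lam \<xi>) =
                   fourier_transform_measure \<mu> \<xi> +
                   fourier_transform_measure w \<xi> * complex_of_real (log_symbol s \<xi>)) \<and>
            fourier_transform_measure \<mu> \<in> schwartz_multipliers \<and>
            fourier_transform_measure w \<in> schwartz_multipliers)"
proof -
  have "m_symbol s lam (- \<xi>) - 1 = m_symbol s lam \<xi> - 1" for \<xi> :: "real ^ 'n"
    by (simp add: m_symbol_def log_symbol_def shifted_log_symbol_def laplace_symbol_def)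
  from L1_symbol_real_even[OF L1_symbol_m_minus_one[OF assms] this]
  obtain g :: "real ^ 'n \<Rightarrow> real" where g: "integrable lborel g"
    "\<And>\<xi>. fourier_transform (\<lambda>x. complex_of_real (g x)) \<xi> = of_real (m_symbol s lam \<xi> - 1)" by blast
  define k where "k = nat \<lceil>s + 2\<rceil>"
  have k: "real k \<ge> s + 2" "k \<ge> 1" using assms unfolding k_def by linarith+
  \<comment> \<open>The radial profiles of the Fourier transforms of the two measures.\<close>
  define \<mu>h where "\<mu>h x = (lam + x) powr s * ln (lam + x) * (1 - flat_exp 0 x) ^ k" for x
  define wh where "wh x = (1 - ((1 - flat_exp 0 x) ^ k)) * ((lam + x) powr s * ln (lam + x) / (x powr s * ln x))" for x
  have S_\<mu>: "tail.S N decay \<mu>h" for N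
    unfolding \<mu>h_def[abs_def] by (rule symb_cutoff_shifted[OF assms k(1)])
  have S_w: "tail.S N decay (\<lambda>x. wh x - 1)" for N
    unfolding wh_def by (rule symb_cutoff_quotient[OF assms k(2)])
  have weak: "tail.S N (\<lambda>_. 1) f" if "tail.S N decay f" for N f
    by (rule tail.symb_weaken[OF that, where K = 2]) (use tail_pos in auto)
  have even: "laplace_symbol (- \<xi>) = laplace_symbol \<xi>" for \<xi> :: "real ^ 'n" by (simp add: laplace_symbol_def)
  obtain g\<^sub>1 :: "real ^ 'n \<Rightarrow> real" where g1: "integrable lborel g\<^sub>1"
    "\<And>\<xi>. fourier_transform (\<lambda>x. complex_of_real (g\<^sub>1 x)) \<xi> = of_real (\<mu>h (laplace_symbol \<xi>))"
    using L1_symbol_real_even[OF L1_symbol_tail[OF S_\<mu>]] even by metis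
  obtain g\<^sub>2 :: "real ^ 'n \<Rightarrow> real" where g2: "integrable lborel g\<^sub>2"
    "\<And>\<xi>. fourier_transform (\<lambda>x. complex_of_real (g\<^sub>2 x)) \<xi> = of_real (wh (laplace_symbol \<xi>) - 1)"
    using L1_symbol_real_even[OF L1_symbol_tail[OF S_w]] even by metis
  obtain \<mu> where \<mu>: "finite_signed_borel_measure \<mu>"
    "\<And>\<xi>. fourier_transform_measure \<mu> \<xi> = of_real 0 + fourier_transform (\<lambda>x. complex_of_real (g\<^sub>1 x)) \<xi>"
    using signed_measure_dirac_plus_L1[OF g1(1), of 0] by blast
  obtain w where w: "finite_signed_borel_measure w"
    "\<And>\<xi>. fourier_transform_measure w \<xi> = of_real 1 + fourier_transform (\<lambda>x. complex_of_real (g\<^sub>2 x)) \<xi>"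
    using signed_measure_dirac_plus_L1[OF g2(1), of 1] by blast
  have \<mu>_eq: "fourier_transform_measure \<mu> = (\<lambda>\<xi>. of_real (\<mu>h (laplace_symbol \<xi>)))"
    using \<mu>(2) g1(2) by (simp add: fun_eq_iff)
  have w_eq: "fourier_transform_measure w = (\<lambda>\<xi>. of_real (wh (laplace_symbol \<xi>)))"
    using w(2) g2(2) by (simp add: fun_eq_iff)
  have "shifted_log_symbol s lam \<xi> = \<mu>h (laplace_symbol \<xi>) + wh (laplace_symbol \<xi>) * log_symbol s \<xi>" for \<xi> :: "real ^ 'n"
  proof (cases "laplace_symbol \<xi> > 2")
    case True
    then have "\<xi> \<noteq> 0" "ln (laplace_symbol \<xi>) > 0" by (auto simp: laplace_symbol_def)
    then have "wh (laplace_symbol \<xi>) * log_symbol s \<xi> = (1 - (1 - flat_exp 0 (laplace_symbol \<xi>)) ^ k) * shifted_log_symbol s lam \<xi>"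
      using True by (simp add: wh_def log_symbol_def shifted_log_symbol_def)
    moreover have "\<mu>h (laplace_symbol \<xi>) = (1 - flat_exp 0 (laplace_symbol \<xi>)) ^ k * shifted_log_symbol s lam \<xi>"
      by (simp add: \<mu>h_def shifted_log_symbol_def)
    ultimately show ?thesis by (simp add: algebra_simps)
  next
    case False
    then show ?thesis by (simp add: shifted_log_symbol_def \<mu>h_def wh_def flat_exp_def)
  qed
  then have "complex_of_real (shifted_log_symbol s lam \<xi>) =
      fourier_transform_measure \<mu> \<xi> + fourier_transform_measure w \<xi> * complex_of_real (log_symbol s \<xi>)" for \<xi>
    by (simp add: \<mu>_eq w_eq flip: of_real_mult of_real_add)
  moreover have "fourier_transform_measure \<mu> \<in> schwartz_multipliers"
    unfolding \<mu>_eq by (rule schwartz_multiplier_tail) (rule weak[OF S_\<mu>])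
  moreover have "fourier_transform_measure w \<in> schwartz_multipliers"
  proof -
    have "tail.S N (\<lambda>_. 1) (\<lambda>x. (wh x - 1) + 1)" for N
      by (intro tail.symb_add weak S_w tail.symb_const)
    then have "tail.S N (\<lambda>_. 1) wh" for N by simp
    then show ?thesis unfolding w_eq by (rule schwartz_multiplier_tail)
  qed
  ultimately show ?thesis
    using g \<mu>(1) w(1) by (intro conjI exI[of _ g] exI[of _ \<mu>] exI[of _ w]) auto
qed

end
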